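(* For $\tau,w\in\mathbb{H}$ with $\tau\neq w$ define $$\widehat{\Phi}(\tau,w):= \frac{1}{\pi} \int_\tau^w \left(\ {}_{*}\!\!\int_{\tau}^{w_1} \frac{\left( 4f_0(\bm w)+g_0(\bm w)\right) \left( 1-\frac{\pi i}6(w_2-\tau)E_2(\tau)\right)}{(i(w_2-\tau))^{\frac32}}\, dw_2\right) \frac{dw_1}{\sqrt{i(w_1-\tau)}} ,$$ where $$f_0 (\bm w) := \vartheta_{3,1}^{[1]} (w_1) \vartheta_{3,2}^{[1]} (w_2) - \vartheta_{3,2}^{[1]} (w_1) \vartheta_{3,1}^{[1]} (w_2),\qquad g_0 (\bm w) :=\vartheta_{\frac32,1}^{[1]} (w_1) \vartheta_{\frac32,0}^{[1]} (w_2) -\vartheta_{\frac32,0}^{[1]} (w_1) \vartheta_{\frac32,1}^{[1]} (w_2).$$ Then for $M = \begin{pmatrix}a & b\\ c & d\end{pmatrix}\in \mathrm{SL}_2(\mathbb{Z})$ we have $$\widehat{\Phi} \left( \frac{a \tau + b}{c \tau + d}, \frac{a w + b}{c w + d} \right)=\nu_{\eta} (M)^{10}\, (c\tau +d)^3 \, \widehat{\Phi}(\tau,w).$$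
   Context: $\mathbb{H}$ is the upper half-plane, $q=e^{2\pi i\tau}$, $\bm w=(w_1,w_2)$, $E_2(\tau)=1-24\sum_{n\ge1}\sum_{d\mid n}d\,q^n$. For $k\in\mathbb{N}_0$: $\vartheta_{m,r}^{[k]}(\tau)=\sum_{n\in\mathbb{Z}+\frac{r}{2m}}n^k q^{mn^2}$ if $m\in\mathbb{Z}_{>0}$, and $\vartheta_{m,r}^{[k]}(\tau)=\sum_{n\in\mathbb{Z}+\frac{r}{2m}+\frac12}(-1)^{n-\frac{r+m}{2m}}n^kq^{mn^2}$ if $m\in\mathbb{Z}_{\geq0}+\frac12$. $\nu_\eta$ is the multiplier system of $\eta(\tau)=q^{1/24}\prod_{n\ge1}(1-q^n)$, i.e. $\eta\left(\frac{a\tau+b}{c\tau+d}\right)=\nu_\eta(M)(c\tau+d)^{1/2}\eta(\tau)$. Square roots are principal and $(x)^{3/2}=(\sqrt{x})^3$. All integrals (and one-sided limits) are along the hyperbolic geodesic from $\tau$ to $w$. For $w_1\in\mathbb{H}\setminus\{\tau\}$ the regularized integral is $${}_{*}\!\!\int_{\tau}^{w_1} \frac{f(w_2)}{(i (w_2-\tau))^{\frac{3}{2}}}\, dw_2 := \lim_{\mathfrak z \to \tau} \left(\int_{\mathfrak z}^{w_1} \frac{f(w_2)}{(i (w_2-\tau))^{\frac{3}{2}}}\, dw_2+ 2 i\, \frac{f(\tau)}{\sqrt{i(\mathfrak z-\tau)}}\right),$$ with integral and limit along the hyperbolic geodesic from $\tau$ to $w_1$. *)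

theory Defs
  imports "HOL-Complex_Analysis.Complex_Analysis"
begin

text \<open>The power \<open>q\<^sup>x\<close> for \<open>q = exp (2 \<pi> i \<tau>)\<close> and real \<open>x\<close>; the branch is part of the convention.\<close>

definition qpow :: "complex \<Rightarrow> real \<Rightarrow> complex" where
  "qpow \<tau> x = exp (2 * of_real pi * \<i> * of_real x * \<tau>)"

definition E2 :: "complex \<Rightarrow> complex" where
  "E2 \<tau> = 1 - 24 * (\<Sum>n. of_nat (\<Sum>d | d dvd Suc n. d) * qpow \<tau> (real (Suc n)))"

definition eta :: "complex \<Rightarrow> complex" where
  "eta \<tau> = qpow \<tau> (1 / 24) * (\<Prod>n. 1 - qpow \<tau> (real (Suc n)))"

definition moebius :: "int \<Rightarrow> int \<Rightarrow> int \<Rightarrow> int \<Rightarrow> complex \<Rightarrow> complex" where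
  "moebius a b c d z = (of_int a * z + of_int b) / (of_int c * z + of_int d)"

definition nu_eta :: "int \<Rightarrow> int \<Rightarrow> int \<Rightarrow> int \<Rightarrow> complex" where
  "nu_eta a b c d = (THE \<nu>. \<forall>\<tau>. Im \<tau> > 0 \<longrightarrow>
     eta (moebius a b c d \<tau>) = \<nu> * csqrt (of_int c * \<tau> + of_int d) * eta \<tau>)"

text \<open>\<open>theta k m r\<close> is \<open>\<vartheta>\<^bsub>m,r\<^esub>\<^bsup>[k]\<^esup>\<close>, meant for positive \<open>m\<close> in \<open>\<int>\<close> or in \<open>\<int> + 1/2\<close>. The sum over
  a coset of \<open>\<int>\<close> is indexed by \<open>j \<in> \<int>\<close>. For half-integral \<open>m\<close> the exponent of the sign is
  \<open>n - (r + m) / (2 m) = (j + r / (2 m) + 1/2) - (r / (2 m) + 1/2) = j\<close>.\<close>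

definition theta :: "nat \<Rightarrow> real \<Rightarrow> int \<Rightarrow> complex \<Rightarrow> complex" where
  "theta k m r \<tau> =
    (if m \<in> \<int> then
       (\<Sum>\<^sub>\<infinity>j::int. let n = of_int j + of_int r / (2 * m)
                  in of_real (n ^ k) * qpow \<tau> (m * n\<^sup>2))
     else
       (\<Sum>\<^sub>\<infinity>j::int. let n = of_int j + of_int r / (2 * m) + 1 / 2
                  in (-1) powi j * of_real (n ^ k) * qpow \<tau> (m * n\<^sup>2)))"

definition f0 :: "complex \<Rightarrow> complex \<Rightarrow> complex" where
  "f0 w1 w2 = theta 1 3 1 w1 * theta 1 3 2 w2 - theta 1 3 2 w1 * theta 1 3 1 w2"

definition g0 :: "complex \<Rightarrow> complex \<Rightarrow> complex" where
  "g0 w1 w2 = theta 1 (3/2) 1 w1 * theta 1 (3/2) 0 w2 - theta 1 (3/2) 0 w1 * theta 1 (3/2) 1 w2"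

text \<open>The hyperbolic geodesic between two points of the upper half-plane is a vertical segment or an
  arc of the circle through both points whose centre lies on the real axis. Seen from that centre,
  both points have their argument in \<open>(0, \<pi>)\<close>, so the arc stays in the upper half-plane.\<close>

definition geodesic_centre :: "complex \<Rightarrow> complex \<Rightarrow> complex" where
  "geodesic_centre z w = of_real (((cmod w)\<^sup>2 - (cmod z)\<^sup>2) / (2 * (Re w - Re z)))"

definition geodesic :: "complex \<Rightarrow> complex \<Rightarrow> real \<Rightarrow> complex" where
  "geodesic z w =
    (if Re z = Re w then linepath z w
     else let x = geodesic_centre z w
          in part_circlepath x (cmod (z - x)) (Arg (z - x)) (Arg (w - x)))"

lemma cmod_geodesic_centre:
  assumes "Re z \<noteq> Re w"
  shows "cmod (w - geodesic_centre z w) = cmod (z - geodesic_centre z w)"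
proof -
  define t where "t = ((cmod w)\<^sup>2 - (cmod z)\<^sup>2) / (2 * (Re w - Re z))"
  have t: "2 * t * (Re w - Re z) = (Re w)\<^sup>2 + (Im w)\<^sup>2 - (Re z)\<^sup>2 - (Im z)\<^sup>2"
    using assms by (simp add: t_def cmod_power2 divide_simps) (simp add: algebra_simps)
  have "(Re w - t)\<^sup>2 + (Im w)\<^sup>2 = (Re z - t)\<^sup>2 + (Im z)\<^sup>2"
    using t by (simp add: power2_eq_square algebra_simps)
  moreover have "geodesic_centre z w = of_real t"
    by (simp only: geodesic_centre_def t_def)
  ultimately show ?thesis
    by (simp add: cmod_def)
qed

lemma pathstart_geodesic: "pathstart (geodesic z w) = z"
  using rcis_cmod_Arg [of "z - geodesic_centre z w"]
  by (auto simp: geodesic_def Let_def rcis_def cis_conv_exp algebra_simps)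

lemma pathfinish_geodesic: "pathfinish (geodesic z w) = w"
  using rcis_cmod_Arg [of "w - geodesic_centre z w"] cmod_geodesic_centre [of z w]
  by (auto simp: geodesic_def Let_def rcis_def cis_conv_exp algebra_simps)

lemma geodesic_upper_half_plane:
  assumes "Im z > 0" "Im w > 0" "u \<in> path_image (geodesic z w)"
  shows "Im u > 0"
proof (cases "Re z = Re w")
  case True
  have "convex {u. Im u > 0}"
    by (rule convex_halfspace_Im_gt)
  then have "closed_segment z w \<subseteq> {u. Im u > 0}"
    using assms(1,2) by (simp add: closed_segment_subset)
  with assms(3) True show ?thesis
    by (auto simp: geodesic_def)
next
  case False
  define x where "x = geodesic_centre z w"
  have x: "Im x = 0"
    by (simp add: x_def geodesic_centre_def)
  have Arg: "0 < Arg (v - x) \<and> Arg (v - x) < pi" if "Im v > 0" for v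
    using that x by (simp add: Arg_lt_pi)
  obtain s where s: "s \<in> closed_segment (Arg (z - x)) (Arg (w - x))"
    and u: "u = x + cmod (z - x) * exp (\<i> * of_real s)"
    using assms(3) False by (auto simp: geodesic_def Let_def x_def path_image_part_circlepath' cis_conv_exp)
  have "0 < s" "s < pi"
    using s Arg [OF assms(1)] Arg [OF assms(2)]
    by (auto simp: closed_segment_eq_real_ivl split: if_splits)
  moreover have "cmod (z - x) > 0"
    using assms(1) x by auto
  ultimately show ?thesis
    using u x by (simp add: Im_exp sin_gt_zero)
qed

text \<open>The regularized integral of \<open>f v / (i (v - \<tau>))\<^bsup>3/2\<^esup>\<close> over \<open>v\<close> from \<open>\<tau>\<close> to \<open>w1\<close>, where \<open>x\<^bsup>3/2\<^esup>\<close> is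
  the cube of the principal square root. The geodesic from a point \<open>z\<close> on \<open>geodesic \<tau> w1\<close> to \<open>w1\<close>
  is a piece of \<open>geodesic \<tau> w1\<close>.\<close>

definition reg_integral :: "complex \<Rightarrow> complex \<Rightarrow> (complex \<Rightarrow> complex) \<Rightarrow> complex" where
  "reg_integral \<tau> w1 f =
    Lim (at \<tau> within path_image (geodesic \<tau> w1))
      (\<lambda>z. contour_integral (geodesic z w1) (\<lambda>v. f v / csqrt (\<i> * (v - \<tau>)) ^ 3)
           + 2 * \<i> * f \<tau> / csqrt (\<i> * (z - \<tau>)))"

definition Phi_hat :: "complex \<Rightarrow> complex \<Rightarrow> complex" where
  "Phi_hat \<tau> w = 1 / of_real pi *
    contour_integral (geodesic \<tau> w) (\<lambda>w1.
      reg_integral \<tau> w1 (\<lambda>w2. (4 * f0 w1 w2 + g0 w1 w2)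
                                * (1 - of_real pi * \<i> / 6 * (w2 - \<tau>) * E2 \<tau>))
      / csqrt (\<i> * (w1 - \<tau>)))"

end

theory Submission
  imports Defs "HOL-Probability.Characteristic_Functions"
begin

text \<open>
  Integrating by parts once, the inner regularized integral of \<open>f v / (i (v - \<tau>))\<^bsup>3/2\<^esup>\<close> equals
  \<open>Q w\<^sub>1 / (i (w\<^sub>1 - \<tau>))\<^bsup>1/2\<^esup>\<close>, where \<open>Q\<close> is the unique holomorphic solution of
  \<open>(v - \<tau>) Q' - Q / 2 = - i f\<close> on the upper half-plane. The two square roots in the outer integrand then
  combine to \<open>i (w\<^sub>1 - \<tau>)\<close>. As \<open>4 f\<^sub>0 + g\<^sub>0\<close> vanishes on the diagonal, the outer integrand extends to a
  holomorphic function, so that only the end points of the geodesic matter and the claim is a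
  comparison of primitives. Uniqueness of \<open>Q\<close> transports the modularity of \<open>4 f\<^sub>0 + g\<^sub>0\<close> and \<open>E\<^sub>2\<close> to it.

  The modularity of \<open>\<eta>\<close> and of the theta series comes from Poisson summation for Gaussians, with Euler's
  pentagonal number theorem expressing \<open>\<eta>\<close> as a theta series; that of \<open>E\<^sub>2\<close> follows by logarithmic
  differentiation of \<open>\<eta>\<close>.
\<close>

section \<open>Jacobi's theta function\<close>

text \<open>Where the exponents 3 and 10 come from: write J(v) = c v + d and count powers.
  \<open>f0\<close> and \<open>g0\<close> are 2 by 2 determinants in theta series of weight 3/2;
  both generators multiply the two determinants by the same scalar, so \<open>4 * f0 + g0\<close>
  has weight 3/2 in each variable, with the multiplier of \<eta>(w1)^3 \<eta>(w2)^3 times \<nu>^4.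
  In w2 the measure contributes J(w2)^(-1/2) J(\<tau>)^(3/2), so a factor J(w2) is left over; the
  \<open>E2\<close> bracket contributes J(\<tau>) / J(w2) and removes it. In w1 everything cancels
  up to J(\<tau>)^(1/2). The total is J(\<tau>)^(3/2 + 1 + 1/2) and \<nu>^(6 + 4). The obstacle is
  the principal root: its cut runs straight up from \<tau>, vertical geodesics may lie on it, and
  Moebius maps do not respect it. Hence no root of J is used in transporting \<open>Q\<close>: the
  quotient \<eta>(M v) / \<eta>(v), whose square is a multiple of J, stands in for it.\<close>

lemma infsum_holomorphic:
  fixes f f' :: "'a \<Rightarrow> complex \<Rightarrow> complex"
  assumes S: "open S"
    and der: "\<And>n z. z \<in> S \<Longrightarrow> (f n has_field_derivative f' n z) (at z)"
    and bound: "\<And>z. z \<in> S \<Longrightarrow> \<exists>r>0. \<exists>M. M summable_on UNIV \<and> (\<forall>n. \<forall>u \<in> ball z r \<inter> S. norm (f n u) \<le> M n)"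
    and z: "z \<in> S"
  shows "((\<lambda>z. \<Sum>\<^sub>\<infinity>n. f n z) has_field_derivative (\<Sum>\<^sub>\<infinity>n. f' n z)) (at z)"
    and "((\<lambda>n. f' n z) has_sum (\<Sum>\<^sub>\<infinity>n. f' n z)) UNIV"
proof -
  obtain r0 M where r0: "r0 > 0" and M: "M summable_on UNIV"
    and le: "\<And>n u. u \<in> ball z r0 \<inter> S \<Longrightarrow> norm (f n u) \<le> M n"
    using bound [OF z] by blast
  obtain r1 where r1: "r1 > 0" "cball z r1 \<subseteq> S"
    using S z open_contains_cball by blast
  define r where "r = min (r0 / 2) r1"
  have r: "r > 0" "cball z r \<subseteq> ball z r0 \<inter> S"
    using r0 r1 by (auto simp: r_def subset_iff)
  have ul: "uniform_limit (cball z r) (\<lambda>X y. \<Sum>n\<in>X. f n y) (\<lambda>y. \<Sum>\<^sub>\<infinity>n. f n y) (finite_subsets_at_top UNIV)"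
    by (rule Weierstrass_m_test_general [OF _ M]) (use le r(2) in blast)
  have "\<forall>\<^sub>F X in finite_subsets_at_top UNIV. continuous_on (cball z r) (\<lambda>y. \<Sum>n\<in>X. f n y) \<and>
          (\<forall>w \<in> ball z r. ((\<lambda>y. \<Sum>n\<in>X. f n y) has_field_derivative (\<Sum>n\<in>X. f' n w)) (at w))"
  proof (intro always_eventually allI conjI ballI)
    fix X :: "'a set"
    show "continuous_on (cball z r) (\<lambda>y. \<Sum>n\<in>X. f n y)"
      by (intro continuous_intros continuous_at_imp_continuous_on ballI DERIV_isCont [OF der]) (use r in auto)
    fix w assume "w \<in> ball z r"
    then show "((\<lambda>y. \<Sum>n\<in>X. f n y) has_field_derivative (\<Sum>n\<in>X. f' n w)) (at w)"
      using r by (intro DERIV_sum der) auto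
  qed
  \<comment> \<open>Uniform limits of holomorphic functions may be differentiated, also along the
    net of finite subsets. A majorant for the terms \<open>f n\<close> alone is enough: convergence
    of the differentiated series comes out as a conclusion, and later supplies the summability of
    series with weight \<open>n\<close>.\<close>
  from has_complex_derivative_uniform_limit [OF this ul _ r(1)]
  obtain g' where g': "\<And>w. w \<in> ball z r \<Longrightarrow> ((\<lambda>y. \<Sum>\<^sub>\<infinity>n. f n y) has_field_derivative g' w) (at w) \<and>
      ((\<lambda>X. \<Sum>n\<in>X. f' n w) \<longlongrightarrow> g' w) (finite_subsets_at_top UNIV)"
    by (metis finite_subsets_at_top_neq_bot)
  have hs: "((\<lambda>n. f' n z) has_sum g' z) UNIV"
    using g' [of z] r by (auto simp: has_sum_def)
  then show "((\<lambda>n. f' n z) has_sum (\<Sum>\<^sub>\<infinity>n. f' n z)) UNIV"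
    by (simp add: has_sum_infsum has_sum_imp_summable)
  show "((\<lambda>z. \<Sum>\<^sub>\<infinity>n. f n z) has_field_derivative (\<Sum>\<^sub>\<infinity>n. f' n z)) (at z)"
    using g' [of z] r infsumI [OF hs] by simp
qed

lemma summable_on_exp_minus_abs: "(\<lambda>n::int. exp (- \<bar>real_of_int n\<bar>)) summable_on UNIV"
proof -
  have *: "(\<lambda>n::nat. exp (- real n)) summable_on UNIV"
  proof -
    have "summable (\<lambda>n::nat. exp (-1::real) ^ n)"
      by (rule summable_geometric) simp
    then have "summable (\<lambda>n::nat. exp (- real n))"
      by (simp flip: exp_of_nat_mult)
    then show ?thesis
      by (intro norm_summable_imp_summable_on) simp
  qed
  have 1: "(\<lambda>n::int. exp (- \<bar>real_of_int n\<bar>)) summable_on (range int)"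
    using * by (subst summable_on_reindex) (auto simp: o_def inj_on_def)
  have 2: "(\<lambda>n::int. exp (- \<bar>real_of_int n\<bar>)) summable_on (range (\<lambda>n. - int n))"
    using * by (subst summable_on_reindex) (auto simp: o_def inj_on_def)
  have "(UNIV::int set) = range int \<union> range (\<lambda>n. - int n)"
    by (auto simp: image_iff) (metis int_cases2)
  with summable_on_union [OF 1 2] show ?thesis by simp
qed

text \<open>The parameter \<open>t\<close> is - i times a point of the upper half-plane: on the
  right half-plane inversion sends \<open>t\<close> to \<open>1 / t\<close>, the principal square
  root has no cut, and real \<open>t\<close> give genuine Gaussians in \<open>u\<close>.\<close>

abbreviation gauss :: "complex \<Rightarrow> complex \<Rightarrow> complex \<Rightarrow> complex" where
  "gauss t u z \<equiv> exp (- of_real pi * t * u\<^sup>2 + 2 * of_real pi * \<i> * u * z)"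

definition jtheta :: "complex \<Rightarrow> complex \<Rightarrow> complex" where
  "jtheta t z = (\<Sum>\<^sub>\<infinity>n::int. gauss t (of_int n) z)"

text \<open>Completing the square in |n|: the Gaussian absorbs the exponential growth at rate
  \<open>2 * pi * R\<close> and one unit more, hence the \<open>+ 1\<close> in \<open>B\<close>. The
  constant depends only on \<sigma> and \<open>R\<close>, so that one summable majorant serves a
  whole half-plane of \<open>t\<close> and a whole strip of \<open>z\<close>.\<close>

lemma jtheta_term_bound:
  assumes "\<sigma> > 0"
  obtains C where "\<And>t z n. Re t \<ge> \<sigma> \<Longrightarrow> \<bar>Im z\<bar> \<le> R \<Longrightarrow>
    norm (gauss t (of_int n) z) \<le> C * exp (- \<bar>real_of_int n\<bar>)"
proof 
  fix t z :: complex and n :: int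
  assume t: "Re t \<ge> \<sigma>" and z: "\<bar>Im z\<bar> \<le> R"
  define x where "x = \<bar>real_of_int n\<bar>"
  define B where "B = 2 * pi * R + 1"
  have "- (pi * Re t * (real_of_int n)\<^sup>2) - 2 * pi * n * Im z \<le> - (pi * \<sigma> * x\<^sup>2) + 2 * pi * x * R"
  proof -
    have "pi * \<sigma> * (real_of_int n)\<^sup>2 \<le> pi * Re t * (real_of_int n)\<^sup>2"
      using t by (intro mult_right_mono mult_left_mono) auto
    moreover have "- (real_of_int n * Im z) \<le> x * R"
      using z unfolding x_def by (metis abs_le_D2 abs_mult abs_ge_zero mult_left_mono)
    then have "2 * pi * - (real_of_int n * Im z) \<le> 2 * pi * (x * R)"
      by (intro mult_left_mono) auto
    moreover have "2 * pi * - (real_of_int n * Im z) = - (2 * pi * n * Im z)" "2 * pi * (x * R) = 2 * pi * x * R"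
      by simp_all
    moreover have "pi * \<sigma> * x\<^sup>2 = pi * \<sigma> * (real_of_int n)\<^sup>2"
      by (simp add: x_def)
    ultimately show ?thesis by linarith
  qed
  also have "\<dots> \<le> B\<^sup>2 / (4 * pi * \<sigma>) - x"
  proof -
    have "0 \<le> (2 * pi * \<sigma> * x - B)\<^sup>2 / (4 * pi * \<sigma>)"
      using assms by simp
    also have "\<dots> = pi * \<sigma> * x\<^sup>2 - B * x + B\<^sup>2 / (4 * pi * \<sigma>)"
      using assms by (simp add: field_simps power2_eq_square)
    finally show ?thesis by (simp add: B_def algebra_simps)
  qed
  finally have "- (pi * Re t * (real_of_int n)\<^sup>2) - 2 * pi * n * Im z \<le> B\<^sup>2 / (4 * pi * \<sigma>) - x" .
  then have "exp (- (2 * pi * n * Im z) - pi * Re t * (real_of_int n)\<^sup>2) \<le> exp (B\<^sup>2 / (4 * pi * \<sigma>)) * exp (- x)"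
    by (simp flip: exp_add)
  moreover have "Re ((of_int n)\<^sup>2 :: complex) = (real_of_int n)\<^sup>2" "Im ((of_int n)\<^sup>2 :: complex) = 0"
    by (simp_all add: power2_eq_square)
  ultimately show "norm (gauss t (of_int n) z)
      \<le> exp ((2 * pi * R + 1)\<^sup>2 / (4 * pi * \<sigma>)) * exp (- \<bar>real_of_int n\<bar>)"
    by (simp add: x_def B_def algebra_simps)
qed

lemma jtheta_summable:
  assumes "Re t > 0"
  shows "(\<lambda>n::int. gauss t (of_int n) z) summable_on UNIV"
proof -
  obtain C where C: "\<And>t' z' n. Re t' \<ge> Re t \<Longrightarrow> \<bar>Im z'\<bar> \<le> \<bar>Im z\<bar> \<Longrightarrow>
    norm (gauss t' (of_int n) z') \<le> C * exp (- \<bar>real_of_int n\<bar>)"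
    using jtheta_term_bound [OF assms, of "\<bar>Im z\<bar>"] by blast
  have *: "(\<lambda>n. C * exp (- \<bar>real_of_int n\<bar>)) summable_on UNIV"
    by (rule summable_on_cmult_right [OF summable_on_exp_minus_abs])
  show ?thesis
    by (rule abs_summable_summable, rule summable_on_comparison_test [OF *]) (use C [of t z] in auto)
qed

lemma jtheta_has_field_derivative_z:
  assumes "Re t > 0"
  shows "(jtheta t has_field_derivative (\<Sum>\<^sub>\<infinity>n::int. 2 * of_real pi * \<i> * of_int n *
            gauss t (of_int n) z)) (at z)"
    and "(\<lambda>n::int. 2 * of_real pi * \<i> * of_int n *
            gauss t (of_int n) z) summable_on UNIV"
proof -
  let ?f = "\<lambda>(n::int) z. gauss t (of_int n) z"
  have b: "\<exists>r>0. \<exists>M. M summable_on UNIV \<and> (\<forall>n. \<forall>u \<in> ball z r \<inter> UNIV. norm (?f n u) \<le> M n)" for z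
  proof -
    obtain C where C: "\<And>t' z' n. Re t' \<ge> Re t \<Longrightarrow> \<bar>Im z'\<bar> \<le> \<bar>Im z\<bar> + 1 \<Longrightarrow>
      norm (gauss t' (of_int n) z') \<le> C * exp (- \<bar>real_of_int n\<bar>)"
      using jtheta_term_bound [OF assms, of "\<bar>Im z\<bar> + 1"] by blast
    have "\<bar>Im u\<bar> \<le> \<bar>Im z\<bar> + 1" if "u \<in> ball z 1" for u
      using abs_Im_le_cmod [of "u - z"] that by (simp add: dist_norm norm_minus_commute)
    then show ?thesis
      using C summable_on_cmult_right [OF summable_on_exp_minus_abs, of C] 
      by (intro exI [of _ 1] conjI exI [of _ "\<lambda>n. C * exp (- \<bar>real_of_int n\<bar>)"]) auto
  qed
  have d: "(?f n has_field_derivative 2 * of_real pi * \<i> * of_int n * ?f n z) (at z)" for n z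
    by (auto intro!: derivative_eq_intros)
  note * = infsum_holomorphic [where f = ?f and S = UNIV, OF open_UNIV d b UNIV_I]
  show "(jtheta t has_field_derivative (\<Sum>\<^sub>\<infinity>n::int. 2 * of_real pi * \<i> * of_int n * ?f n z)) (at z)"
    unfolding jtheta_def [abs_def] by (rule *(1))
  show "(\<lambda>n::int. 2 * of_real pi * \<i> * of_int n * ?f n z) summable_on UNIV"
    using *(2) by (rule has_sum_imp_summable)
qed

text \<open>On a small closed disc compactness bounds the real part of \<open>g\<close> from below
  and the imaginary part of \<open>h\<close>, so the uniform term bound applies although both
  parameters vary. Exponential weights leave ample room for the linear weight of the derivative
  series.\<close>

lemma jtheta_weighted_holomorphic:
  fixes p :: "int \<Rightarrow> complex"
  assumes S: "open S" and g: "g holomorphic_on S" and h: "h holomorphic_on S"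
    and pos: "\<And>t. t \<in> S \<Longrightarrow> Re (g t) > 0"
    and p: "\<And>n. norm (p n) \<le> K * exp (2 * pi * \<bar>real_of_int n\<bar>)"
  shows "(\<lambda>t. \<Sum>\<^sub>\<infinity>n::int. p n * gauss (g t) (of_int n) (h t)) holomorphic_on S"
proof -
  let ?e = "\<lambda>(n::int) t z. gauss t (of_int n) z"
  let ?f = "\<lambda>n t. p n * ?e n (g t) (h t)"
  have K: "K \<ge> 0"
    using order_trans [OF norm_ge_zero p [of 0]] by simp
  have b: "\<exists>r>0. \<exists>M. M summable_on UNIV \<and> (\<forall>n. \<forall>u \<in> ball t r \<inter> S. norm (?f n u) \<le> M n)" 
    if t: "t \<in> S" for t
  proof -
    obtain r where r: "r > 0" "cball t r \<subseteq> S"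
      using S t open_contains_cball by blast
    have cont: "continuous_on (cball t r) g" "continuous_on (cball t r) h"
      using g h r(2) holomorphic_on_imp_continuous_on holomorphic_on_subset by blast+
    have cont': "continuous_on (cball t r) (\<lambda>u. Re (g u))" "continuous_on (cball t r) (\<lambda>u. \<bar>Im (h u)\<bar>)"
      by (intro continuous_intros cont)+
    obtain t0 where t0: "t0 \<in> cball t r" "\<And>u. u \<in> cball t r \<Longrightarrow> Re (g t0) \<le> Re (g u)"
      using continuous_attains_inf [of "cball t r" "\<lambda>u. Re (g u)"] r(1) cont' by auto
    obtain t1 where t1: "t1 \<in> cball t r" "\<And>u. u \<in> cball t r \<Longrightarrow> \<bar>Im (h u)\<bar> \<le> \<bar>Im (h t1)\<bar>"
      using continuous_attains_sup [of "cball t r" "\<lambda>u. \<bar>Im (h u)\<bar>"] r(1) cont' by auto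
    have "Re (g t0) > 0" using t0(1) r(2) pos by blast
    then obtain C where C: "\<And>t' z n. Re t' \<ge> Re (g t0) \<Longrightarrow> \<bar>Im z\<bar> \<le> \<bar>Im (h t1)\<bar> + 1 \<Longrightarrow>
      norm (?e n t' z) \<le> C * exp (- \<bar>real_of_int n\<bar>)"
      using jtheta_term_bound by blast
    have "norm (?f n u) \<le> K * (C * exp (- \<bar>real_of_int n\<bar>))" if u: "u \<in> ball t r" for u n
    proof -
      \<comment> \<open>Moving the argument by - i sgn n multiplies the \<open>n\<close>-th term by
        exp (2 pi |n|) and stays in the strip enlarged by 1, so the unweighted bound there already
        bounds the weighted term.\<close>
      define z where "z = h u - \<i> * of_real (sgn (real_of_int n))"
      have "\<bar>Im z\<bar> \<le> \<bar>Im (h u)\<bar> + 1"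
        by (auto simp: z_def sgn_if)
      then have "norm (?e n (g u) z) \<le> C * exp (- \<bar>real_of_int n\<bar>)"
        using u t0(2) [of u] t1(2) [of u] by (intro C) auto
      moreover have "?e n (g u) z = of_real (exp (2 * pi * \<bar>real_of_int n\<bar>)) * ?e n (g u) (h u)"
      proof -
        have "of_int n * (of_real (sgn (real_of_int n)) :: complex) = of_real \<bar>real_of_int n\<bar>"
          by (simp add: sgn_if)
        then have "2 * of_real pi * \<i> * of_int n * z = of_real (2 * pi * \<bar>real_of_int n\<bar>) + 2 * of_real pi * \<i> * of_int n * h u"
          by (simp add: z_def algebra_simps)
        then show ?thesis
          unfolding exp_of_real [symmetric] exp_add [symmetric] by (intro arg_cong [where f = exp]) simp
      qed
      then have "norm (?e n (g u) z) = exp (2 * pi * \<bar>real_of_int n\<bar>) * norm (?e n (g u) (h u))"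
        by (simp only: norm_mult norm_of_real abs_exp_cancel)
      moreover have "norm (?f n u) \<le> K * exp (2 * pi * \<bar>real_of_int n\<bar>) * norm (?e n (g u) (h u))"
        unfolding norm_mult by (intro mult_right_mono p) simp
      ultimately show ?thesis
        using K mult_left_mono by (fastforce simp only: mult.assoc)
    qed
    moreover have "(\<lambda>n::int. K * (C * exp (- \<bar>real_of_int n\<bar>))) summable_on UNIV"
      by (intro summable_on_cmult_right summable_on_exp_minus_abs)
    ultimately show ?thesis
      using r(1) by blast
  qed
  have d: "(?f n has_field_derivative deriv (?f n) t) (at t)" if "t \<in> S" for n t
    by (rule holomorphic_derivI [OF _ S that]) (intro holomorphic_intros g h)
  note * = infsum_holomorphic [where f = ?f and S = S, OF S d b]
  show ?thesis
    unfolding holomorphic_on_open [OF S] using *(1) by blast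
qed

lemma jtheta_holomorphic_compose:
  assumes "open S" "g holomorphic_on S" "h holomorphic_on S"
    and "\<And>t. t \<in> S \<Longrightarrow> Re (g t) > 0"
  shows "(\<lambda>t. jtheta (g t) (h t)) holomorphic_on S"
  using jtheta_weighted_holomorphic [OF assms, of "\<lambda>_. 1" 1] by (simp add: jtheta_def)


text \<open>Symmetric ranges fit the partial sums of Fourier series and of the pentagonal series,
  half-open ones the telescoping of \<open>F (n + 1) - F n\<close>.\<close>

lemma has_sum_int_LIMSEQ:
  fixes f :: "int \<Rightarrow> 'a :: {comm_monoid_add, topological_space}"
  assumes "(f has_sum S) UNIV"
  shows "(\<lambda>N. \<Sum>k = - int N .. int N. f k) \<longlonglongrightarrow> S"
    and "(\<lambda>N. \<Sum>k \<in> {- int N..<int N}. f k) \<longlonglongrightarrow> S"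
proof -
  have 1: "\<forall>\<^sub>F N in sequentially. X \<subseteq> {- int N..<int N}" if "finite X" for X
  proof -
    define B where "B = Max (abs ` X)"
    have B: "\<bar>x\<bar> \<le> B" if "x \<in> X" for x
      unfolding B_def using \<open>finite X\<close> that by (intro Max_ge) auto
    have "X \<subseteq> {- int N..<int N}" if "N \<ge> nat (B + 1)" for N
      using B that by (force simp: abs_le_iff)
    then show ?thesis by (rule eventually_sequentiallyI)
  qed
  have "{- int N..<int N} \<subseteq> {- int N..int N}" for N by auto
  with 1 have 2: "\<forall>\<^sub>F N in sequentially. X \<subseteq> {- int N..int N}" if "finite X" for X
    by (smt (verit) eventually_mono subset_trans that)
  have S: "(sum f \<longlongrightarrow> S) (finite_subsets_at_top UNIV)"
    using assms by (simp add: has_sum_def)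
  show "(\<lambda>N. \<Sum>k = - int N .. int N. f k) \<longlonglongrightarrow> S"
    by (rule filterlim_compose [OF S]) (use 2 in \<open>auto simp: filterlim_finite_subsets_at_top\<close>)
  show "(\<lambda>N. \<Sum>k \<in> {- int N..<int N}. f k) \<longlonglongrightarrow> S"
    by (rule filterlim_compose [OF S]) (use 1 in \<open>auto simp: filterlim_finite_subsets_at_top\<close>)
qed

section \<open>Convergence of Fourier series of entire periodic functions\<close>

lemma holomorphic_factor_zero:
  assumes "f holomorphic_on S" "open S" "a \<in> S" "f a = 0"
  obtains g where "g holomorphic_on S" "\<And>z. z \<in> S \<Longrightarrow> f z = (z - a) * g z" "g a = deriv f a"
proof
  show "(\<lambda>z. if z = a then deriv f a else (f z - f a) / (z - a)) holomorphic_on S"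
    by (rule pole_lemma_open) (use assms in auto)
qed (use assms in auto)

text \<open>One integration by parts: the exponentials equal 1 at both end points, which leaves
  \<open>G 1 - G 0\<close> and an integral of \<open>deriv G\<close>, both bounded in
  \<open>k\<close>, over the factor 2 pi i k.\<close>

lemma Riemann_Lebesgue_holomorphic:
  fixes G :: "complex \<Rightarrow> complex"
  assumes G: "G holomorphic_on U" "open U" "closed_segment 0 1 \<subseteq> U"
  obtains C where "\<And>k::int. k \<noteq> 0 \<Longrightarrow>
    norm (contour_integral (linepath 0 1) (\<lambda>z. G z * exp (2 * of_real pi * \<i> * of_int k * z))) \<le> C / real_of_int \<bar>k\<bar>"
proof -
  define e where "e = (\<lambda>(k::int) z. exp (2 * of_real pi * \<i> * of_int k * z))"
  have e: "(e k has_field_derivative 2 * of_real pi * \<i> * of_int k * e k z) (at z within A)" for k z A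
    unfolding e_def by (auto intro!: derivative_eq_intros)
  have e1: "e k 0 = 1" "e k 1 = 1" for k
    using exp_eq_1 [of "2 * of_real pi * \<i> * of_int k"] by (auto simp: e_def)
  have en: "norm (e k z) = 1" if "z \<in> closed_segment 0 1" for k z
    using that by (auto simp: e_def closed_segment_def)
  have contG: "continuous_on (closed_segment 0 1) G" "continuous_on (closed_segment 0 1) (deriv G)"
    using G holomorphic_deriv [OF G(1,2)] by (meson holomorphic_on_imp_continuous_on continuous_on_subset)+
  have conte: "continuous_on (closed_segment 0 1) (e k)" for k
    unfolding e_def by (intro continuous_intros)
  have "bounded (deriv G ` closed_segment 0 1)"
    by (intro compact_imp_bounded compact_continuous_image contG) auto
  then obtain B where B: "\<And>z. z \<in> closed_segment 0 1 \<Longrightarrow> norm (deriv G z) \<le> B"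
    by (auto simp: bounded_iff)
  have "norm (deriv G 0) \<le> B" by (rule B) auto
  then have B0: "B \<ge> 0" using norm_ge_zero order_trans by blast
  show ?thesis
  proof
    fix k :: int assume k: "k \<noteq> 0"
    let ?I = "contour_integral (linepath 0 1)"
    have i1: "(\<lambda>z. G z * e k z) contour_integrable_on linepath 0 1"
      and i2: "(\<lambda>z. deriv G z * e k z) contour_integrable_on linepath 0 1"
      by (intro contour_integrable_continuous_linepath continuous_intros contG conte)+
    have "((\<lambda>z. deriv G z * e k z + 2 * of_real pi * \<i> * of_int k * (G z * e k z)) has_contour_integral
              (G (pathfinish (linepath 0 1)) * e k (pathfinish (linepath 0 1)) - G (pathstart (linepath 0 1)) * e k (pathstart (linepath 0 1)))) (linepath 0 1)"
    proof (rule contour_integral_primitive [where S = U])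
      fix z assume z: "z \<in> U"
      have "(G has_field_derivative deriv G z) (at z within U)"
        using z G holomorphic_derivI by blast
      then show "((\<lambda>z. G z * e k z) has_field_derivative
          deriv G z * e k z + 2 * of_real pi * \<i> * of_int k * (G z * e k z)) (at z within U)"
        by (auto intro!: derivative_eq_intros e)
    next
      show "valid_path (linepath (0::complex) 1)" by (rule valid_path_linepath)
      show "path_image (linepath 0 1) \<subseteq> U" using G(3) by (simp only: path_image_linepath)
    qed
    then have "?I (\<lambda>z. deriv G z * e k z + 2 * of_real pi * \<i> * of_int k * (G z * e k z)) = G 1 - G 0"
      by (simp add: contour_integral_unique e1)
    then have "?I (\<lambda>z. deriv G z * e k z) + 2 * of_real pi * \<i> * of_int k * ?I (\<lambda>z. G z * e k z) = G 1 - G 0"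
      by (subst (asm) contour_integral_add)
         (use i1 i2 contour_integral_lmul [OF i1] in \<open>auto intro!: contour_integrable_lmul\<close>)
    then have eq: "2 * of_real pi * \<i> * of_int k * ?I (\<lambda>z. G z * e k z) = G 1 - G 0 - ?I (\<lambda>z. deriv G z * e k z)"
      by (simp add: algebra_simps)
    have "norm (?I (\<lambda>z. deriv G z * e k z)) \<le> B * norm (1 - 0 :: complex)"
      by (rule contour_integral_bound_linepath [OF i2 B0]) (use B en in \<open>auto simp: norm_mult\<close>)
    then have "norm (G 1 - G 0 - ?I (\<lambda>z. deriv G z * e k z)) \<le> norm (G 1 - G 0) + B"
      using norm_triangle_ineq4 [of "G 1 - G 0" "?I (\<lambda>z. deriv G z * e k z)"] by simp
    then have "2 * pi * \<bar>real_of_int k\<bar> * norm (?I (\<lambda>z. G z * e k z)) \<le> norm (G 1 - G 0) + B"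
      unfolding eq [symmetric] by (simp add: norm_mult)
    then show "norm (?I (\<lambda>z. G z * exp (2 * of_real pi * \<i> * of_int k * z))) \<le> ((norm (G 1 - G 0) + B) / (2 * pi)) / real_of_int \<bar>k\<bar>"
      using k by (simp add: e_def field_simps)
  qed
qed

text \<open>Chernoff's argument: dividing \<open>f - f 0\<close> by \<open>exp (2 \<pi> i z) - 1\<close> makes the partial sums of the
  Fourier series telescope.\<close>

lemma Fourier_partial_sums_tendsto:
  fixes f :: "complex \<Rightarrow> complex"
  assumes hol: "f holomorphic_on UNIV" and per: "\<And>z. f (z + 1) = f z"
  shows "(\<lambda>N. \<Sum>k = - int N .. int N. contour_integral (linepath 0 1) (\<lambda>z. f z * exp (2 * of_real pi * \<i> * of_int k * z))) \<longlonglongrightarrow> f 0"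
proof -
  define e where "e = (\<lambda>(k::int) z. exp (2 * of_real pi * \<i> * of_int k * z))"
  let ?I = "contour_integral (linepath 0 1)"
  \<comment> \<open>In this strip exp (2 pi i z) - 1 vanishes only at 0 and 1, both times simply,
    and by periodicity \<open>f z - f 0\<close> vanishes there as well. Dividing these zeros out of
    numerator and denominator one at a time makes the quotient \<open>G\<close> holomorphic around
    the whole segment.\<close>
  define U where "U = {z. - 1 / 2 < Re z} \<inter> {z. Re z < 3 / 2}"
  have "open U"
    unfolding U_def by (intro open_Int open_halfspace_Re_gt open_halfspace_Re_lt)
  then have U: "open U" "0 \<in> U" "1 \<in> U"
    by (auto simp: U_def)
  have seg: "closed_segment 0 1 \<subseteq> U"
    by (auto simp: U_def closed_segment_def)
  define E where "E = (\<lambda>z. exp (2 * of_real pi * \<i> * z) - 1)"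
  have E': "(E has_field_derivative 2 * of_real pi * \<i> * exp (2 * of_real pi * \<i> * z)) (at z)" for z
    unfolding E_def by (auto intro!: derivative_eq_intros)
  have E01: "E 0 = 0" "E 1 = 0"
    by (auto simp: E_def)
  have E0: "z = 0 \<or> z = 1" if "z \<in> U" "E z = 0" for z
  proof -
    from that(2) obtain n :: int where n: "Re (2 * of_real pi * \<i> * z) = 0" "Im (2 * of_real pi * \<i> * z) = of_int (2 * n) * pi"
      unfolding E_def using exp_eq_1 [of "2 * of_real pi * \<i> * z"] by auto
    then have "Im z = 0" "Re z = n" by auto
    with that(1) have "n = 0 \<or> n = 1" by (auto simp: U_def)
    then show ?thesis using \<open>Im z = 0\<close> \<open>Re z = n\<close> by (auto simp: complex_eq_iff)
  qed
  have Ehol: "E holomorphic_on U"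
    unfolding E_def by (intro holomorphic_intros)
  obtain E1 where E1: "E1 holomorphic_on U" "\<And>z. z \<in> U \<Longrightarrow> E z = z * E1 z" "E1 0 = deriv E 0"
    using holomorphic_factor_zero [OF Ehol U(1,2) E01(1)] by (metis diff_zero)
  have "E1 1 = 0" using E1(2) [of 1] U E01 by auto
  from holomorphic_factor_zero [OF E1(1) U(1,3) this]
  obtain E2 where E2: "E2 holomorphic_on U" "\<And>z. z \<in> U \<Longrightarrow> E1 z = (z - 1) * E2 z" "E2 1 = deriv E1 1"
    by metis
  have E2nz: "E2 z \<noteq> 0" if z: "z \<in> U" for z
  proof
    assume 0: "E2 z = 0"
    then have "E z = 0" using E1 E2 z by simp
    then consider "z = 0" | "z = 1" using E0 z by blast
    then show False
    proof cases
      case 1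
      with 0 E2 U have "E1 0 = 0" by auto
      then show False using E1(3) DERIV_imp_deriv [OF E' [of 0]] by simp
    next
      case 2
      have "((\<lambda>z. z * ((z - 1) * E2 z)) has_field_derivative E2 1) (at 1)"
        using holomorphic_derivI [OF E2(1) U(1,3)]
        by (auto intro!: derivative_eq_intros)
      then have "(E has_field_derivative E2 1) (at 1)"
        by (rule has_field_derivative_transform_within_open [where S = U]) (use U E1 E2 in auto)
      with E' [of 1] have "E2 1 = 2 * of_real pi * \<i> * exp (2 * of_real pi * \<i>)"
        by (metis DERIV_unique mult.right_neutral)
      with 0 2 show False by simp
    qed
  qed
  have Hhol: "(\<lambda>z. f z - f 0) holomorphic_on U"
    by (intro holomorphic_intros holomorphic_on_subset [OF hol]) auto
  obtain H1 where H1: "H1 holomorphic_on U" "\<And>z. z \<in> U \<Longrightarrow> f z - f 0 = (z - 0) * H1 z"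
    using holomorphic_factor_zero [OF Hhol U(1,2)] by auto
  have "H1 1 = 0" using H1(2) [of 1] U per [of 0] by auto
  from holomorphic_factor_zero [OF H1(1) U(1,3) this]
  obtain H2 where H2: "H2 holomorphic_on U" "\<And>z. z \<in> U \<Longrightarrow> H1 z = (z - 1) * H2 z"
    by metis
  define G where "G = (\<lambda>z. H2 z / E2 z)"
  have Ghol: "G holomorphic_on U"
    unfolding G_def by (intro holomorphic_intros H2 E2) (use E2nz in auto)
  have G: "f z = f 0 + G z * (e 1 z - 1)" if "z \<in> U" for z
  proof -
    have "f z - f 0 = G z * E z"
      using H1 H2 E1 E2 E2nz that by (simp add: G_def)
    then show ?thesis by (simp add: E_def e_def algebra_simps)
  qed
  define g where "g = (\<lambda>k. ?I (\<lambda>z. G z * e k z))"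
  have contG: "continuous_on (closed_segment 0 1) G"
    using Ghol seg holomorphic_on_imp_continuous_on continuous_on_subset by blast
  have conte: "continuous_on (closed_segment 0 1) (e k)" for k
    unfolding e_def by (intro continuous_intros)
  have Ge: "(\<lambda>z. G z * e k z) contour_integrable_on linepath 0 1" for k
    by (intro contour_integrable_continuous_linepath continuous_intros contG conte)
  have e_Suc: "e (k + 1) z = e k z * e 1 z" for k z
    by (simp add: e_def exp_add [symmetric] algebra_simps)
  have Ie: "?I (e k) = (if k = 0 then 1 else 0)" for k
  proof (cases "k = 0")
    case True
    then show ?thesis by (simp add: e_def)
  next
    case False
    have e1: "e k 0 = 1" "e k 1 = 1"
      using exp_eq_1 [of "2 * of_real pi * \<i> * of_int k"] by (auto simp: e_def)
    have "(e k has_contour_integral (e k (pathfinish (linepath 0 1)) / (2 * of_real pi * \<i> * of_int k)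
              - e k (pathstart (linepath 0 1)) / (2 * of_real pi * \<i> * of_int k))) (linepath 0 1)"
    proof (rule contour_integral_primitive [where S = UNIV])
      show "valid_path (linepath (0::complex) 1)" by (rule valid_path_linepath)
    qed (use False in \<open>auto simp: e_def intro!: derivative_eq_intros\<close>)
    then show ?thesis using False by (simp add: e1 contour_integral_unique)
  qed
  \<comment> \<open>Multiplying by \<open>e 1\<close> raises the index of a coefficient by one, so
    away from \<open>k = 0\<close> each coefficient of \<open>f\<close> is a difference of
    neighbouring coefficients of \<open>G\<close>. The partial sums reduce to \<open>f 0\<close> and
    two coefficients of \<open>G\<close>, which decay.\<close>
  have coeff: "?I (\<lambda>z. f z * e k z) = f 0 * (if k = 0 then 1 else 0) + g (k + 1) - g k" for k
  proof -
    have "?I (\<lambda>z. f z * e k z) = ?I (\<lambda>z. f 0 * e k z + (G z * e (k + 1) z - G z * e k z))"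
    proof (rule contour_integral_cong [OF refl])
      fix z :: complex assume "z \<in> path_image (linepath 0 1)"
      then have "z \<in> U" using seg by auto
      then show "f z * e k z = f 0 * e k z + (G z * e (k + 1) z - G z * e k z)"
        unfolding G [OF \<open>z \<in> U\<close>] e_Suc by (simp add: algebra_simps)
    qed
    also have "\<dots> = f 0 * ?I (e k) + (g (k + 1) - g k)"
    proof -
      have eI: "e k contour_integrable_on linepath 0 1"
        by (intro contour_integrable_continuous_linepath conte)
      have 1: "(\<lambda>z. f 0 * e k z) contour_integrable_on linepath 0 1"
        and 2: "(\<lambda>z. G z * e (k + 1) z - G z * e k z) contour_integrable_on linepath 0 1"
        by (intro contour_integrable_continuous_linepath continuous_intros contG conte)+
      show ?thesis
        by (simp only: contour_integral_add [OF 1 2] contour_integral_lmul [OF eI] contour_integral_diff [OF Ge Ge] g_def)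
    qed
    finally show ?thesis by (simp add: Ie)
  qed
  have sum: "(\<Sum>k = - int N .. int N. ?I (\<lambda>z. f z * e k z)) = f 0 + g (int N + 1) - g (- int N)" for N
  proof (induction N)
    case 0
    then show ?case by (simp add: coeff del: linepath_0)
  next
    case (Suc N)
    have "{- int (Suc N) .. int (Suc N)} = insert (- int (Suc N)) (insert (int (Suc N)) {- int N .. int N})"
      by auto
    then show ?case using Suc by (simp add: coeff algebra_simps del: linepath_0)
  qed
  obtain C where C: "\<And>k::int. k \<noteq> 0 \<Longrightarrow> norm (g k) \<le> C / real_of_int \<bar>k\<bar>"
    using Riemann_Lebesgue_holomorphic [OF Ghol U(1) seg] unfolding g_def e_def by blast
  have "(\<lambda>N. g (int N + 1)) \<longlonglongrightarrow> 0"
  proof (rule Lim_null_comparison)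
    show "\<forall>\<^sub>F N in sequentially. norm (g (int N + 1)) \<le> C / real N"
      using eventually_gt_at_top [of 0]
    proof eventually_elim
      case (elim N)
      have "norm (g 1) \<le> C" using C [of 1] by simp
      then have "C \<ge> 0" using norm_ge_zero order_trans by blast
      then have "C / (1 + real N) \<le> C / real N" using elim by (intro divide_left_mono) auto
      then show ?case using C [of "int N + 1"] by (simp add: add.commute)
    qed
    show "(\<lambda>N. C / real N) \<longlonglongrightarrow> 0" by (rule lim_const_over_n)
  qed
  moreover have "(\<lambda>N. g (- int N)) \<longlonglongrightarrow> 0"
  proof (rule Lim_null_comparison)
    show "\<forall>\<^sub>F N in sequentially. norm (g (- int N)) \<le> C / real N"
      using eventually_gt_at_top [of 0]
    proof eventually_elim
      case (elim N)
      then show ?case using C [of "- int N"] by simp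
    qed
    show "(\<lambda>N. C / real N) \<longlonglongrightarrow> 0" by (rule lim_const_over_n)
  qed
  ultimately have "(\<lambda>N. f 0 + g (int N + 1) - g (- int N)) \<longlonglongrightarrow> f 0 + 0 - 0"
    by (intro tendsto_intros)
  then have "(\<lambda>N. \<Sum>k = - int N .. int N. ?I (\<lambda>z. f z * e k z)) \<longlonglongrightarrow> f 0"
    by (simp only: sum) simp
  then show ?thesis by (simp add: e_def)
qed

section \<open>Poisson summation for Gaussians\<close>

text \<open>The characteristic function of the standard normal distribution after the substitution x
  = a u: the choice \<open>a = sqrt (2 * pi * t)\<close> turns exp (- x^2 / 2) into exp (- pi t
  u^2), and \<open>\<xi> = 2 * pi * s / a\<close> turns the phase into exp (2 pi i u s).\<close>

lemma gaussian_fourier: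
  fixes t s :: real
  assumes "t > 0"
  shows "integrable lborel (\<lambda>u::real. exp (of_real (- pi * t * u\<^sup>2) + 2 * of_real pi * \<i> * of_real u * of_real s) :: complex)"
    and "integral\<^sup>L lborel (\<lambda>u::real. exp (of_real (- pi * t * u\<^sup>2) + 2 * of_real pi * \<i> * of_real u * of_real s) :: complex)
         = of_real (exp (- pi * s\<^sup>2 / t) / sqrt t)"
proof -
  define a where "a = sqrt (2 * pi * t)"
  have a: "a > 0" "a\<^sup>2 = 2 * pi * t" using assms by (auto simp: a_def)
  define \<xi> where "\<xi> = 2 * pi * s / a"
  define h :: "real \<Rightarrow> complex" where "h = (\<lambda>x. std_normal_density x *\<^sub>R iexp (\<xi> * x))"
  have int: "integrable lborel h"
    unfolding h_def by (rule Bochner_Integration.integrable_bound [OF integrable_normal_moment [of 1 0 0]]) 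
      (auto simp: norm_mult)
  have val: "integral\<^sup>L lborel h = of_real (exp (- \<xi>\<^sup>2 / 2))"
    using fun_cong [OF char_std_normal_distribution, of \<xi>]
    unfolding char_def h_def by (subst (asm) integral_density) auto
  have eq: "h (0 + a * u) = of_real (1 / sqrt (2 * pi)) * exp (of_real (- pi * t * u\<^sup>2) + 2 * of_real pi * \<i> * of_real u * of_real s)" for u
  proof -
    have "std_normal_density (a * u) = 1 / sqrt (2 * pi) * exp (- pi * t * u\<^sup>2)"
      by (simp add: normal_density_def power_mult_distrib a)
    moreover have "\<xi> * (a * u) = 2 * pi * u * s" using a by (simp add: \<xi>_def)
    then have "iexp (\<xi> * (a * u)) = exp (2 * of_real pi * \<i> * of_real u * of_real s)"
      by (simp only: of_real_mult of_real_numeral mult_ac)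
    ultimately show ?thesis
      unfolding h_def scaleR_conv_of_real exp_add exp_of_real add_0 by (simp only: of_real_mult mult_ac)
  qed
  have "integrable lborel (\<lambda>u. h (0 + a * u))"
    using int a by (subst lborel_integrable_real_affine_iff) auto
  then have "integrable lborel (\<lambda>u. of_real (sqrt (2 * pi)) * h (0 + a * u))"
    by (rule integrable_mult_right)
  then show "integrable lborel (\<lambda>u::real. exp (of_real (- pi * t * u\<^sup>2) + 2 * of_real pi * \<i> * of_real u * of_real s) :: complex)"
    unfolding eq by (simp flip: of_real_mult)
  have "of_real (exp (- \<xi>\<^sup>2 / 2)) = \<bar>a\<bar> *\<^sub>R integral\<^sup>L lborel (\<lambda>u. h (0 + a * u))"
    unfolding val [symmetric] by (rule lborel_integral_real_affine) (use a in auto)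
  then have *: "complex_of_real (exp (- \<xi>\<^sup>2 / 2)) = of_real (a / sqrt (2 * pi)) * integral\<^sup>L lborel (\<lambda>u::real. exp (of_real (- pi * t * u\<^sup>2) + 2 * of_real pi * \<i> * of_real u * of_real s) :: complex)"
    using a unfolding eq by (simp add: scaleR_conv_of_real)
  have 1: "a / sqrt (2 * pi) = sqrt t" by (simp add: a_def real_sqrt_mult)
  have 2: "- \<xi>\<^sup>2 / 2 = - pi * s\<^sup>2 / t"
    unfolding \<xi>_def power_divide a(2) using assms by (simp add: power2_eq_square)
  show "integral\<^sup>L lborel (\<lambda>u::real. exp (of_real (- pi * t * u\<^sup>2) + 2 * of_real pi * \<i> * of_real u * of_real s) :: complex)
         = of_real (exp (- pi * s\<^sup>2 / t) / sqrt t)"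
    unfolding of_real_divide * [unfolded 1 2] using assms by (intro nonzero_mult_div_cancel_left [symmetric]) simp
qed

lemma entire_primitive:
  fixes f :: "complex \<Rightarrow> complex"
  assumes "f holomorphic_on UNIV"
  obtains F where "\<And>z. (F has_field_derivative f z) (at z)"
  using holomorphic_convex_primitive' [OF convex_UNIV open_UNIV assms] by auto

text \<open>Links the Lebesgue integral over the real line with contour integrals: the latter are
  evaluated through an entire primitive, so the Gaussian integral is needed as a limit of increments
  of that primitive. Dominated convergence over [- N, N] provides it.\<close>

lemma gaussian_fourier_LIMSEQ:
  fixes t s :: real
  assumes t: "t > 0"
    and F: "\<And>z. (F has_field_derivative gauss (of_real t) z (of_real s)) (at z)"
  shows "(\<lambda>N. F (of_nat N) - F (- of_nat N)) \<longlonglongrightarrow> of_real (exp (- pi * s\<^sup>2 / t) / sqrt t)"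
proof -
  define \<psi> :: "real \<Rightarrow> complex" where "\<psi> = (\<lambda>u. exp (of_real (- pi * t * u\<^sup>2) + 2 * of_real pi * \<i> * of_real u * of_real s))"
  have int: "integrable lborel \<psi>"
    and val: "integral\<^sup>L lborel \<psi> = of_real (exp (- pi * s\<^sup>2 / t) / sqrt t)"
    unfolding \<psi>_def by (rule gaussian_fourier [OF t])+
  have lim: "(\<lambda>N. integral\<^sup>L lborel (\<lambda>u. indicator {- real N..real N} u *\<^sub>R \<psi> u)) \<longlonglongrightarrow> integral\<^sup>L lborel \<psi>"
  proof (rule integral_dominated_convergence [where w = "\<lambda>u. norm (\<psi> u)"])
    show "AE u in lborel. (\<lambda>N. indicator {- real N..real N} u *\<^sub>R \<psi> u) \<longlonglongrightarrow> \<psi> u"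
    proof (intro AE_I2 tendsto_eventually)
      fix u :: real
      obtain N where N: "\<bar>u\<bar> \<le> real N" using real_arch_simple by blast
      show "\<forall>\<^sub>F N in sequentially. indicator {- real N..real N} u *\<^sub>R \<psi> u = \<psi> u"
        using eventually_ge_at_top [of N] by eventually_elim (use N in \<open>auto simp: abs_le_iff\<close>)
    qed
    show "integrable lborel (\<lambda>u. norm (\<psi> u))" using int by simp
  qed (use int in \<open>auto simp: indicator_def\<close>)
  have "integral\<^sup>L lborel (\<lambda>u. indicator {- real N..real N} u *\<^sub>R \<psi> u) = F (of_nat N) - F (- of_nat N)" for N
  proof -
    have "set_integrable lborel {- real N..real N} \<psi>"
      unfolding set_integrable_def using int by (intro integrable_mult_indicator) auto
    then have "(LINT u : {- real N..real N}|lborel. \<psi> u) = integral {- real N..real N} \<psi>"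
      by (rule set_borel_integral_eq_integral)
    moreover have "(\<psi> has_integral ((F \<circ> of_real) (real N) - (F \<circ> of_real) (- real N))) {- real N..real N}"
    proof (rule fundamental_theorem_of_calculus)
      fix u :: real
      have "(F has_field_derivative \<psi> u) (at (of_real u))"
        using F [of "of_real u"] by (simp add: \<psi>_def mult.assoc)
      then show "((F \<circ> of_real) has_vector_derivative \<psi> u) (at u within {- real N..real N})"
 
        unfolding o_def by (rule has_vector_derivative_real_field)
    qed auto
    ultimately show ?thesis
      by (simp add: set_lebesgue_integral_def integral_unique)
  qed
  with lim val show ?thesis by simp
qed

lemma jtheta_has_sum:
  assumes "Re t > 0"
  shows "((\<lambda>n::int. gauss t (of_int n) z) has_sum jtheta t z) UNIV"
  unfolding jtheta_def using jtheta_summable [OF assms] by (rule has_sum_infsum)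

text \<open>Expanding (n + x)^2 moves the cross term into the second argument: shifting the
  summation lattice by \<open>x\<close> is, up to one factor, a translation of that argument by i t
  x.\<close>

lemma jtheta_shift_has_sum:
  assumes "Re t > 0"
  shows "((\<lambda>n::int. gauss t (of_int n + x) y) 
           has_sum gauss t x y * jtheta t (y + \<i> * t * x)) UNIV"
proof -
  have "gauss t (of_int n + x) y =
     gauss t x y * 
     gauss t (of_int n) (y + \<i> * t * x)" for n :: int
    unfolding exp_add [symmetric] by (rule arg_cong [where f = exp]) (simp add: algebra_simps power2_eq_square)
  with has_sum_cmult_right [OF jtheta_has_sum [OF assms, of "y + \<i> * t * x"]] show ?thesis
    by simp
qed

text \<open>Unfolding: since exp (2 pi i k n) = 1, the integrand is the sum over \<open>n\<close> of
  \<open>\<psi> (z + of_int n)\<close> for one Gaussian \<open>\<psi>\<close>, so the integral over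
  a period is the integral of \<open>\<psi>\<close> over the whole line.\<close>

lemma jtheta_fourier_coeff:
  fixes t y :: real and k :: int
  assumes t: "t > 0"
  shows "contour_integral (linepath 0 1) (\<lambda>z. gauss (of_real t) z (of_real y) *
            jtheta t (of_real y + \<i> * of_real t * z) * exp (2 * of_real pi * \<i> * of_int k * z)) = of_real (exp (- pi * (y + of_int k)\<^sup>2 / t) / sqrt t)"
proof -
  let ?J = "\<lambda>z. jtheta t (of_real y + \<i> * of_real t * z)"
  define \<psi> where "\<psi> = (\<lambda>z. gauss (of_real t) z (of_real (y + of_int k)))"
  define pre where "pre = (\<lambda>z. gauss (of_real t) z (of_real y) * exp (2 * of_real pi * \<i> * of_int k * z))"
  define tm where "tm = (\<lambda>(n::int) z. gauss (of_real t) (of_int n) (of_real y + \<i> * of_real t * z))"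
  have \<psi>: "\<psi> (z + of_int n) = pre z * tm n z" for n z
  proof -
    have "exp (2 * of_real pi * \<i> * of_int m) = 1" for m :: int
      using exp_eq_1 [of "2 * of_real pi * \<i> * of_int m"] by auto
    from this [of "k * n"] have "exp (2 * of_real pi * \<i> * of_int (k * n)) = 1" .
    then have "pre z * tm n z = gauss (of_real t) z (of_real y) * exp (2 * of_real pi * \<i> * of_int k * z) * exp (2 * of_real pi * \<i> * of_int (k * n)) * tm n z"
      by (simp add: pre_def)
    also have "\<dots> = \<psi> (z + of_int n)"
      unfolding pre_def tm_def \<psi>_def exp_add [symmetric] by (rule arg_cong [where f = exp]) (simp add: algebra_simps power2_eq_square)
    finally show ?thesis ..
  qed
  have "\<psi> holomorphic_on UNIV"
    unfolding \<psi>_def by (intro holomorphic_intros)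
  then obtain F where F: "\<And>z. (F has_field_derivative \<psi> z) (at z)"
    using entire_primitive by blast
  \<comment> \<open>Through the primitive \<open>F\<close> the \<open>n\<close>-th translate
    contributes an increment, and the increments telescope. Summation and integration may be
    exchanged because the theta series converges uniformly on the segment.\<close>
  have seg: "((\<lambda>z. pre z * tm n z) has_contour_integral (F (of_int (n + 1)) - F (of_int n))) (linepath 0 1)" for n
  proof -
    have "((\<lambda>z. \<psi> (z + of_int n)) has_contour_integral (F (pathfinish (linepath 0 1) + of_int n) - F (pathstart (linepath 0 1) + of_int n))) (linepath 0 1)"
    proof (rule contour_integral_primitive [where S = UNIV])
      show "valid_path (linepath (0::complex) 1)" by (rule valid_path_linepath)
      show "((\<lambda>z. F (z + of_int n)) has_field_derivative \<psi> (z + of_int n)) (at z)" for z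
        by (rule DERIV_chain2 [OF F, THEN DERIV_cong]) (auto intro!: derivative_eq_intros)
    qed auto
    then show ?thesis by (simp add: \<psi> add.commute)
  qed
  have contpre: "continuous_on A pre" for A unfolding pre_def by (intro continuous_intros)
  obtain P where P: "\<And>z. z \<in> closed_segment 0 1 \<Longrightarrow> norm (pre z) \<le> P"
    using compact_imp_bounded [OF compact_continuous_image [OF contpre compact_segment [of 0 1]]]
    unfolding bounded_iff by blast
  have tt: "Re (of_real t) \<ge> t" by simp
  obtain C where C: "\<And>t' z n. Re t' \<ge> t \<Longrightarrow> \<bar>Im z\<bar> \<le> t \<Longrightarrow>
    norm (gauss t' (of_int n) z) \<le> C * exp (- \<bar>real_of_int n\<bar>)"
    using jtheta_term_bound [OF t] by blast
  have ul: "uniform_limit (path_image (linepath 0 1)) (\<lambda>X z. \<Sum>n\<in>X. pre z * tm n z) 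
      (\<lambda>z. pre z * ?J z) (finite_subsets_at_top UNIV)"
  proof (rule Weierstrass_m_test_general')
    show "(\<lambda>n::int. P * (C * exp (- \<bar>real_of_int n\<bar>))) summable_on UNIV"
      by (intro summable_on_cmult_right summable_on_exp_minus_abs)
    fix n :: int and z :: complex assume "z \<in> path_image (linepath 0 1)"
    then have z: "z \<in> closed_segment 0 1" by (simp only: path_image_linepath)
    then have "Im z = 0 \<and> 0 \<le> Re z \<and> Re z \<le> 1" by (auto simp: closed_segment_def)
    then have "\<bar>Im (of_real y + \<i> * of_real t * z)\<bar> \<le> t" using t by (auto simp: abs_mult mult_left_le)
    then have "norm (tm n z) \<le> C * exp (- \<bar>real_of_int n\<bar>)"
      unfolding tm_def by (rule C [OF tt])
    then show "norm (pre z * tm n z) \<le> P * (C * exp (- \<bar>real_of_int n\<bar>))"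
      using P [OF z] unfolding norm_mult by (intro mult_mono) (auto intro: order_trans [OF norm_ge_zero])
  next
    fix z :: complex
    show "((\<lambda>n. pre z * tm n z) has_sum pre z * ?J z) UNIV"
      unfolding tm_def by (intro has_sum_cmult_right jtheta_has_sum) (use t in auto)
  qed
  let ?I = "contour_integral (linepath 0 1) (\<lambda>z. pre z * ?J z)"
  have "((\<lambda>X. contour_integral (linepath 0 1) (\<lambda>z. \<Sum>n\<in>X. pre z * tm n z)) \<longlongrightarrow> ?I) (finite_subsets_at_top UNIV)"
  proof (rule contour_integral_uniform_limit(2) [OF _ ul])
    show "\<forall>\<^sub>F X in finite_subsets_at_top UNIV. (\<lambda>z. \<Sum>n\<in>X. pre z * tm n z) contour_integrable_on linepath 0 1"
      by (intro eventually_finite_subsets_at_top_weakI contour_integrable_sum has_contour_integral_integrable [OF seg]) auto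
    show "norm (vector_derivative (linepath (0::complex) 1) (at s)) \<le> (1::real)" for s :: real
      by (simp add: vector_derivative_linepath_at)
  qed auto
  moreover have "contour_integral (linepath 0 1) (\<lambda>z. \<Sum>n\<in>X. pre z * tm n z) = (\<Sum>n\<in>X. F (of_int (n + 1)) - F (of_int n))" if "finite X" for X
    by (intro contour_integral_unique has_contour_integral_sum seg that)
  then have "\<forall>\<^sub>F X in finite_subsets_at_top UNIV. contour_integral (linepath 0 1) (\<lambda>z. \<Sum>n\<in>X. pre z * tm n z) = (\<Sum>n\<in>X. F (of_int (n + 1)) - F (of_int n))"
    by (intro eventually_finite_subsets_at_top_weakI) auto
  ultimately have "((\<lambda>n. F (of_int (n + 1)) - F (of_int n)) has_sum ?I) UNIV"
    unfolding has_sum_def by (rule Lim_transform_eventually)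
  then have "(\<lambda>N. \<Sum>n \<in> {- int N..<int N}. F (of_int (n + 1)) - F (of_int n)) \<longlonglongrightarrow> ?I"
    by (rule has_sum_int_LIMSEQ)
  moreover have "(\<Sum>n \<in> {- int N..<int N}. F (of_int (n + 1)) - F (of_int n)) = F (of_nat N) - F (- of_nat N)" for N
  proof (induction N)
    case (Suc N)
    have "{- int (Suc N)..<int (Suc N)} = insert (- int (Suc N)) (insert (int N) {- int N..<int N})"
      by auto
    then show ?case using Suc by (simp add: algebra_simps)
  qed auto
  ultimately have "(\<lambda>N. F (of_nat N) - F (- of_nat N)) \<longlonglongrightarrow> ?I" by simp
  moreover have "(\<lambda>N. F (of_nat N) - F (- of_nat N)) \<longlonglongrightarrow> of_real (exp (- pi * (y + of_int k)\<^sup>2 / t) / sqrt t)"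
    by (rule gaussian_fourier_LIMSEQ [OF t]) (use F in \<open>simp only: \<psi>_def\<close>)
  ultimately have "?I = of_real (exp (- pi * (y + of_int k)\<^sup>2 / t) / sqrt t)"
    by (rule LIMSEQ_unique)
  then show ?thesis by (simp add: pre_def mult_ac)
qed

text \<open>Poisson summation: \<open>f\<close> is the periodization of a Gaussian with a phase,
  \<open>f 0\<close> is the left side, and the sum of the Fourier coefficients is the right side
  once (y + k)^2 is expanded. Real \<open>t\<close> and \<open>y\<close> are what the Gaussian
  integral provides.\<close>

lemma jtheta_inversion_real:
  fixes t y :: real
  assumes t: "t > 0"
  shows "jtheta (of_real t) (of_real y) = exp (- of_real pi * (of_real y)\<^sup>2 / of_real t) / csqrt (of_real t) * jtheta (1 / of_real t) (\<i> * of_real y / of_real t)"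
proof -
  have Re: "Re (of_real t) > 0" "Re (1 / of_real t) > 0" using t by (simp_all add: Re_divide_of_real)
  define f where "f = (\<lambda>z. gauss (of_real t) z (of_real y) *
            jtheta (of_real t) (of_real y + \<i> * of_real t * z))"
  have jhol: "jtheta (of_real t) holomorphic_on UNIV"
    unfolding holomorphic_on_open [OF open_UNIV] using jtheta_has_field_derivative_z(1) [OF Re(1)] by blast
  have "(jtheta (of_real t) \<circ> (\<lambda>z. of_real y + \<i> * of_real t * z)) holomorphic_on UNIV"
    by (intro holomorphic_on_compose_gen [OF _ jhol] holomorphic_intros) auto
  then have hol: "f holomorphic_on UNIV"
    unfolding f_def o_def by (intro holomorphic_intros)
  have f: "((\<lambda>n::int. gauss (of_real t) (of_int n + z) (of_real y)) has_sum f z) UNIV" for z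
    unfolding f_def by (rule jtheta_shift_has_sum [OF Re(1)])
  have per: "f (z + 1) = f z" for z
  proof (rule infsumI [OF f, THEN sym, THEN trans])
    let ?g = "\<lambda>n::int. gauss (of_real t) (of_int n + z) (of_real y)"
    have "bij_betw (\<lambda>n::int. n + 1) UNIV UNIV"
      by (rule bij_betwI [where g = "\<lambda>n. n - 1"]) auto
    from infsum_reindex_bij_betw [OF this, of ?g]
    have "(\<Sum>\<^sub>\<infinity>n. ?g (n + 1)) = f z" using infsumI [OF f] by simp
    then show "(\<Sum>\<^sub>\<infinity>n::int. gauss (of_real t) (of_int n + (z + 1)) (of_real y)) = f z"
      by (simp add: add_ac)
  qed
  have "(\<lambda>N. \<Sum>k = - int N .. int N. of_real (exp (- pi * (y + of_int k)\<^sup>2 / t) / sqrt t)) \<longlonglongrightarrow> f 0"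
    using Fourier_partial_sums_tendsto [OF hol per] unfolding f_def jtheta_fourier_coeff [OF t] .
  moreover have "(\<lambda>N. \<Sum>k = - int N .. int N. of_real (exp (- pi * (y + of_int k)\<^sup>2 / t) / sqrt t)) \<longlonglongrightarrow>
     exp (- of_real pi * (of_real y)\<^sup>2 / of_real t) / csqrt (of_real t) * jtheta (1 / of_real t) (\<i> * of_real y / of_real t)"
  proof -
    have "of_real (exp (- pi * (y + of_int k)\<^sup>2 / t) / sqrt t) = exp (- of_real pi * (of_real y)\<^sup>2 / of_real t) / csqrt (of_real t) * 
       gauss (1 / of_real t) (of_int k) (\<i> * of_real y / of_real t)" for k :: int
    proof -
      have "complex_of_real (- pi * (y + of_int k)\<^sup>2 / t) = - of_real pi * (of_real y)\<^sup>2 / of_real t + (- of_real pi * (1 / of_real t) * of_int k ^ 2 + 2 * of_real pi * \<i> * of_int k * (\<i> * of_real y / of_real t))"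
        using t by (simp add: field_simps power2_eq_square)
      then have "complex_of_real (exp (- pi * (y + of_int k)\<^sup>2 / t)) = exp (- of_real pi * (of_real y)\<^sup>2 / of_real t) *
          gauss (1 / of_real t) (of_int k) (\<i> * of_real y / of_real t)"
        by (simp only: exp_of_real [symmetric] exp_add)
      moreover have "csqrt (of_real t) = of_real (sqrt t)" using t by (simp add: csqrt_of_real_nonneg)
      ultimately show ?thesis by (simp add: mult_ac)
    qed
    then show ?thesis
      using has_sum_int_LIMSEQ(1) [OF has_sum_cmult_right [OF jtheta_has_sum [OF Re(2)], of "exp (- of_real pi * (of_real y)\<^sup>2 / of_real t) / csqrt (of_real t)" "\<i> * of_real y / of_real t"]]
      by simp
  qed
  ultimately have "f 0 = exp (- of_real pi * (of_real y)\<^sup>2 / of_real t) / csqrt (of_real t) * jtheta (1 / of_real t) (\<i> * of_real y / of_real t)"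
    by (rule LIMSEQ_unique)
  then show ?thesis by (simp add: f_def)
qed

lemma islimpt_reals_ge:
  "of_real a islimpt (of_real ` {a<..} :: complex set)"
proof -
  have "a islimpt {a<..}"
    by (simp add: islimpt_greaterThanLessThan1 [of a "a + 1"] islimpt_subset [where S = "{a<..<a+1}"] subset_iff)
  then show ?thesis
    by (rule islimpt_isCont_image) (auto simp: eventually_at_filter)
qed

lemma Re_inverse_pos: "Re t > 0 \<Longrightarrow> Re (1 / t) > 0"
  by (auto simp: Re_divide intro!: divide_pos_pos add_pos_nonneg)

text \<open>The identity theorem applied twice: for real \<open>t\<close> both sides are entire in
  \<open>z\<close> and agree on the positive axis; for fixed \<open>z\<close> both are holomorphic
  in \<open>t\<close> on the right half-plane and agree on a ray. The principal root is the right
  branch because it is so for real \<open>t\<close>.\<close>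

theorem jtheta_inversion:
  assumes "Re t > 0"
  shows "jtheta t z = exp (- of_real pi * z\<^sup>2 / t) / csqrt t * jtheta (1 / t) (\<i> * z / t)"
proof -
  define D where "D = (\<lambda>t z. jtheta t z - exp (- of_real pi * z\<^sup>2 / t) / csqrt t * jtheta (1 / t) (\<i> * z / t))"
  have holz: "jtheta t holomorphic_on A" if "Re t > 0" for t A
    using holomorphic_on_subset [of "jtheta t" UNIV A] jtheta_has_field_derivative_z(1) [OF that] 
    unfolding holomorphic_on_open [OF open_UNIV] by blast
  have Dz: "D t holomorphic_on UNIV" if t: "Re t > 0" for t
  proof -
    have "(jtheta (1 / t) \<circ> (\<lambda>z. \<i> * z / t)) holomorphic_on UNIV"
      using t by (intro holomorphic_on_compose holomorphic_intros holz Re_inverse_pos) auto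
    then show ?thesis
      unfolding D_def o_def using t by (intro holomorphic_intros holz) auto
  qed
  have Dt: "(\<lambda>t. D t z) holomorphic_on {t. Re t > 0}" for z
    unfolding D_def 
    by (intro holomorphic_intros jtheta_holomorphic_compose open_halfspace_Re_gt Re_inverse_pos)
       (auto simp: complex_nonpos_Reals_iff)
  have 1: "D (of_real t) z = 0" if t: "t > 0" for t :: real and z
  proof (rule analytic_continuation [OF Dz open_UNIV connected_UNIV])
    show "of_real 0 islimpt (of_real ` {0<..} :: complex set)" by (rule islimpt_reals_ge)
    show "D (of_real t) x = 0" if "x \<in> of_real ` {0<..}" for x
      using that jtheta_inversion_real [OF t] by (auto simp: D_def)
  qed (use t in auto)
  have "D t z = 0"
  proof (rule analytic_continuation [OF Dt open_halfspace_Re_gt])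
    show "connected {t. Re t > 0}" by (intro convex_connected convex_halfspace_Re_gt)
    show "of_real 1 islimpt (of_real ` {1<..} :: complex set)" by (rule islimpt_reals_ge)
  qed (use 1 assms in auto)
  then show ?thesis by (simp add: D_def)
qed

section \<open>Theta series with characteristics\<close>

text \<open>For \<open>k = 0\<close> the theta constant with characteristics \<open>x\<close> and
  \<open>y\<close> at the modulus i t, for \<open>k = 1\<close> its derivative in \<open>y\<close>
  up to the factor 2 pi i. Both characteristics stay free because inversion exchanges them and
  because differentiating in them leads from \<open>k = 0\<close> to \<open>k = 1\<close>.\<close>

definition theta_char :: "nat \<Rightarrow> complex \<Rightarrow> complex \<Rightarrow> complex \<Rightarrow> complex" where
  "theta_char k x y t = (\<Sum>\<^sub>\<infinity>n::int. (of_int n + x) ^ k *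
     gauss t (of_int n + x) y)"

lemma theta_char_0_eq_jtheta:
  assumes "Re t > 0"
  shows "theta_char 0 x y t = gauss t x y * jtheta t (y + \<i> * t * x)"
  unfolding theta_char_def using infsumI [OF jtheta_shift_has_sum [OF assms]] by simp

text \<open>At the point \<open>y + \<i> * t * x\<close> the inverted argument is
  \<open>- x + \<i> * (1 / t) * y\<close>, which has the same shape with the characteristics (x, y)
  replaced by (y, - x).\<close>

lemma theta_char_0_inversion:
  assumes t: "Re t > 0"
  shows "theta_char 0 x y t = exp (2 * of_real pi * \<i> * x * y) / csqrt t * theta_char 0 y (- x) (1 / t)"
proof -
  have t0: "t \<noteq> 0" using t by auto
  have z: "\<i> * (y + \<i> * t * x) / t = - x + \<i> * (1 / t) * y"
    using t0 by (simp add: field_simps)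
  have e: "gauss t x y * exp (- of_real pi * (y + \<i> * t * x)\<^sup>2 / t) =
      exp (2 * of_real pi * \<i> * x * y) * gauss (1 / t) y (- x)"
    unfolding exp_add [symmetric] using t0
    by (intro arg_cong [where f = exp]) (simp add: field_simps power2_eq_square)
  have "theta_char 0 x y t = (gauss t x y * exp (- of_real pi * (y + \<i> * t * x)\<^sup>2 / t))
       / csqrt t * jtheta (1 / t) (- x + \<i> * (1 / t) * y)"
    unfolding theta_char_0_eq_jtheta [OF t] jtheta_inversion [OF t, of "y + \<i> * t * x"] z by simp
  also have "\<dots> = exp (2 * of_real pi * \<i> * x * y) / csqrt t * theta_char 0 y (- x) (1 / t)"
    unfolding e theta_char_0_eq_jtheta [OF Re_inverse_pos [OF t]] by simp
  finally show ?thesis .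
qed

lemma theta_char_has_sum:
  assumes t: "Re t > 0" and k: "k \<le> 1"
  shows "((\<lambda>n::int. (of_int n + x) ^ k *
     gauss t (of_int n + x) y) has_sum theta_char k x y t) UNIV"
proof -
  let ?E = "\<lambda>n::int. gauss t (of_int n + x) y"
  have 0: "?E summable_on UNIV"
    using jtheta_shift_has_sum [OF t] has_sum_imp_summable by blast
  have E: "?E n = gauss t x y *
     gauss t (of_int n) (y + \<i> * t * x)" for n
    unfolding exp_add [symmetric] by (rule arg_cong [where f = exp]) (simp add: algebra_simps power2_eq_square)
  have "(\<lambda>n::int. 1 / (2 * of_real pi * \<i>) * gauss t x y * (2 * of_real pi * \<i> * of_int n *
            gauss t (of_int n) (y + \<i> * t * x))) summable_on UNIV"
    by (intro summable_on_cmult_right jtheta_has_field_derivative_z(2) [OF t])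
  then have "(\<lambda>n::int. of_int n * ?E n) summable_on UNIV"
    unfolding E by (simp add: mult_ac)
  from summable_on_add [OF this summable_on_cmult_right [OF 0, of x]]
  have "(\<lambda>n::int. (of_int n + x) * ?E n) summable_on UNIV"
    by (simp add: algebra_simps)
  with 0 k have "(\<lambda>n::int. (of_int n + x) ^ k * ?E n) summable_on UNIV"
    by (cases k) auto
  then show ?thesis
    unfolding theta_char_def by (rule has_sum_infsum)
qed

text \<open>In \<open>y\<close> each term brings down 2 pi i (n + x). In \<open>x\<close> the linear
  phase moves too; the factor exp (- 2 pi i x y) turns it into exp (2 pi i n y), so that only the
  Gaussian is differentiated and - 2 pi t (n + x) comes down. Both are needed since inversion turns
  a derivative in \<open>y\<close> into one in the first characteristic.\<close>

lemma
  assumes t: "Re t > 0"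
  shows theta_char_0_deriv_y: "((\<lambda>y. theta_char 0 x y t) has_field_derivative 2 * of_real pi * \<i> * theta_char 1 x y t) (at y)"
    and theta_char_0_deriv_x: "((\<lambda>x. exp (- 2 * of_real pi * \<i> * x * y) * theta_char 0 x y t) has_field_derivative
           - 2 * of_real pi * t * (exp (- 2 * of_real pi * \<i> * x * y) * theta_char 1 x y t)) (at x)"
proof -
  let ?E = "\<lambda>(n::int). gauss t (of_int n + x) y"
  let ?J = "\<lambda>(n::int) z. gauss t (of_int n) z"
  let ?p = "gauss t x y"
  let ?z = "y + \<i> * t * x"
  define J' where "J' = (\<Sum>\<^sub>\<infinity>n::int. 2 * of_real pi * \<i> * of_int n * ?J n ?z)"
  have J'sum: "((\<lambda>n::int. 2 * of_real pi * \<i> * of_int n * ?J n ?z) has_sum J') UNIV"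
    unfolding J'_def by (intro has_sum_infsum jtheta_has_field_derivative_z(2) [OF t])
  have J: "(jtheta t has_field_derivative J') (at ?z)"
    unfolding J'_def by (rule jtheta_has_field_derivative_z(1) [OF t])
  have E: "?E n = ?p * ?J n ?z" for n
    unfolding exp_add [symmetric] by (rule arg_cong [where f = exp]) (simp add: algebra_simps power2_eq_square)
  have "((\<lambda>n::int. ?p * (2 * of_real pi * \<i> * of_int n * ?J n ?z) + 2 * of_real pi * \<i> * x * (?p * ?J n ?z)) has_sum
      ?p * J' + 2 * of_real pi * \<i> * x * (?p * jtheta t ?z)) UNIV"
    by (intro has_sum_add has_sum_cmult_right J'sum jtheta_has_sum t)
  moreover have "?p * (2 * of_real pi * \<i> * of_int n * ?J n ?z) + 2 * of_real pi * \<i> * x * (?p * ?J n ?z) =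
     2 * of_real pi * \<i> * ((of_int n + x) ^ 1 * ?E n)" for n
    unfolding E by (simp add: algebra_simps)
  ultimately have "((\<lambda>n::int. 2 * of_real pi * \<i> * ((of_int n + x) ^ 1 * ?E n)) has_sum
      ?p * J' + 2 * of_real pi * \<i> * x * (?p * jtheta t ?z)) UNIV"
    by simp
  moreover have "((\<lambda>n::int. 2 * of_real pi * \<i> * ((of_int n + x) ^ 1 * ?E n)) has_sum 2 * of_real pi * \<i> * theta_char 1 x y t) UNIV"
    by (intro has_sum_cmult_right theta_char_has_sum t) simp
  ultimately have eq: "?p * J' + 2 * of_real pi * \<i> * x * (?p * jtheta t ?z) = 2 * of_real pi * \<i> * theta_char 1 x y t"
    by (rule has_sum_unique)
  have "((\<lambda>y. jtheta t (y + \<i> * t * x)) has_field_derivative J' * 1) (at y)"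
    by (rule DERIV_chain2 [where f = "jtheta t" and g = "\<lambda>y. y + \<i> * t * x", OF J]) (auto intro!: derivative_eq_intros)
  then have "((\<lambda>y. gauss t x y * jtheta t (y + \<i> * t * x)) has_field_derivative
      ?p * J' + 2 * of_real pi * \<i> * x * (?p * jtheta t ?z)) (at y)"
    by (auto intro!: derivative_eq_intros)
  then show "((\<lambda>y. theta_char 0 x y t) has_field_derivative 2 * of_real pi * \<i> * theta_char 1 x y t) (at y)"
    unfolding theta_char_0_eq_jtheta [OF t] eq .
  let ?q = "exp (- 2 * of_real pi * \<i> * x * y)"
  have "((\<lambda>x. jtheta t (y + \<i> * t * x)) has_field_derivative J' * (\<i> * t)) (at x)"
    by (rule DERIV_chain2 [where f = "jtheta t" and g = "\<lambda>x. y + \<i> * t * x", OF J]) (auto intro!: derivative_eq_intros)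
  then have "((\<lambda>x. exp (- of_real pi * t * x\<^sup>2) * jtheta t (y + \<i> * t * x)) has_field_derivative
      exp (- of_real pi * t * x\<^sup>2) * (J' * (\<i> * t)) - 2 * of_real pi * t * x * exp (- of_real pi * t * x\<^sup>2) * jtheta t ?z) (at x)"
    by (auto intro!: derivative_eq_intros)
  moreover have "exp (- of_real pi * t * x\<^sup>2) = exp (- 2 * of_real pi * \<i> * x * y) * gauss t x y" for x
    unfolding exp_add [symmetric] by (rule arg_cong [where f = exp]) simp
  then have "exp (- 2 * of_real pi * \<i> * x * y) * theta_char 0 x y t = exp (- of_real pi * t * x\<^sup>2) * jtheta t (y + \<i> * t * x)" for x
    unfolding theta_char_0_eq_jtheta [OF t] by simp
  moreover have "exp (- of_real pi * t * x\<^sup>2) * (J' * (\<i> * t)) - 2 * of_real pi * t * x * exp (- of_real pi * t * x\<^sup>2) * jtheta t ?z =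
     \<i> * t * ?q * (?p * J' + 2 * of_real pi * \<i> * x * (?p * jtheta t ?z))"
  proof -
    have "?q * ?p = exp (- of_real pi * t * x\<^sup>2)"
      unfolding exp_add [symmetric] by (rule arg_cong [where f = exp]) simp
    then show ?thesis by (simp add: algebra_simps)
  qed
  ultimately show "((\<lambda>x. exp (- 2 * of_real pi * \<i> * x * y) * theta_char 0 x y t) has_field_derivative
           - 2 * of_real pi * t * (exp (- 2 * of_real pi * \<i> * x * y) * theta_char 1 x y t)) (at x)"
    unfolding eq by (simp add: mult_ac)
qed

text \<open>The case \<open>k = 0\<close> differentiated in \<open>y\<close>, which on the right is
  the first characteristic; the extra factor i / t is the ratio of - 2 pi / t to 2 pi i.\<close>

lemma theta_char_1_inversion:
  assumes t: "Re t > 0"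
  shows "theta_char 1 x y t = \<i> * exp (2 * of_real pi * \<i> * x * y) / (t * csqrt t) * theta_char 1 y (- x) (1 / t)"
proof -
  have t0: "t \<noteq> 0" using t by auto
  have "((\<lambda>y. exp (- 2 * of_real pi * \<i> * y * (- x)) * theta_char 0 y (- x) (1 / t) / csqrt t) has_field_derivative
           (- 2 * of_real pi * (1 / t) * (exp (- 2 * of_real pi * \<i> * y * (- x)) * theta_char 1 y (- x) (1 / t))) / csqrt t) (at y)"
    by (intro DERIV_cdivide theta_char_0_deriv_x Re_inverse_pos t)
  moreover have "exp (- 2 * of_real pi * \<i> * y * (- x)) * theta_char 0 y (- x) (1 / t) / csqrt t = theta_char 0 x y t" for y
    using theta_char_0_inversion [OF t, of x y] by (simp add: mult_ac)
  ultimately have "((\<lambda>y. theta_char 0 x y t) has_field_derivative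
           (- 2 * of_real pi * (1 / t) * (exp (- 2 * of_real pi * \<i> * y * (- x)) * theta_char 1 y (- x) (1 / t))) / csqrt t) (at y)"
    by simp
  from DERIV_unique [OF theta_char_0_deriv_y [OF t] this]
  have eq: "2 * of_real pi * \<i> * theta_char 1 x y t = 
    - 2 * of_real pi * (1 / t) * (exp (- 2 * of_real pi * \<i> * y * (- x)) * theta_char 1 y (- x) (1 / t)) / csqrt t" .
  have "2 * of_real pi * \<i> * theta_char 1 x y t = 2 * of_real pi * \<i> * 
     (\<i> * exp (2 * of_real pi * \<i> * x * y) / (t * csqrt t) * theta_char 1 y (- x) (1 / t))"
    unfolding eq using t0 by (simp add: field_simps)
  then show ?thesis by (subst (asm) mult_left_cancel) auto
qed

section \<open>The pentagonal number theorem and the logarithmic derivative of \<open>\<eta>\<close>\<close>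

text \<open>Shanks' finite form of Euler's pentagonal number theorem.\<close>

definition shanks :: "complex \<Rightarrow> nat \<Rightarrow> complex" where
  "shanks q n = (\<Sum>s\<le>n. (-1) ^ s * (\<Prod>k\<in>{s<..n}. 1 - q ^ k) * q ^ (s * n + (\<Sum>{..s})))"

text \<open>Each difference of summands splits as \<open>G (s - 1) - G s\<close>, so only the end
  term \<open>- G n\<close> and the new summand survive. With N = n + 1 their exponents are N (3 N -
  1) / 2 and N (3 N + 1) / 2, a pair of generalized pentagonal numbers.\<close>

lemma shanks_telescope:
  "shanks q (Suc n) - shanks q n = (-1) ^ Suc n * (q ^ (Suc n * Suc n + \<Sum>{..n}) + q ^ (Suc n * Suc n + \<Sum>{..Suc n}))"
proof -
  define P where "P = (\<lambda>s. \<Prod>k\<in>{s<..n}. 1 - q ^ k)"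
  define T where "T = (\<lambda>s::nat. \<Sum>{..s})"
  have P1: "(\<Prod>k\<in>{s<..Suc n}. 1 - q ^ k) = P s * (1 - q ^ Suc n)" if "s \<le> n" for s
  proof -
    have "{s<..Suc n} = insert (Suc n) {s<..n}" using that by auto
    then show ?thesis by (simp add: P_def mult.commute)
  qed
  have P2: "P r = P (Suc r) * (1 - q ^ Suc r)" if "Suc r \<le> n" for r
  proof -
    have "{r<..n} = insert (Suc r) {Suc r<..n}" using that by auto
    then show ?thesis by (simp add: P_def mult.commute)
  qed
  have TS: "T (Suc s) = T s + Suc s" for s by (simp add: T_def)
  define G where "G = (\<lambda>s. (-1) ^ s * P s * q ^ (Suc s * Suc n + T s))"
  have step: "(-1) ^ s * (P s * (1 - q ^ Suc n)) * q ^ (s * Suc n + T s) - (-1) ^ s * P s * q ^ (s * n + T s)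
     = (if s = 0 then 0 else G (s - 1)) - G s" if "s \<le> n" for s
  proof (cases s)
    case 0
    then show ?thesis by (simp add: G_def T_def algebra_simps)
  next
    case (Suc r)
    have e1: "q ^ (s * Suc n + T s) = q ^ (s * n + T s) * q ^ s"
      unfolding power_add [symmetric] by (rule arg_cong [where f = "power q"]) simp
    have e2: "q ^ (Suc s * Suc n + T s) = q ^ (s * Suc n + T s) * q ^ Suc n"
      unfolding power_add [symmetric] by (rule arg_cong [where f = "power q"]) simp
    have e3: "q ^ (Suc r * Suc n + T r) = q ^ (s * n + T s)"
      by (rule arg_cong [where f = "power q"]) (simp add: Suc TS)
    have "G r = - ((-1) ^ s * (P s * (1 - q ^ s)) * q ^ (s * n + T s))"
      unfolding G_def e3 using P2 [of r] that Suc by simp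
    moreover have "G s = (-1) ^ s * P s * (q ^ (s * n + T s) * q ^ s * q ^ Suc n)"
      unfolding G_def e2 e1 ..
    ultimately show ?thesis using Suc unfolding e1 by (simp add: algebra_simps)
  qed
  have tele: "(\<Sum>s\<le>m. (if s = 0 then 0 else G (s - 1)) - G s) = - G m" for m
    by (induction m) auto
  have "shanks q (Suc n) = (\<Sum>s\<le>n. (-1) ^ s * (P s * (1 - q ^ Suc n)) * q ^ (s * Suc n + T s))
      + (-1) ^ Suc n * q ^ (Suc n * Suc n + T (Suc n))"
    using P1 by (simp add: shanks_def T_def)
  then have "shanks q (Suc n) - shanks q n = (\<Sum>s\<le>n. (-1) ^ s * (P s * (1 - q ^ Suc n)) * q ^ (s * Suc n + T s) - (-1) ^ s * P s * q ^ (s * n + T s))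
      + (-1) ^ Suc n * q ^ (Suc n * Suc n + T (Suc n))"
    unfolding sum_subtractf by (simp add: shanks_def P_def T_def)
  also have "(\<Sum>s\<le>n. (-1) ^ s * (P s * (1 - q ^ Suc n)) * q ^ (s * Suc n + T s) - (-1) ^ s * P s * q ^ (s * n + T s)) = - G n"
    unfolding tele [symmetric] by (rule sum.cong) (use step in auto)
  also have "G n = (-1) ^ n * q ^ (Suc n * Suc n + T n)"
    by (simp add: G_def P_def)
  finally show ?thesis by (simp add: T_def algebra_simps)
qed

lemma norm_qpow_1: "Im \<tau> > 0 \<Longrightarrow> norm (qpow \<tau> 1) < 1"
  by (simp add: qpow_def)

lemma qpow_of_nat: "qpow \<tau> (real n) = qpow \<tau> 1 ^ n"
  unfolding qpow_def by (subst exp_of_nat_mult [symmetric]) (simp add: mult_ac)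

lemma euler_product_convergent:
  assumes "norm (q::complex) < 1"
  shows "convergent_prod (\<lambda>n. 1 - q ^ Suc n)"
proof (rule abs_convergent_prod_imp_convergent_prod, rule summable_imp_abs_convergent_prod)
  have "summable (\<lambda>n. norm q ^ Suc n)"
    using assms by (intro summable_Suc_iff [THEN iffD2] summable_geometric) auto
  then show "summable (\<lambda>i. norm (1 - q ^ Suc i - 1))"
    by (simp add: norm_power norm_mult)
qed

text \<open>The summand \<open>s = 0\<close> is the partial product. Every other one contains at
  least the \<open>n\<close>-th power of \<open>q\<close> and a product bounded by \<open>K\<close>,
  so the rest is at most K n |q|^n in norm.\<close>

lemma shanks_LIMSEQ:
  assumes q: "norm q < 1"
  shows "shanks q \<longlonglongrightarrow> (\<Prod>n. 1 - q ^ Suc n)"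
proof -
  let ?t = "\<lambda>n s. (-1) ^ s * (\<Prod>k\<in>{s<..n}. 1 - q ^ k) * q ^ (s * n + \<Sum>{..s})"
  define K where "K = exp (1 / (1 - norm q))"
  have bound: "norm (\<Prod>k\<in>{s<..n}. 1 - q ^ k) \<le> K" for s n
  proof -
    have "norm (\<Prod>k\<in>{s<..n}. 1 - q ^ k) \<le> (\<Prod>k\<in>{s<..n}. 1 + norm q ^ k)"
      unfolding prod_norm [symmetric]
      by (intro prod_mono) (auto intro: order_trans [OF norm_triangle_ineq4] simp: norm_power)
    also have "\<dots> \<le> exp (\<Sum>k\<in>{s<..n}. norm q ^ k)"
      by (rule prod_le_exp_sum) auto
    also have "(\<Sum>k\<in>{s<..n}. norm q ^ k) \<le> (\<Sum>k. norm q ^ k)"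
      using q by (intro sum_le_suminf summable_geometric) auto
    also have "\<dots> = 1 / (1 - norm q)" using q by (intro suminf_geometric) auto
    finally show ?thesis by (simp add: K_def)
  qed
  have split: "shanks q n = (\<Prod>k\<in>{0<..n}. 1 - q ^ k) + (\<Sum>s\<in>{1..n}. ?t n s)" for n
  proof -
    have "{..n} = insert 0 {1..n}" by auto
    then show ?thesis by (simp add: shanks_def)
  qed
  have "(\<lambda>n. \<Sum>s\<in>{1..n}. ?t n s) \<longlonglongrightarrow> 0"
  proof (rule Lim_null_comparison [OF always_eventually])
    show "\<forall>n. norm (\<Sum>s\<in>{1..n}. ?t n s) \<le> K * (real n * norm q ^ n)"
    proof
      fix n
      have "norm (?t n s) \<le> K * norm q ^ n" if "s \<in> {1..n}" for s
      proof -
        have "n \<le> s * n + (\<Sum>{..s})" using that by (cases s) auto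
        then have "norm q ^ (s * n + (\<Sum>{..s})) \<le> norm q ^ n"
          using q by (intro power_decreasing) auto
        with bound [of s n] show ?thesis
          unfolding norm_mult norm_power by (intro mult_mono) (auto simp: K_def)
      qed
      then have "norm (\<Sum>s\<in>{1..n}. ?t n s) \<le> of_nat (card {1..n}) * (K * norm q ^ n)"
        by (intro sum_norm_bound) auto
      then show "norm (\<Sum>s\<in>{1..n}. ?t n s) \<le> K * (real n * norm q ^ n)"
        by (simp add: mult_ac)
    qed
    have "(\<lambda>n. real n * norm q ^ n) \<longlonglongrightarrow> 0"
      using powser_times_n_limit_0 [of "norm q"] q by simp
    then show "(\<lambda>n. K * (real n * norm q ^ n)) \<longlonglongrightarrow> 0"
      by (rule tendsto_mult_right_zero)
  qed
  moreover have "(\<lambda>n. \<Prod>k\<in>{0<..n}. 1 - q ^ k) \<longlonglongrightarrow> (\<Prod>n. 1 - q ^ Suc n)"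
  proof -
    have "(\<lambda>n. \<Prod>k<n. 1 - q ^ Suc k) \<longlonglongrightarrow> (\<Prod>n. 1 - q ^ Suc n)"
      by (rule LIMSEQ_lessThan_iff_atMost [where f = "\<lambda>A. \<Prod>k\<in>A. 1 - q ^ Suc k", THEN iffD2])
         (rule convergent_prod_LIMSEQ [OF euler_product_convergent [OF q]])
    moreover have "(\<Prod>k<n. 1 - q ^ Suc k) = (\<Prod>k\<in>{0<..n}. 1 - q ^ k)" for n
      by (rule prod.reindex_bij_witness [where i = "\<lambda>k. k - 1" and j = Suc]) auto
    ultimately show ?thesis by simp
  qed
  ultimately show ?thesis
    unfolding split [abs_def] using tendsto_add by fastforce
qed

text \<open>Completing the square: for m = k (3 k + 1) / 2 one has m + 1 / 24 = (3 / 2) (k + 1 /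
  6)^2, so the prefactor of \<eta> turns pentagonal exponents into those of a theta series. Passing
  from \<open>N\<close> to \<open>Suc N\<close> adds the two indices of absolute value N +
  1.\<close>

lemma eta_LIMSEQ:
  assumes "Im \<tau> > 0"
  shows "(\<lambda>N. \<Sum>k = - int N .. int N. (-1) powi k * exp (3 * of_real pi * \<i> * \<tau> * (of_int k + 1 / 6)\<^sup>2)) \<longlonglongrightarrow> eta \<tau>"
proof -
  let ?e = "\<lambda>k::int. exp (3 * of_real pi * \<i> * \<tau> * (of_int k + 1 / 6)\<^sup>2)"
  define q where "q = qpow \<tau> 1"
  have *: "qpow \<tau> (1 / 24) * q ^ m = ?e k" 
    if "2 * int m = k * (3 * k + 1)" for m k
  proof -
    have m: "2 * of_nat m = (of_int k * (3 * of_int k + 1) :: complex)"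
      using arg_cong [OF that, of "of_int :: int \<Rightarrow> complex"] by simp
    have "qpow \<tau> (1 / 24) * q ^ m = exp (2 * of_real pi * \<i> * of_real (1 / 24) * \<tau> + of_nat m * (2 * of_real pi * \<i> * \<tau>))"
      by (simp add: q_def qpow_def exp_add exp_of_nat_mult)
    also have "2 * of_real pi * \<i> * of_real (1 / 24) * \<tau> + of_nat m * (2 * of_real pi * \<i> * \<tau>) = 
        of_real pi * \<i> * \<tau> * (1 / 12 + 2 * of_nat m)" by (simp add: algebra_simps)
    also have "\<dots> = 3 * of_real pi * \<i> * \<tau> * (of_int k + 1 / 6)\<^sup>2"
      unfolding m by (simp add: field_simps power2_eq_square)
    finally show ?thesis .
  qed
  have T: "2 * \<Sum>{..n} = n * (n + 1)" for n :: nat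
    by (induction n) auto
  have "qpow \<tau> (1 / 24) * shanks q N = (\<Sum>k = - int N .. int N. (-1) powi k * ?e k)" for N
  proof (induction N)
    case 0
    show ?case using * [of 0 0] by (simp add: shanks_def)
  next
    case (Suc N)
    have T': "2 * (\<Sum>i\<le>n. int i) = int n * (int n + 1)" for n
      using arg_cong [OF T [of n], of int] by (simp add: algebra_simps)
    have "2 * int (Suc N * Suc N + \<Sum>{..N}) = - int (Suc N) * (3 * (- int (Suc N)) + 1)"
      using T' [of N] by (simp add: algebra_simps)
    note e1 = * [OF this]
    have "2 * int (Suc N * Suc N + \<Sum>{..Suc N}) = int (Suc N) * (3 * int (Suc N) + 1)"
      using T' [of "Suc N"] by (simp add: algebra_simps)
    note e2 = * [OF this]
    have "shanks q (Suc N) = shanks q N + (-1) ^ Suc N * (q ^ (Suc N * Suc N + \<Sum>{..N}) + q ^ (Suc N * Suc N + \<Sum>{..Suc N}))"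
      using shanks_telescope [of q N] by (simp only: diff_eq_eq add.commute)
    then have "qpow \<tau> (1 / 24) * shanks q (Suc N) = qpow \<tau> (1 / 24) * shanks q N + (-1) ^ Suc N * 
       (qpow \<tau> (1 / 24) * q ^ (Suc N * Suc N + \<Sum>{..N}) + qpow \<tau> (1 / 24) * q ^ (Suc N * Suc N + \<Sum>{..Suc N}))"
      by (simp only: distrib_left mult.left_commute)
    also have "\<dots> = (\<Sum>k = - int N .. int N. (-1) powi k * ?e k) +
       ((-1) powi (- int (Suc N)) * exp (3 * of_real pi * \<i> * \<tau> * (of_int (- int (Suc N)) + 1 / 6)\<^sup>2) 
        + (-1) powi (int (Suc N)) * exp (3 * of_real pi * \<i> * \<tau> * (of_int (int (Suc N)) + 1 / 6)\<^sup>2))"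
      unfolding e1 e2 Suc.IH power_int_minus power_int_of_nat power_inverse [symmetric] by (simp add: distrib_left)
    also have "\<dots> = (\<Sum>k\<in>insert (- int (Suc N)) (insert (int (Suc N)) {- int N .. int N}). (-1) powi k * ?e k)"
      by (subst sum.insert; (subst sum.insert)?) (auto simp: add_ac)
    also have "insert (- int (Suc N)) (insert (int (Suc N)) {- int N .. int N}) = {- int (Suc N) .. int (Suc N)}"
      by auto
    finally show ?case .
  qed
  moreover have "(\<lambda>N. qpow \<tau> (1 / 24) * shanks q N) \<longlonglongrightarrow> eta \<tau>"
    unfolding eta_def qpow_of_nat q_def [symmetric]
    by (intro tendsto_mult tendsto_const shanks_LIMSEQ) (use assms in \<open>simp add: q_def norm_qpow_1\<close>)
  ultimately show ?thesis by simp
qed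

lemma eta_nonzero:
  assumes "Im \<tau> > 0"
  shows "eta \<tau> \<noteq> 0"
proof -
  define q where "q = qpow \<tau> 1"
  have q: "norm q < 1" using assms by (simp add: q_def norm_qpow_1)
  have "1 - q ^ Suc n \<noteq> 0" for n
  proof
    assume "1 - q ^ Suc n = 0"
    then have "norm (q ^ Suc n) = 1" by simp
    then show False using q power_less_one_iff [of "norm q" "Suc n"] by (simp add: norm_power del: power_Suc)
  qed
  then have "(\<Prod>n. 1 - q ^ Suc n) \<noteq> 0"
    by (intro prodinf_nonzero euler_product_convergent q)
  then show ?thesis
    unfolding eta_def qpow_of_nat q_def [symmetric] by (simp add: qpow_def)
qed

section \<open>\<open>E2\<close> as the logarithmic derivative of \<eta>\<close>

text \<open>Both series rearrange the double series of d q^(d m) over positive d and m: summing over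
  m gives geometric series, collecting the terms with d m = n gives divisor sums. Absolute
  summability justifies the exchange.\<close>

lemma Lambert_series_sigma:
  fixes q :: complex
  assumes q: "norm q < 1"
  obtains S where "(\<lambda>n. of_nat (Suc n) * q ^ Suc n / (1 - q ^ Suc n)) sums S"
    and "(\<lambda>n. of_nat (\<Sum>d | d dvd Suc n. d) * q ^ Suc n) sums S"
proof -
  define g where "g = (\<lambda>(d::nat, m::nat). of_nat d * q ^ (d * m))"
  have geo: "((\<lambda>m. x ^ m) has_sum (x / (1 - x))) {1..}" if "norm x < 1" for x :: "'a :: {real_normed_field, banach}"
  proof -
    have "(\<lambda>m. x * x ^ m) sums (x * (1 / (1 - x)))"
      by (intro sums_mult geometric_sums that)
    moreover have "summable (\<lambda>m. norm (x * x ^ m))"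
      using that by (simp add: norm_mult norm_power summable_geometric summable_mult)
    ultimately have "((\<lambda>m. x ^ Suc m) has_sum (x / (1 - x))) UNIV"
      by (simp add: norm_summable_imp_has_sum)
    then have "((\<lambda>m. x ^ m) has_sum (x / (1 - x))) (range Suc)"
      by (subst has_sum_reindex) (auto simp: o_def)
    moreover have "range Suc = {1..}"
      by (auto simp: image_iff) (metis Suc_le_D One_nat_def)
    ultimately show ?thesis by simp
  qed
  have qd: "norm (q ^ d) < 1" if "d \<in> {1..}" for d
    using that q power_less_one_iff [of "norm q" d] by (auto simp: norm_power)
  have inner: "((\<lambda>m. g (d, m)) has_sum (of_nat d * (q ^ d / (1 - q ^ d)))) {1..}" if "d \<in> {1..}" for d
    using has_sum_cmult_right [OF geo [OF qd [OF that]], of "of_nat d"] by (simp add: g_def power_mult)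
  have "(\<lambda>x. norm (g x)) summable_on {1..} \<times> {1..}"
  proof (rule summable_on_SigmaI)
    fix d :: nat assume d: "d \<in> {1..}"
    have "norm (norm q ^ d) < 1" using qd [OF d] by (simp add: norm_power)
    from has_sum_cmult_right [OF geo [OF this], of "of_nat d"]
    show "((\<lambda>m. norm (g (d, m))) has_sum (real d * (norm q ^ d / (1 - norm q ^ d)))) {1..}"
      by (simp add: g_def norm_mult norm_power power_mult)
  next
    have "summable (\<lambda>d. real d * norm q ^ d)"
    proof (rule summable_comparison_test')
      show "summable (\<lambda>d. real (Suc d) * norm q ^ d)"
        using geometric_deriv_sums [of "norm q"] q by (intro sums_summable) auto
      show "norm (real d * norm q ^ d) \<le> real (Suc d) * norm q ^ d" if "d \<ge> 0" for d
        by (simp add: mult_right_mono)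
    qed
    then have "(\<lambda>d. real d * norm q ^ d) summable_on UNIV"
      by (intro norm_summable_imp_summable_on) simp
    then have "(\<lambda>d. real d * norm q ^ d) summable_on {1..}"
      by (rule summable_on_subset_banach) auto
    then have "(\<lambda>d. 1 / (1 - norm q) * (real d * norm q ^ d)) summable_on {1..}"
      by (rule summable_on_cmult_right)
    then show "(\<lambda>d. real d * (norm q ^ d / (1 - norm q ^ d))) summable_on {1..}"
    proof (rule summable_on_comparison_test)
      fix d :: nat assume d: "d \<in> {1..}"
      have "norm q ^ d \<le> norm q ^ 1" using d q by (intro power_decreasing) auto
      then have "norm q ^ d / (1 - norm q ^ d) \<le> norm q ^ d / (1 - norm q)"
        using q by (intro divide_left_mono) (auto intro!: mult_pos_pos)
      then have "real d * (norm q ^ d / (1 - norm q ^ d)) \<le> real d * (norm q ^ d / (1 - norm q))"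
        by (rule mult_left_mono) simp
      then show "real d * (norm q ^ d / (1 - norm q ^ d)) \<le> 1 / (1 - norm q) * (real d * norm q ^ d)"
        by (simp add: mult_ac)
      show "0 \<le> real d * (norm q ^ d / (1 - norm q ^ d))"
        using qd [OF d] by (simp add: norm_power)
    qed
  qed (auto simp: g_def)
  then have "g summable_on {1..} \<times> {1..}" by (rule abs_summable_summable)
  then obtain S where S: "(g has_sum S) ({1..} \<times> {1..})" by (auto simp: summable_on_def)
  have suc: "(\<lambda>n. F (Suc n)) sums S" if "(F has_sum S) {1..}" for F :: "nat \<Rightarrow> complex"
  proof -
    have "range Suc = {1..}"
      by (auto simp: image_iff) (metis Suc_le_D One_nat_def)
    with that have "(F has_sum S) (range Suc)" by simp
    then have "((\<lambda>n. F (Suc n)) has_sum S) UNIV"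
      by (subst (asm) has_sum_reindex) (auto simp: o_def)
    then show ?thesis by (rule has_sum_imp_sums)
  qed
  have 1: "((\<lambda>d. of_nat d * (q ^ d / (1 - q ^ d))) has_sum S) {1..}"
    by (rule has_sum_SigmaD [OF S inner])
  have "(g has_sum S) ({1..} \<times> {1..}) \<longleftrightarrow> ((\<lambda>(n, d). of_nat d * q ^ n) has_sum S) (Sigma {1..} (\<lambda>n. {d. d dvd n}))"
  proof (rule has_sum_reindex_bij_witness [where i = "\<lambda>(n, d). (d, n div d)" and j = "\<lambda>(d, m). (d * m, d)"])
    show "(\<lambda>(n, d). (d, n div d)) x \<in> {1..} \<times> {1..}" if "x \<in> Sigma {1..} (\<lambda>n. {d. d dvd n})" for x :: "nat \<times> nat"
      using that by (auto simp: Suc_le_eq elim!: dvdE)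
    show "(\<lambda>(d, m). (d * m, d)) x \<in> Sigma {1..} (\<lambda>n. {d. d dvd n})" if "x \<in> {1..} \<times> {1..}" for x :: "nat \<times> nat"
      using that by (auto simp: Suc_le_eq)
  qed (auto simp: g_def)
  with S have "((\<lambda>(n, d). of_nat d * q ^ n) has_sum S) (Sigma {1..} (\<lambda>n. {d. d dvd n}))"
    by blast
  then have 2: "((\<lambda>n. of_nat (\<Sum>d | d dvd n. d) * q ^ n) has_sum S) {1..}"
  proof (rule has_sum_SigmaD)
    fix n :: nat assume n: "n \<in> {1..}"
    have "((\<lambda>d. of_nat d * q ^ n) has_sum (\<Sum>d | d dvd n. of_nat d * q ^ n)) {d. d dvd n}"
      using n by (intro has_sum_finite) auto
    then show "((\<lambda>d. case (n, d) of (n, d) \<Rightarrow> of_nat d * q ^ n) has_sum of_nat (\<Sum>d | d dvd n. d) * q ^ n) {d. d dvd n}"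
      by (simp add: sum_distrib_right)
  qed
  show thesis
    using that [of S] suc [OF 1] suc [OF 2] by simp
qed

text \<open>Logarithmic differentiation of the product: q^(1/24) contributes 2 pi i / 24, the other
  factors together - 2 pi i times the Lambert series S, and 1 - 24 S is \<open>E2\<close>.\<close>

lemma eta_deriv:
  assumes \<tau>: "Im \<tau> > 0"
  shows "(eta has_field_derivative of_real pi * \<i> / 12 * E2 \<tau> * eta \<tau>) (at \<tau>)"
proof -
  define f where "f = (\<lambda>k x. 1 - qpow x (real (Suc k)))"
  define P where "P = (\<lambda>x. \<Prod>k. f k x)"
  have f': "(f k has_field_derivative - (2 * of_real pi * \<i> * of_nat (Suc k) * qpow x (real (Suc k)))) (at x)" for k x
    unfolding f_def qpow_def by (auto intro!: derivative_eq_intros simp: mult_ac)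
  have fhol: "f k holomorphic_on A" for k A
    using f' holomorphic_on_subset [of "f k" UNIV A] unfolding holomorphic_on_open [OF open_UNIV] by blast
  \<comment> \<open>On the disc of this radius the imaginary part stays at least \<open>r\<close>,
    so exp (- 2 pi r) is the ratio of a geometric majorant there.\<close>
  define r where "r = Im \<tau> / 2"
  have r: "r > 0" using \<tau> by (simp add: r_def)
  have Im: "Im x \<ge> r" if "x \<in> cball \<tau> r" for x
    using abs_Im_le_cmod [of "\<tau> - x"] that by (simp add: dist_norm r_def abs_le_iff)
  have "uniformly_convergent_on (cball \<tau> r) (\<lambda>N x. \<Prod>n<N. f n x)"
  proof (rule uniformly_convergent_on_prod')
    show "continuous_on (cball \<tau> r) (f n)" for n
      using fhol holomorphic_on_imp_continuous_on by blast
    show "uniformly_convergent_on (cball \<tau> r) (\<lambda>N x. \<Sum>n<N. norm (f n x - 1))"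
    proof (rule Weierstrass_m_test')
      show "summable (\<lambda>n. exp (- 2 * pi * r) ^ Suc n)"
        using r by (intro summable_Suc_iff [THEN iffD2] summable_geometric) auto
      fix n x assume x: "x \<in> cball \<tau> r"
      have "norm (qpow x 1) \<le> exp (- 2 * pi * r)"
        using Im [OF x] by (simp add: qpow_def)
      then have "norm (qpow x 1) ^ Suc n \<le> exp (- 2 * pi * r) ^ Suc n"
        by (intro power_mono) auto
      then show "norm (norm (f n x - 1)) \<le> exp (- 2 * pi * r) ^ Suc n"
        unfolding f_def qpow_of_nat by (simp add: norm_power norm_mult)
    qed
  qed auto
  then obtain L where L: "uniform_limit (cball \<tau> r) (\<lambda>N x. \<Prod>n<N. f n x) L sequentially"
    by (auto simp: uniformly_convergent_on_def)
  have LP: "L x = P x" if x: "x \<in> cball \<tau> r" for x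
  proof (rule LIMSEQ_unique)
    show "(\<lambda>N. \<Prod>n<N. f n x) \<longlonglongrightarrow> L x" by (rule tendsto_uniform_limitI [OF L x])
    have "norm (qpow x 1) < 1" using Im [OF x] r by (intro norm_qpow_1) linarith
    then have "convergent_prod (\<lambda>n. f n x)"
      unfolding f_def qpow_of_nat by (rule euler_product_convergent)
    then have "(\<lambda>N. \<Prod>n\<le>N. f n x) \<longlonglongrightarrow> P x"
      unfolding P_def by (rule convergent_prod_LIMSEQ)
    then show "(\<lambda>N. \<Prod>n<N. f n x) \<longlonglongrightarrow> P x"
      by (rule LIMSEQ_lessThan_iff_atMost [where f = "\<lambda>A. \<Prod>n\<in>A. f n x", THEN iffD2])
  qed
  have ulc: "uniform_limit (cball \<tau> r) (\<lambda>N x. \<Prod>n<N. f n x) P sequentially"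
    using L by (rule uniform_limit_cong' [THEN iffD1, rotated 2]) (use LP in auto)
  then have ul: "uniform_limit (ball \<tau> r) (\<lambda>N x. \<Prod>n<N. f n x) P sequentially"
    by (rule uniform_limit_on_subset) auto
  have eta: "eta x = qpow x (1 / 24) * P x" for x
    by (simp add: eta_def P_def f_def)
  have P0: "P \<tau> \<noteq> 0" using eta_nonzero [OF \<tau>] by (simp add: eta)
  have sums: "(\<lambda>k. deriv (f k) \<tau> / f k \<tau>) sums (deriv P \<tau> / P \<tau>)"
    by (rule logderiv_prodinf_complex_uniform_limit [OF ul fhol P0]) (use r in auto)
  have "P holomorphic_on ball \<tau> r"
  proof (rule holomorphic_uniform_limit [OF _ ulc])
    show "\<forall>\<^sub>F N in sequentially. continuous_on (cball \<tau> r) (\<lambda>x. \<Prod>n<N. f n x) \<and> (\<lambda>x. \<Prod>n<N. f n x) holomorphic_on ball \<tau> r"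
      using fhol by (intro always_eventually allI conjI holomorphic_on_prod continuous_on_prod holomorphic_on_imp_continuous_on)
  qed auto
  then have P': "(P has_field_derivative deriv P \<tau>) (at \<tau>)"
    using r by (intro holomorphic_derivI [OF _ open_ball]) auto
  define q where "q = qpow \<tau> 1"
  have q: "norm q < 1" using norm_qpow_1 [OF \<tau>] by (simp add: q_def)
  obtain S where S1: "(\<lambda>n. of_nat (Suc n) * q ^ Suc n / (1 - q ^ Suc n)) sums S"
    and S2: "(\<lambda>n. of_nat (\<Sum>d | d dvd Suc n. d) * q ^ Suc n) sums S"
    by (rule Lambert_series_sigma [OF q])
  have "deriv (f k) \<tau> / f k \<tau> = - (2 * of_real pi * \<i>) * (of_nat (Suc k) * q ^ Suc k / (1 - q ^ Suc k))" for k
    unfolding DERIV_imp_deriv [OF f'] unfolding f_def qpow_of_nat q_def by simp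
  with sums have "(\<lambda>k. - (2 * of_real pi * \<i>) * (of_nat (Suc k) * q ^ Suc k / (1 - q ^ Suc k))) sums (deriv P \<tau> / P \<tau>)"
    by simp
  with sums_mult [OF S1, of "- (2 * of_real pi * \<i>)"] have "deriv P \<tau> / P \<tau> = - (2 * of_real pi * \<i>) * S"
    using sums_unique2 by blast
  then have dP: "deriv P \<tau> = - (2 * of_real pi * \<i>) * S * P \<tau>"
    using P0 by (simp add: field_simps)
  have E2: "E2 \<tau> = 1 - 24 * S"
    unfolding E2_def qpow_of_nat q_def [symmetric] using sums_unique [OF S2] by simp
  have "((\<lambda>x. qpow x (1 / 24) * P x) has_field_derivative
     (2 * of_real pi * \<i> / 24 * qpow \<tau> (1 / 24)) * P \<tau> + deriv P \<tau> * qpow \<tau> (1 / 24)) (at \<tau>)"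
    by (rule DERIV_mult [OF _ P']) (auto simp: qpow_def intro!: derivative_eq_intros)
  moreover have "(2 * of_real pi * \<i> / 24 * qpow \<tau> (1 / 24)) * P \<tau> + deriv P \<tau> * qpow \<tau> (1 / 24) = of_real pi * \<i> / 12 * E2 \<tau> * eta \<tau>"
    by (simp add: dP E2 eta algebra_simps)
  moreover have "(\<lambda>x. qpow x (1 / 24) * P x) = eta"
    by (rule ext) (simp only: eta)
  ultimately show ?thesis
    by (simp only:)
qed

section \<open>Modular transformations\<close>

text \<open>Inversion changes the scale of the lattice under a theta series; splitting the index
  into residue classes modulo \<open>m\<close> restores the old scale.\<close>

lemma has_sum_int_mod:
  fixes f :: "int \<Rightarrow> complex"
  assumes m: "m > 0" and f: "(f has_sum S) UNIV"
    and g: "\<And>s. s \<in> {0..<m} \<Longrightarrow> ((\<lambda>j. f (m * j + s)) has_sum g s) UNIV"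
  shows "S = (\<Sum>s\<in>{0..<m}. g s)"
proof -
  have "(f has_sum S) UNIV \<longleftrightarrow> ((\<lambda>(s, j). f (m * j + s)) has_sum S) ({0..<m} \<times> UNIV)"
    by (rule has_sum_reindex_bij_witness [where i = "\<lambda>(s, j). m * j + s" and j = "\<lambda>n. (n mod m, n div m)"])
       (use m in auto)
  with f have "((\<lambda>(s, j). f (m * j + s)) has_sum S) ({0..<m} \<times> UNIV)" by blast
  then have "(g has_sum S) {0..<m}"
    by (rule has_sum_SigmaD) (use g in auto)
  moreover have "(g has_sum (\<Sum>s\<in>{0..<m}. g s)) {0..<m}"
    by (rule has_sum_finite) auto
  ultimately show ?thesis by (rule has_sum_unique)
qed

lemma exp_pi_i_int: "exp (of_real pi * \<i> * of_int n) = (-1) powi n"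
proof -
  have "exp (of_int n * (of_real pi * \<i>)) = exp (of_real pi * \<i>) powi n"
    by (rule exp_power_int [symmetric])
  then show ?thesis by (simp add: mult_ac)
qed

lemma exp_2pi_i_int: "exp (2 * of_real pi * \<i> * of_int n) = 1"
  using exp_eq_1 [of "2 * of_real pi * \<i> * of_int n"] by auto

section \<open>The theta series of index 3/2 and 3\<close>

definition theta_alt :: "nat \<Rightarrow> complex \<Rightarrow> complex \<Rightarrow> complex" where
  "theta_alt k x \<tau> = (\<Sum>\<^sub>\<infinity>j::int. (-1) powi j * (of_int j + x) ^ k * exp (3 * of_real pi * \<i> * \<tau> * (of_int j + x)\<^sup>2))"

definition theta_odd :: "complex \<Rightarrow> complex \<Rightarrow> complex" where
  "theta_odd x \<tau> = (\<Sum>\<^sub>\<infinity>j::int. (of_int j + x) * exp (6 * of_real pi * \<i> * \<tau> * (of_int j + x)\<^sup>2))"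

text \<open>The alternating sign is the phase of the characteristic \<open>y = 1 / 2\<close>, up to
  exp (pi i x), which is divided out.\<close>

lemma theta_alt_has_sum:
  assumes \<tau>: "Im \<tau> > 0" and k: "k \<le> 1"
  shows "((\<lambda>j::int. (-1) powi j * (of_int j + x) ^ k * exp (3 * of_real pi * \<i> * \<tau> * (of_int j + x)\<^sup>2)) 
           has_sum theta_alt k x \<tau>) UNIV"
    and "theta_alt k x \<tau> = exp (- of_real pi * \<i> * x) * theta_char k x (1 / 2) (- 3 * \<i> * \<tau>)"
proof -
  have eq: "exp (- of_real pi * \<i> * x) * ((of_int n + x) ^ k *
     gauss (- 3 * \<i> * \<tau>) (of_int n + x) (1 / 2)) =
     (-1) powi n * (of_int n + x) ^ k * exp (3 * of_real pi * \<i> * \<tau> * (of_int n + x)\<^sup>2)" for n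
  proof -
    have "exp (- of_real pi * \<i> * x) * gauss (- 3 * \<i> * \<tau>) (of_int n + x) (1 / 2) =
        exp (of_real pi * \<i> * of_int n) * exp (3 * of_real pi * \<i> * \<tau> * (of_int n + x)\<^sup>2)"
      unfolding exp_add [symmetric] by (rule arg_cong [where f = exp]) (simp add: algebra_simps)
    then show ?thesis unfolding exp_pi_i_int by (simp add: mult_ac)
  qed
  have "Re (- 3 * \<i> * \<tau>) > 0" using \<tau> by simp
  from has_sum_cmult_right [OF theta_char_has_sum [OF this k], of "exp (- of_real pi * \<i> * x)" x "1 / 2"]
  have "((\<lambda>n::int. exp (- of_real pi * \<i> * x) * ((of_int n + x) ^ k *
     gauss (- 3 * \<i> * \<tau>) (of_int n + x) (1 / 2))) has_sum 
     exp (- of_real pi * \<i> * x) * theta_char k x (1 / 2) (- 3 * \<i> * \<tau>)) UNIV" .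
  then have *: "((\<lambda>j::int. (-1) powi j * (of_int j + x) ^ k * exp (3 * of_real pi * \<i> * \<tau> * (of_int j + x)\<^sup>2)) 
           has_sum exp (- of_real pi * \<i> * x) * theta_char k x (1 / 2) (- 3 * \<i> * \<tau>)) UNIV"
    by (simp only: eq)
  show eq: "theta_alt k x \<tau> = exp (- of_real pi * \<i> * x) * theta_char k x (1 / 2) (- 3 * \<i> * \<tau>)"
    unfolding theta_alt_def by (rule infsumI [OF *])
  show "((\<lambda>j::int. (-1) powi j * (of_int j + x) ^ k * exp (3 * of_real pi * \<i> * \<tau> * (of_int j + x)\<^sup>2)) 
           has_sum theta_alt k x \<tau>) UNIV"
    unfolding eq by (rule *)
qed

lemma theta_odd_has_sum:
  assumes \<tau>: "Im \<tau> > 0" 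
  shows "((\<lambda>j::int. (of_int j + x) * exp (6 * of_real pi * \<i> * \<tau> * (of_int j + x)\<^sup>2)) has_sum theta_odd x \<tau>) UNIV"
    and "theta_odd x \<tau> = theta_char 1 x 0 (- 6 * \<i> * \<tau>)"
proof -
  have "Re (- 6 * \<i> * \<tau>) > 0" using \<tau> by simp
  from theta_char_has_sum [OF this, of 1 x 0] 
  have *: "((\<lambda>j::int. (of_int j + x) * exp (6 * of_real pi * \<i> * \<tau> * (of_int j + x)\<^sup>2)) has_sum theta_char 1 x 0 (- 6 * \<i> * \<tau>)) UNIV"
    by (simp add: mult_ac)
  show eq: "theta_odd x \<tau> = theta_char 1 x 0 (- 6 * \<i> * \<tau>)"
    unfolding theta_odd_def by (rule infsumI [OF *])
  show "((\<lambda>j::int. (of_int j + x) * exp (6 * of_real pi * \<i> * \<tau> * (of_int j + x)\<^sup>2)) has_sum theta_odd x \<tau>) UNIV"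
    unfolding eq by (rule *)
qed

lemma
  shows theta_alt_shift: "theta_alt k (x + 1) \<tau> = - theta_alt k x \<tau>"
    and theta_alt_reflect: "theta_alt k (- x) \<tau> = (-1) ^ k * theta_alt k x \<tau>"
    and theta_odd_shift: "theta_odd (x + 1) \<tau> = theta_odd x \<tau>"
    and theta_odd_reflect: "theta_odd (- x) \<tau> = - theta_odd x \<tau>"
proof -
  have bij: "bij (\<lambda>j::int. j + 1)" "bij (\<lambda>j::int. - j)"
    by (rule bij_betwI [where g = "\<lambda>n. n - 1"]; simp) (rule bij_betwI [where g = uminus]; simp)
  let ?a = "\<lambda>x (j::int). (-1) powi j * (of_int j + x) ^ k * exp (3 * of_real pi * \<i> * \<tau> * (of_int j + x)\<^sup>2) :: complex"
  have "theta_alt k (x + 1) \<tau> = (\<Sum>\<^sub>\<infinity>j::int. - ?a x (j + 1))"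
    unfolding theta_alt_def by (rule infsum_cong) (simp add: power_int_add add_ac)
  also have "\<dots> = - theta_alt k x \<tau>"
    unfolding infsum_uminus theta_alt_def by (subst infsum_reindex_bij_betw [OF bij(1)]) simp
  finally show "theta_alt k (x + 1) \<tau> = - theta_alt k x \<tau>" .
  have "theta_alt k (- x) \<tau> = (\<Sum>\<^sub>\<infinity>j::int. (-1) ^ k * ?a x (- j))"
    unfolding theta_alt_def
  proof (rule infsum_cong)
    fix j :: int
    have "of_int j + - x = - (of_int (- j) + x)" by simp
    then have "(of_int j + - x) ^ k = (-1) ^ k * (of_int (- j) + x) ^ k" "(of_int j + - x)\<^sup>2 = (of_int (- j) + x)\<^sup>2"
      by (metis power_minus) (metis \<open>of_int j + - x = - (of_int (- j) + x)\<close> power2_minus)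
    then show "?a (- x) j = (-1) ^ k * ?a x (- j)"
      by (simp add: power_int_minus mult_ac flip: power_int_inverse)
  qed
  also have "\<dots> = (-1) ^ k * theta_alt k x \<tau>"
    unfolding infsum_cmult_right' theta_alt_def by (subst infsum_reindex_bij_betw [OF bij(2)]) simp
  finally show "theta_alt k (- x) \<tau> = (-1) ^ k * theta_alt k x \<tau>" .
  let ?b = "\<lambda>x (j::int). (of_int j + x) * exp (6 * of_real pi * \<i> * \<tau> * (of_int j + x)\<^sup>2) :: complex"
  have "theta_odd (x + 1) \<tau> = (\<Sum>\<^sub>\<infinity>j::int. ?b x (j + 1))"
    unfolding theta_odd_def by (rule infsum_cong) (simp add: add_ac)
  also have "\<dots> = theta_odd x \<tau>"
    unfolding theta_odd_def by (subst infsum_reindex_bij_betw [OF bij(1)]) simp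
  finally show "theta_odd (x + 1) \<tau> = theta_odd x \<tau>" .
  have "theta_odd (- x) \<tau> = (\<Sum>\<^sub>\<infinity>j::int. - ?b x (- j))"
    unfolding theta_odd_def
  proof (rule infsum_cong)
    fix j :: int
    have "(of_int j + - x)\<^sup>2 = (of_int (- j) + x)\<^sup>2"
      by (simp add: power2_eq_square algebra_simps)
    then show "?b (- x) j = - ?b x (- j)" by (simp add: algebra_simps)
  qed
  also have "\<dots> = - theta_odd x \<tau>"
    unfolding infsum_uminus theta_odd_def by (subst infsum_reindex_bij_betw [OF bij(2)]) simp
  finally show "theta_odd (- x) \<tau> = - theta_odd x \<tau>" .
qed

text \<open>Shift and reflection combined. They fold the residue classes produced by inversion onto
  few independent functions, and a class that the fold sends to its own negative vanishes.\<close>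

lemma theta_special_values:
  shows "theta_alt 1 (5 / 6) \<tau> = theta_alt 1 (1 / 6) \<tau>"
    and "theta_alt 0 (5 / 6) \<tau> = - theta_alt 0 (1 / 6) \<tau>"
    and "theta_alt 0 (1 / 2) \<tau> = 0"
    and "theta_odd 0 \<tau> = 0" and "theta_odd (1 / 2) \<tau> = 0"
    and "theta_odd (5 / 6) \<tau> = - theta_odd (1 / 6) \<tau>"
    and "theta_odd (2 / 3) \<tau> = - theta_odd (1 / 3) \<tau>"
  using theta_alt_shift [of 1 "- (1 / 6)" \<tau>] theta_alt_reflect [of 1 "1 / 6" \<tau>]
    theta_alt_shift [of 0 "- (1 / 6)" \<tau>] theta_alt_reflect [of 0 "1 / 6" \<tau>]
    theta_alt_shift [of 0 "- (1 / 2)" \<tau>] theta_alt_reflect [of 0 "1 / 2" \<tau>]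
    theta_odd_reflect [of 0 \<tau>] theta_odd_shift [of "- (1 / 2)" \<tau>] theta_odd_reflect [of "1 / 2" \<tau>]
    theta_odd_shift [of "- (1 / 6)" \<tau>] theta_odd_reflect [of "1 / 6" \<tau>]
    theta_odd_shift [of "- (1 / 3)" \<tau>] theta_odd_reflect [of "1 / 3" \<tau>]
  by auto

lemma theta_eq:
  shows "theta 1 3 1 \<tau> = theta_odd (1 / 6) \<tau>" "theta 1 3 2 \<tau> = theta_odd (1 / 3) \<tau>"
    and "theta 1 (3 / 2) 1 \<tau> = theta_alt 1 (1 / 6) \<tau>" "theta 1 (3 / 2) 0 \<tau> = theta_alt 1 (1 / 2) \<tau>"
proof -
  have 3: "(3::real) \<in> \<int>" by simp
  have 32: "(3 / 2 :: real) \<notin> \<int>"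
  proof
    assume "(3 / 2 :: real) \<in> \<int>"
    then obtain n where "3 / 2 = real_of_int n" by (elim Ints_cases)
    then have "real_of_int 3 = real_of_int (2 * n)" by simp
    then have "3 = 2 * n" by (simp only: of_int_eq_iff)
    then show False by presburger
  qed
  show "theta 1 3 1 \<tau> = theta_odd (1 / 6) \<tau>" "theta 1 3 2 \<tau> = theta_odd (1 / 3) \<tau>"
    unfolding theta_def theta_odd_def using 3 by (simp_all add: Let_def qpow_def mult_ac)
  show "theta 1 (3 / 2) 0 \<tau> = theta_alt 1 (1 / 2) \<tau>"
    unfolding theta_def theta_alt_def using 32 by (simp add: Let_def qpow_def mult_ac)
  \<comment> \<open>Here r / (2 m) + 1 / 2 = 1 / 3 + 1 / 2 = 5 / 6, which reflection and shift
    identify with 1 / 6.\<close>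
  have "theta 1 (3 / 2) 1 \<tau> = theta_alt 1 (5 / 6) \<tau>"
    unfolding theta_def theta_alt_def using 32 by (simp add: Let_def qpow_def mult_ac add.assoc)
  then show "theta 1 (3 / 2) 1 \<tau> = theta_alt 1 (1 / 6) \<tau>"
    by (simp only: theta_special_values)
qed

text \<open>The pentagonal series was reached along symmetric partial sums; summability of the theta
  series identifies that limit with the unordered sum.\<close>

lemma eta_eq_theta_alt:
  assumes "Im \<tau> > 0"
  shows "eta \<tau> = theta_alt 0 (1 / 6) \<tau>"
  using LIMSEQ_unique [OF eta_LIMSEQ [OF assms] has_sum_int_LIMSEQ(1) [OF theta_alt_has_sum(1) [OF assms, of 0 "1 / 6", simplified]]]
  by simp

lemma Im_minus_inverse: "Im \<tau> > 0 \<Longrightarrow> Im (- 1 / \<tau>) > 0"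
  by (auto simp: Im_divide intro!: divide_pos_pos sum_power2_gt_zero_iff [THEN iffD2])

text \<open>The inverted parameter 1 / t = - i \<tau> / 3 is a ninth of - 3 i \<tau>. Writing the
  index as 3 j + s gives n + 1 / 2 = 3 (j + (2 s + 1) / 6), and the square of 3 restores the
  parameter. What remains is a discrete Fourier transform over the classes \<open>s\<close>.\<close>

lemma theta_alt_inversion:
  assumes \<tau>: "Im \<tau> > 0" and k: "k \<le> 1" and t: "t = 3 * \<i> / \<tau>"
  shows "theta_alt k (of_int (2 * p + 1) / 6) (- 1 / \<tau>) = (3 * \<i> / t) ^ k / csqrt t *
     (\<Sum>s\<in>{0..<3}. exp (- of_real pi * \<i> * of_int (2 * s + 1) * of_int (2 * p + 1) / 6) * theta_alt k (of_int (2 * s + 1) / 6) \<tau>)"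
proof -
  let ?e = "\<lambda>s::int. exp (- of_real pi * \<i> * of_int (2 * s + 1) * of_int (2 * p + 1) / 6) :: complex"
  define x :: complex where "x = of_int (2 * p + 1) / 6"
  have \<tau>0: "\<tau> \<noteq> 0" using \<tau> by auto
  have Ret: "Re t > 0" using \<tau> unfolding t by (auto simp: Re_divide intro!: divide_pos_pos sum_power2_gt_zero_iff [THEN iffD2])
  have t1: "1 / t = - \<i> * \<tau> / 3" using \<tau>0 by (simp add: t field_simps)
  have tS: "- 3 * \<i> * (- 1 / \<tau>) = t" by (simp add: t)
  have ImS: "Im (- 1 / \<tau>) > 0"
    by (rule Im_minus_inverse [OF \<tau>])
  have inv: "theta_char k x (1 / 2) t = (\<i> / t) ^ k * exp (of_real pi * \<i> * x) / csqrt t * theta_char k (1 / 2) (- x) (1 / t)"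
    using theta_char_0_inversion [OF Ret, of x "1 / 2"] theta_char_1_inversion [OF Ret, of x "1 / 2"] k
    by (cases k) (auto simp: mult_ac)
  have "theta_char k (1 / 2) (- x) (1 / t) = (\<Sum>s\<in>{0..<3}. 3 ^ k * 
      ?e s * theta_alt k (of_int (2 * s + 1) / 6) \<tau>)"
  proof (rule has_sum_int_mod)
    show "((\<lambda>n::int. (of_int n + 1 / 2) ^ k *
     gauss (1 / t) (of_int n + 1 / 2) (- x)) has_sum theta_char k (1 / 2) (- x) (1 / t)) UNIV"
      by (rule theta_char_has_sum [OF Re_inverse_pos [OF Ret] k])
    fix s :: int
    let ?y = "of_int (2 * s + 1) / 6 :: complex"
    have "(of_int (3 * j + s) + 1 / 2) ^ k *
       gauss (1 / t) (of_int (3 * j + s) + 1 / 2) (- x) =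
       3 ^ k * ?e s * ((-1) powi j * (of_int j + ?y) ^ k * exp (3 * of_real pi * \<i> * \<tau> * (of_int j + ?y)\<^sup>2))" for j
    proof -
      have n: "of_int (3 * j + s) + 1 / 2 = 3 * (of_int j + ?y)" by (simp add: field_simps)
      have "- of_real pi * (1 / t) * (3 * (of_int j + ?y))\<^sup>2 = 3 * of_real pi * \<i> * \<tau> * (of_int j + ?y)\<^sup>2"
        unfolding t1 by (simp add: field_simps power2_eq_square)
      \<comment> \<open>Since 2 p + 1 is odd, the part of the phase that depends on \<open>j\<close>
        is pi i j up to a multiple of 2 pi i: the alternating sign reappears.\<close>
      moreover have "2 * of_real pi * \<i> * (3 * (of_int j + ?y)) * (- x) = 
         - of_real pi * \<i> * of_int (2 * s + 1) * of_int (2 * p + 1) / 6 + (of_real pi * \<i> * of_int j + 2 * of_real pi * \<i> * of_int (- j * (p + 1)))"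
        by (simp add: x_def field_simps)
      ultimately have "gauss (1 / t) (3 * (of_int j + ?y)) (- x) =
         exp (3 * of_real pi * \<i> * \<tau> * (of_int j + ?y)\<^sup>2) * (?e s * (-1) powi j)"
        by (simp only: exp_add exp_2pi_i_int exp_pi_i_int mult_1_right)
      then show ?thesis
        unfolding n power_mult_distrib by (simp only: mult_ac)
    qed
    then show "((\<lambda>j. (of_int (3 * j + s) + 1 / 2) ^ k *
       gauss (1 / t) (of_int (3 * j + s) + 1 / 2) (- x)) has_sum
       3 ^ k * ?e s * theta_alt k ?y \<tau>) UNIV"
      using has_sum_cmult_right [OF theta_alt_has_sum(1) [OF \<tau> k, of ?y], of "3 ^ k * ?e s"]
      by simp
  qed simp
  then have "theta_char k x (1 / 2) t = (\<i> / t) ^ k * exp (of_real pi * \<i> * x) / csqrt t * (3 ^ k * (\<Sum>s\<in>{0..<3}. 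
      ?e s * theta_alt k (of_int (2 * s + 1) / 6) \<tau>))"
    unfolding inv by (simp add: sum_distrib_left mult.assoc)
  moreover have "theta_alt k x (- 1 / \<tau>) = exp (- of_real pi * \<i> * x) * theta_char k x (1 / 2) t"
    using theta_alt_has_sum(2) [OF ImS k, of x] unfolding tS .
  moreover have "exp (- of_real pi * \<i> * x) * exp (of_real pi * \<i> * x) = 1"
    by (simp flip: exp_add)
  ultimately show ?thesis
    unfolding x_def [symmetric] by (simp add: power_mult_distrib power_divide mult_ac)
qed

text \<open>Here 1 / t = - i \<tau> / 6 is a thirty-sixth of - 6 i \<tau>, so classes modulo 6 are
  needed; without an alternating sign the inverted sum runs over integers.\<close>

lemma theta_odd_inversion:
  assumes \<tau>: "Im \<tau> > 0" and t: "t = 6 * \<i> / \<tau>"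
  shows "theta_odd (of_int r / 6) (- 1 / \<tau>) = 6 * \<i> / (t * csqrt t) *
     (\<Sum>s\<in>{0..<6}. exp (- of_real pi * \<i> * of_int s * of_int r / 3) * theta_odd (of_int s / 6) \<tau>)"
proof -
  let ?e = "\<lambda>s::int. exp (- of_real pi * \<i> * of_int s * of_int r / 3) :: complex"
  define x :: complex where "x = of_int r / 6"
  have \<tau>0: "\<tau> \<noteq> 0" using \<tau> by auto
  have Ret: "Re t > 0" using \<tau> unfolding t by (auto simp: Re_divide intro!: divide_pos_pos sum_power2_gt_zero_iff [THEN iffD2])
  have t1: "1 / t = - \<i> * \<tau> / 6" using \<tau>0 by (simp add: t field_simps)
  have tS: "- 6 * \<i> * (- 1 / \<tau>) = t" by (simp add: t)
  have ImS: "Im (- 1 / \<tau>) > 0"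
    by (rule Im_minus_inverse [OF \<tau>])
  have "theta_char 1 0 (- x) (1 / t) = (\<Sum>s\<in>{0..<6}. 6 * 
      ?e s * theta_odd (of_int s / 6) \<tau>)"
  proof (rule has_sum_int_mod)
    show "((\<lambda>n::int. (of_int n + 0) ^ 1 *
     gauss (1 / t) (of_int n + 0) (- x)) has_sum theta_char 1 0 (- x) (1 / t)) UNIV"
      by (rule theta_char_has_sum [OF Re_inverse_pos [OF Ret]]) simp
    fix s :: int
    let ?y = "of_int s / 6 :: complex"
    have "(of_int (6 * j + s) + 0) ^ 1 *
       gauss (1 / t) (of_int (6 * j + s) + 0) (- x) =
       6 * ?e s * ((of_int j + ?y) * exp (6 * of_real pi * \<i> * \<tau> * (of_int j + ?y)\<^sup>2))" for j
    proof -
      have n: "of_int (6 * j + s) + 0 = 6 * (of_int j + ?y)" by (simp add: field_simps)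
      have "- of_real pi * (1 / t) * (6 * (of_int j + ?y))\<^sup>2 = 6 * of_real pi * \<i> * \<tau> * (of_int j + ?y)\<^sup>2"
        unfolding t1 by (simp add: field_simps power2_eq_square)
      moreover have "2 * of_real pi * \<i> * (6 * (of_int j + ?y)) * (- x) = 
         - of_real pi * \<i> * of_int s * of_int r / 3 + 2 * of_real pi * \<i> * of_int (- j * r)"
        by (simp add: x_def field_simps)
      ultimately have "gauss (1 / t) (6 * (of_int j + ?y)) (- x) =
         exp (6 * of_real pi * \<i> * \<tau> * (of_int j + ?y)\<^sup>2) * ?e s"
        by (simp only: exp_add exp_2pi_i_int mult_1_right)
      then show ?thesis
        unfolding n power_one_right by (simp only: mult_ac)
    qed
    then show "((\<lambda>j. (of_int (6 * j + s) + 0) ^ 1 *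
       gauss (1 / t) (of_int (6 * j + s) + 0) (- x)) has_sum
       6 * ?e s * theta_odd ?y \<tau>) UNIV"
      using has_sum_cmult_right [OF theta_odd_has_sum(1) [OF \<tau>, of ?y], of "6 * ?e s"]
      by simp
  qed simp
  then have "theta_char 1 x 0 t = \<i> / (t * csqrt t) * (6 * (\<Sum>s\<in>{0..<6}. ?e s * theta_odd (of_int s / 6) \<tau>))"
    unfolding theta_char_1_inversion [OF Ret, of x 0] by (simp add: sum_distrib_left mult.assoc)
  moreover have "theta_odd x (- 1 / \<tau>) = theta_char 1 x 0 t"
    using theta_odd_has_sum(2) [OF ImS, of x] unfolding tS .
  ultimately show ?thesis
    unfolding x_def [symmetric] by simp
qed

lemma exp_pi_sixth: "exp (- of_real pi * \<i> / 6) = of_real (sqrt 3 / 2) - \<i> / 2"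
proof -
  have "exp (- of_real pi * \<i> / 6) = cis (- (pi / 6))"
    by (simp add: cis_conv_exp mult_ac)
  then show ?thesis by (simp add: complex_eq_iff cos_30 sin_30)
qed

lemma
  defines "\<omega> \<equiv> exp (- of_real pi * \<i> / 6)"
  shows omega_power: "exp (- of_real pi * \<i> * of_nat n / 6) = \<omega> ^ n"
    and omega_2: "\<omega>\<^sup>2 = 1 / 2 - \<i> * of_real (sqrt 3) / 2"
    and omega_3: "\<omega> ^ 3 = - \<i>"
proof -
  show "exp (- of_real pi * \<i> * of_nat n / 6) = \<omega> ^ n"
    unfolding \<omega>_def exp_of_nat_mult [symmetric] by (simp add: mult_ac)
  have s3: "(complex_of_real (sqrt 3))\<^sup>2 = 3"
    by (simp flip: of_real_power)
  have \<omega>: "\<omega> = (of_real (sqrt 3) - \<i>) / 2"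
    unfolding \<omega>_def exp_pi_sixth by (simp add: diff_divide_distrib)
  show 2: "\<omega>\<^sup>2 = 1 / 2 - \<i> * of_real (sqrt 3) / 2"
    unfolding \<omega> power_divide using s3 by (simp add: power2_eq_square field_simps)
  have "\<omega> ^ 3 = \<omega>\<^sup>2 * \<omega>" by (simp add: power3_eq_cube power2_eq_square)
  also have "\<dots> = - \<i>"
    unfolding 2 unfolding \<omega> using s3 by (simp add: power2_eq_square field_simps)
  finally show "\<omega> ^ 3 = - \<i>" .
qed

text \<open>The Fourier matrix of powers of \<omega> = exp (- pi i / 6), folded by the special
  values. In weight 0 the class 1 / 2 drops out and \<omega> - \<omega>^5 = sqrt 3. In weight 1 the
  folded coefficient is \<omega> + \<omega>^5 = - i, which cancels the i in 3 i / t.\<close>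

lemma
  assumes \<tau>: "Im \<tau> > 0" and t: "t = 3 * \<i> / \<tau>"
  shows eta_inversion: "eta (- 1 / \<tau>) = of_real (sqrt 3) / csqrt t * eta \<tau>"
    and theta_alt_inversion_6: "theta_alt 1 (1 / 6) (- 1 / \<tau>) = 3 / (t * csqrt t) * (theta_alt 1 (1 / 6) \<tau> + theta_alt 1 (1 / 2) \<tau>)"
    and theta_alt_inversion_2: "theta_alt 1 (1 / 2) (- 1 / \<tau>) = 3 / (t * csqrt t) * (2 * theta_alt 1 (1 / 6) \<tau> - theta_alt 1 (1 / 2) \<tau>)"
proof -
  define \<omega> where "\<omega> = exp (- of_real pi * \<i> / 6)"
  have \<omega>: "\<omega> = (of_real (sqrt 3) - \<i>) / 2"
    unfolding \<omega>_def exp_pi_sixth by (simp add: diff_divide_distrib)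
  have \<omega>2: "\<omega>\<^sup>2 = 1 / 2 - \<i> * of_real (sqrt 3) / 2" and \<omega>3: "\<omega> ^ 3 = - \<i>"
    using omega_2 omega_3 by (simp_all add: \<omega>_def)
  have s3: "complex_of_real (sqrt 3) * complex_of_real (sqrt 3) = 3"
    by (simp flip: of_real_mult)
  have \<omega>5: "\<omega> ^ 5 = - (of_real (sqrt 3) + \<i>) / 2"
  proof -
    have "\<omega> ^ 5 = \<omega> ^ 3 * \<omega>\<^sup>2" by (simp flip: power_add)
    then show ?thesis unfolding \<omega>3 \<omega>2 by (simp add: field_simps)
  qed
  have "\<omega> ^ 9 = (\<omega> ^ 3) ^ 3" "\<omega> ^ 15 = (\<omega> ^ 3) ^ 5"
    by (simp_all flip: power_mult)
  then have \<omega>9: "\<omega> ^ 9 = \<i>" and \<omega>15: "\<omega> ^ 15 = - \<i>"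
    unfolding \<omega>3 by (simp_all add: eval_nat_numeral)
  have e: "exp (- of_real pi * \<i> * of_nat n / 6) = \<omega> ^ n" for n
    unfolding \<omega>_def by (rule omega_power)
  have e': "exp (- of_real pi * \<i> * of_int a * of_int b / 6) = \<omega> ^ n" if "a * b = int n" for a b n
  proof -
    have "of_int a * of_int b = (of_nat n :: complex)" 
      using arg_cong [OF that, of "of_int :: int \<Rightarrow> complex"] by simp
    then show ?thesis using e [of n] by (simp only: mult.assoc)
  qed
  have set: "{0..<3::int} = {0, 1, 2}" by auto
  have t0: "t \<noteq> 0" "csqrt t \<noteq> 0" using \<tau> by (auto simp: t)
  have ImS: "Im (- 1 / \<tau>) > 0"
    by (rule Im_minus_inverse [OF \<tau>])
  have 1: "theta_alt k (1 / 6) (- 1 / \<tau>) = (3 * \<i> / t) ^ k / csqrt t *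
      (\<omega> * theta_alt k (1 / 6) \<tau> - \<i> * theta_alt k (1 / 2) \<tau> + \<omega> ^ 5 * theta_alt k (5 / 6) \<tau>)" if "k \<le> 1" for k
    using theta_alt_inversion [OF \<tau> that t, of 0] e' [of 1 1 1] e' [of 3 1 3] e' [of 5 1 5]
    by (simp add: set \<omega>3 add_ac)
  have 2: "theta_alt 1 (1 / 2) (- 1 / \<tau>) = (3 * \<i> / t) ^ 1 / csqrt t *
      (- \<i> * theta_alt 1 (1 / 6) \<tau> + \<i> * theta_alt 1 (1 / 2) \<tau> - \<i> * theta_alt 1 (5 / 6) \<tau>)"
  proof -
    have p: "exp (- of_real pi * \<i> * of_int (2 * 0 + 1) * of_int (2 * 1 + 1) / 6) = \<omega> ^ 3"
      "exp (- of_real pi * \<i> * of_int (2 * 1 + 1) * of_int (2 * 1 + 1) / 6) = \<omega> ^ 9"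
      "exp (- of_real pi * \<i> * of_int (2 * 2 + 1) * of_int (2 * 1 + 1) / 6) = \<omega> ^ 15"
      by (rule e'; simp)+
    have sum3: "(\<Sum>s\<in>{0..<3::int}. h s) = h 0 + h 1 + h 2" for h :: "int \<Rightarrow> complex"
      by (simp add: set)
    show ?thesis
      using theta_alt_inversion [OF \<tau> order.refl t, of 1] unfolding sum3 p \<omega>3 \<omega>9 \<omega>15 by simp
  qed
  show "eta (- 1 / \<tau>) = of_real (sqrt 3) / csqrt t * eta \<tau>"
    unfolding eta_eq_theta_alt [OF ImS] eta_eq_theta_alt [OF \<tau>] 1 [OF zero_le_one]
    unfolding theta_special_values \<omega>5 unfolding \<omega> using t0 by (simp add: field_simps)
  show "theta_alt 1 (1 / 6) (- 1 / \<tau>) = 3 / (t * csqrt t) * (theta_alt 1 (1 / 6) \<tau> + theta_alt 1 (1 / 2) \<tau>)"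
    unfolding 1 [OF order.refl] theta_special_values \<omega>5 unfolding \<omega> using t0 by (simp add: field_simps)
  show "theta_alt 1 (1 / 2) (- 1 / \<tau>) = 3 / (t * csqrt t) * (2 * theta_alt 1 (1 / 6) \<tau> - theta_alt 1 (1 / 2) \<tau>)"
    unfolding 2 theta_special_values using t0 by (simp add: field_simps)
qed

text \<open>The classes 0 and 3 modulo 6 vanish and the others pair up with opposite signs; each
  surviving coefficient is \<omega>^2 - i \<omega> = - i sqrt 3 up to sign.\<close>

lemma
  assumes \<tau>: "Im \<tau> > 0" and t: "t = 6 * \<i> / \<tau>"
  shows theta_odd_inversion_1: "theta_odd (1 / 6) (- 1 / \<tau>) = 6 * of_real (sqrt 3) / (t * csqrt t) * (theta_odd (1 / 6) \<tau> + theta_odd (1 / 3) \<tau>)"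
    and theta_odd_inversion_2: "theta_odd (1 / 3) (- 1 / \<tau>) = 6 * of_real (sqrt 3) / (t * csqrt t) * (theta_odd (1 / 6) \<tau> - theta_odd (1 / 3) \<tau>)"
proof -
  define \<omega> where "\<omega> = exp (- of_real pi * \<i> / 6)"
  have \<omega>: "\<omega> = (of_real (sqrt 3) - \<i>) / 2"
    unfolding \<omega>_def exp_pi_sixth by (simp add: diff_divide_distrib)
  have \<omega>2: "\<omega>\<^sup>2 = 1 / 2 - \<i> * of_real (sqrt 3) / 2" and \<omega>3: "\<omega> ^ 3 = - \<i>"
    using omega_2 omega_3 by (simp_all add: \<omega>_def)
  have \<omega>n: "\<omega> ^ 4 = - \<i> * \<omega>" "\<omega> ^ 8 = - (\<omega>\<^sup>2)" "\<omega> ^ 10 = \<i> * \<omega>" "\<omega> ^ 16 = - \<i> * \<omega>" "\<omega> ^ 20 = - (\<omega>\<^sup>2)"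
  proof -
    have *: "\<omega> ^ (3 * a + b) = (- \<i>) ^ a * \<omega> ^ b" for a b by (simp add: power_add power_mult \<omega>3)
    show "\<omega> ^ 4 = - \<i> * \<omega>" using * [of 1 1] by simp
    show "\<omega> ^ 8 = - (\<omega>\<^sup>2)" using * [of 2 2] by simp
    show "\<omega> ^ 10 = \<i> * \<omega>" using * [of 3 1] by (simp add: eval_nat_numeral)
    show "\<omega> ^ 16 = - \<i> * \<omega>" using * [of 5 1] by (simp add: eval_nat_numeral)
    show "\<omega> ^ 20 = - (\<omega>\<^sup>2)" using * [of 6 2] by (simp add: eval_nat_numeral)
  qed
  have e': "exp (- of_real pi * \<i> * of_int a * of_int b / 3) = \<omega> ^ n" if "2 * (a * b) = int n" for a b n
  proof -
    have "2 * (of_int a * of_int b) = (of_nat n :: complex)" 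
      using arg_cong [OF that, of "of_int :: int \<Rightarrow> complex"] by simp
    then have "- of_real pi * \<i> * of_int a * of_int b / 3 = - of_real pi * \<i> * of_nat n / 6"
      by (simp add: field_simps)
    then show ?thesis using omega_power [of n] by (simp only: \<omega>_def)
  qed
  have set: "{0..<6::int} = {0, 1, 2, 3, 4, 5}" by auto
  have t0: "t \<noteq> 0" "csqrt t \<noteq> 0" using \<tau> by (auto simp: t)
  have \<omega>24: "\<omega>\<^sup>2 - \<i> * \<omega> = - \<i> * of_real (sqrt 3)"
    unfolding \<omega>2 unfolding \<omega> by (simp add: field_simps)
  have i: "6 * \<i> / (t * csqrt t) * ((\<omega>\<^sup>2 - \<i> * \<omega>) * X) = 6 * of_real (sqrt 3) / (t * csqrt t) * X" for X
    unfolding \<omega>24 using t0 by (simp add: field_simps)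
  have "theta_odd (1 / 6) (- 1 / \<tau>) = 6 * \<i> / (t * csqrt t) *
     (\<omega>\<^sup>2 * theta_odd (1 / 6) \<tau> - \<i> * \<omega> * theta_odd (1 / 3) \<tau> - \<omega>\<^sup>2 * theta_odd (2 / 3) \<tau> + \<i> * \<omega> * theta_odd (5 / 6) \<tau>)"
    using theta_odd_inversion [OF \<tau> t, of 1] e' [of 1 1 2] e' [of 2 1 4] e' [of 4 1 8] e' [of 5 1 10]
    by (simp add: set \<omega>n theta_special_values add_ac)
  also have "\<omega>\<^sup>2 * theta_odd (1 / 6) \<tau> - \<i> * \<omega> * theta_odd (1 / 3) \<tau> - \<omega>\<^sup>2 * theta_odd (2 / 3) \<tau> + \<i> * \<omega> * theta_odd (5 / 6) \<tau> =
      (\<omega>\<^sup>2 - \<i> * \<omega>) * (theta_odd (1 / 6) \<tau> + theta_odd (1 / 3) \<tau>)"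
    unfolding theta_special_values by (simp add: algebra_simps)
  finally show "theta_odd (1 / 6) (- 1 / \<tau>) = 6 * of_real (sqrt 3) / (t * csqrt t) * (theta_odd (1 / 6) \<tau> + theta_odd (1 / 3) \<tau>)"
    by (simp only: i)
  have "theta_odd (1 / 3) (- 1 / \<tau>) = 6 * \<i> / (t * csqrt t) *
     (- \<i> * \<omega> * theta_odd (1 / 6) \<tau> - \<omega>\<^sup>2 * theta_odd (1 / 3) \<tau> - \<i> * \<omega> * theta_odd (2 / 3) \<tau> - \<omega>\<^sup>2 * theta_odd (5 / 6) \<tau>)"
    using theta_odd_inversion [OF \<tau> t, of 2] e' [of 1 2 4] e' [of 2 2 8] e' [of 4 2 16] e' [of 5 2 20]
    by (simp add: set \<omega>n theta_special_values add_ac)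
  also have "- \<i> * \<omega> * theta_odd (1 / 6) \<tau> - \<omega>\<^sup>2 * theta_odd (1 / 3) \<tau> - \<i> * \<omega> * theta_odd (2 / 3) \<tau> - \<omega>\<^sup>2 * theta_odd (5 / 6) \<tau> =
      (\<omega>\<^sup>2 - \<i> * \<omega>) * (theta_odd (1 / 6) \<tau> - theta_odd (1 / 3) \<tau>)"
    unfolding theta_special_values by (simp add: algebra_simps)
  finally show "theta_odd (1 / 3) (- 1 / \<tau>) = 6 * of_real (sqrt 3) / (t * csqrt t) * (theta_odd (1 / 6) \<tau> - theta_odd (1 / 3) \<tau>)"
    by (simp only: i)
qed

section \<open>Modularity of \<eta> squared and of the kernel\<close>

definition wedge_form :: "complex \<Rightarrow> complex \<Rightarrow> complex" where
  "wedge_form w1 w2 = 4 * f0 w1 w2 + g0 w1 w2"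

text \<open>As \<open>f0\<close> and \<open>g0\<close> are determinants, a linear substitution of
  their theta series multiplies them by its determinant, here - 2 for index 3 and - 3 for index 3/2.
  With the products of prefactors 27 / 2 and 9 both give - 27, so \<open>f0\<close> and
  \<open>g0\<close> transform alike. The eta powers contribute 27, and the quotient - 1 is written
  as a square because - i is the multiplier of \<eta>^2 under inversion.\<close>

lemma wedge_form_inversion:
  assumes w: "Im w1 > 0" "Im w2 > 0"
  shows "wedge_form (- 1 / w1) (- 1 / w2) / (eta (- 1 / w1) ^ 3 * eta (- 1 / w2) ^ 3) =
     (- \<i>)\<^sup>2 * (wedge_form w1 w2 / (eta w1 ^ 3 * eta w2 ^ 3))"
proof -
  define t where "t = (\<lambda>w. 3 * \<i> / w)"
  define u where "u = (\<lambda>w. t w * csqrt (t w))"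
  have nz: "t w \<noteq> 0" "u w \<noteq> 0" "eta w \<noteq> 0" if "Im w > 0" for w
    using that eta_nonzero [OF that] by (auto simp: t_def u_def)
  have s3: "complex_of_real (sqrt 3) * complex_of_real (sqrt 3) = 3" "complex_of_real (sqrt 3) ^ 3 = 3 * of_real (sqrt 3)"
    by (simp_all add: power3_eq_cube flip: of_real_mult)
  have eta3: "eta (- 1 / w) ^ 3 = 3 * of_real (sqrt 3) / u w * eta w ^ 3" if "Im w > 0" for w
  proof -
    have "csqrt (t w) ^ 3 = u w"
      using power2_csqrt [of "t w"] by (simp add: u_def power3_eq_cube power2_eq_square)
    then show ?thesis
      unfolding eta_inversion [OF that t_def [THEN fun_cong]] power_mult_distrib power_divide s3 by simp
  qed
  have alt: "theta_alt 1 (1 / 6) (- 1 / w) = 3 / u w * (theta_alt 1 (1 / 6) w + theta_alt 1 (1 / 2) w)"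
      "theta_alt 1 (1 / 2) (- 1 / w) = 3 / u w * (2 * theta_alt 1 (1 / 6) w - theta_alt 1 (1 / 2) w)" if "Im w > 0" for w
    using theta_alt_inversion_6 [OF that refl] theta_alt_inversion_2 [OF that refl] by (simp_all add: u_def t_def)
  have odd: "theta_odd (1 / 6) (- 1 / w) = 6 * of_real (sqrt 3) / (2 * csqrt 2 * u w) * (theta_odd (1 / 6) w + theta_odd (1 / 3) w)"
      "theta_odd (1 / 3) (- 1 / w) = 6 * of_real (sqrt 3) / (2 * csqrt 2 * u w) * (theta_odd (1 / 6) w - theta_odd (1 / 3) w)" if "Im w > 0" for w
  proof -
    \<comment> \<open>The parameters 6 i / w and 3 i / w of the two indices differ by the factor 2,
      which the principal root splits off because it is positive.\<close>
    have "csqrt (2 * t w) = csqrt 2 * csqrt (t w)"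
      by (rule csqrt_mult) (use Arg_bounded [of "t w"] in \<open>auto simp: Arg_numeral\<close>)
    then have "2 * t w * csqrt (2 * t w) = 2 * csqrt 2 * u w" by (simp add: u_def)
    moreover have "2 * t w = 6 * \<i> / w" by (simp add: t_def)
    ultimately show "theta_odd (1 / 6) (- 1 / w) = 6 * of_real (sqrt 3) / (2 * csqrt 2 * u w) * (theta_odd (1 / 6) w + theta_odd (1 / 3) w)"
      "theta_odd (1 / 3) (- 1 / w) = 6 * of_real (sqrt 3) / (2 * csqrt 2 * u w) * (theta_odd (1 / 6) w - theta_odd (1 / 3) w)"
      using theta_odd_inversion_1 [OF that refl] theta_odd_inversion_2 [OF that refl] by simp_all
  qed
  have c2: "csqrt 2 * csqrt 2 = 2" using power2_csqrt [of 2] by (simp add: power2_eq_square)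
  have c2': "(6 * of_real (sqrt 3) / (2 * csqrt 2 * x)) * (6 * of_real (sqrt 3) / (2 * csqrt 2 * y)) = 27 / 2 / (x * y)" for x y
  proof -
    have "(6 * of_real (sqrt 3) / (2 * csqrt 2 * x)) * (6 * of_real (sqrt 3) / (2 * csqrt 2 * y)) = 
        9 * (of_real (sqrt 3) * of_real (sqrt 3)) / ((csqrt 2 * csqrt 2) * (x * y))" by simp
    then show ?thesis unfolding s3 c2 by simp
  qed
  have f0: "f0 (- 1 / w1) (- 1 / w2) = - 27 / (u w1 * u w2) * f0 w1 w2"
  proof -
    define c where "c = 6 * of_real (sqrt 3) / (2 * csqrt 2 * u w1)"
    define d where "d = 6 * of_real (sqrt 3) / (2 * csqrt 2 * u w2)"
    have "f0 (- 1 / w1) (- 1 / w2) = c * d * (-2) * f0 w1 w2"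
      unfolding f0_def theta_eq odd [OF w(1)] odd [OF w(2)] c_def [symmetric] d_def [symmetric]
      by (simp add: algebra_simps)
    then show ?thesis unfolding c_def d_def c2' by simp
  qed
  have g0: "g0 (- 1 / w1) (- 1 / w2) = - 27 / (u w1 * u w2) * g0 w1 w2"
  proof -
    define c where "c = 3 / u w1"
    define d where "d = 3 / u w2"
    have "g0 (- 1 / w1) (- 1 / w2) = c * d * (-3) * g0 w1 w2"
      unfolding g0_def theta_eq alt [OF w(1)] alt [OF w(2)] c_def [symmetric] d_def [symmetric]
      by (simp add: algebra_simps)
    then show ?thesis unfolding c_def d_def by simp
  qed
  have e3: "eta (- 1 / w1) ^ 3 * eta (- 1 / w2) ^ 3 = 27 / (u w1 * u w2) * (eta w1 ^ 3 * eta w2 ^ 3)"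
    unfolding eta3 [OF w(1)] eta3 [OF w(2)] using s3 by (simp add: mult_ac)
  have "wedge_form (- 1 / w1) (- 1 / w2) = - 27 / (u w1 * u w2) * wedge_form w1 w2"
    unfolding wedge_form_def f0 g0 by (simp only: distrib_left mult.left_commute)
  then show ?thesis unfolding e3 using nz [OF w(1)] nz [OF w(2)] by simp
qed

lemma eta_translation: "eta (\<tau> + of_int n) = exp (of_real pi * \<i> * of_int n / 12) * eta \<tau>"
proof -
  have 1: "qpow (\<tau> + of_int n) (real k) = qpow \<tau> (real k)" for k
  proof -
    have "qpow (\<tau> + of_int n) (real k) = qpow \<tau> (real k) * exp (2 * of_real pi * \<i> * of_int (int k * n))"
      unfolding qpow_def exp_add [symmetric] by (rule arg_cong [where f = exp]) (simp add: algebra_simps)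
    then show ?thesis by (simp only: exp_2pi_i_int mult_1_right)
  qed
  have 2: "qpow (\<tau> + of_int n) (1 / 24) = exp (of_real pi * \<i> * of_int n / 12) * qpow \<tau> (1 / 24)"
    unfolding qpow_def exp_add [symmetric] by (rule arg_cong [where f = exp]) (simp add: field_simps)
  show ?thesis unfolding eta_def 1 2 by (rule mult.assoc)
qed

lemma theta_odd_translation:
  "theta_odd (of_int r / 6) (\<tau> + of_int n) = exp (of_real pi * \<i> * of_int n * of_int r ^ 2 / 6) * theta_odd (of_int r / 6) \<tau>"
  unfolding theta_odd_def infsum_cmult_right' [symmetric]
proof (rule infsum_cong)
  fix j :: int
  let ?y = "of_int j + of_int r / 6 :: complex"
  have "6 * of_real pi * \<i> * (\<tau> + of_int n) * ?y\<^sup>2 = 6 * of_real pi * \<i> * \<tau> * ?y\<^sup>2 + (of_real pi * \<i> * of_int n * of_int r ^ 2 / 6 + 2 * of_real pi * \<i> * of_int (n * (3 * j\<^sup>2 + j * r)))"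
    by (simp add: field_simps power2_eq_square)
  then have "exp (6 * of_real pi * \<i> * (\<tau> + of_int n) * ?y\<^sup>2) = exp (6 * of_real pi * \<i> * \<tau> * ?y\<^sup>2) * exp (of_real pi * \<i> * of_int n * of_int r ^ 2 / 6)"
    by (simp only: exp_add exp_2pi_i_int mult_1_right)
  then show "?y * exp (6 * of_real pi * \<i> * (\<tau> + of_int n) * ?y\<^sup>2) =
      exp (of_real pi * \<i> * of_int n * of_int r ^ 2 / 6) * (?y * exp (6 * of_real pi * \<i> * \<tau> * ?y\<^sup>2))"
    by (simp only: mult_ac)
qed

text \<open>For odd \<open>c\<close> the integer j (3 j + c) is even, so that all terms acquire the
  same phase.\<close>

lemma theta_alt_translation:
  assumes c: "odd c"
  shows "theta_alt k (of_int c / 6) (\<tau> + of_int n) = exp (of_real pi * \<i> * of_int n * of_int c ^ 2 / 12) * theta_alt k (of_int c / 6) \<tau>"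
  unfolding theta_alt_def infsum_cmult_right' [symmetric]
proof (rule infsum_cong)
  fix j :: int
  let ?y = "of_int j + of_int c / 6 :: complex"
  have "even (j * (3 * j + c))" using c by auto
  then obtain m where m: "j * (3 * j + c) = 2 * m" by (elim evenE)
  have m': "of_int j * (3 * of_int j + of_int c) = (2 * of_int m :: complex)"
    using arg_cong [OF m, of "of_int :: int \<Rightarrow> complex"] by simp
  have "3 * of_real pi * \<i> * of_int n * ?y\<^sup>2 = of_real pi * \<i> * of_int n * of_int c ^ 2 / 12 + of_real pi * \<i> * of_int n * (of_int j * (3 * of_int j + of_int c))"
    by (simp add: field_simps power2_eq_square)
  then have "3 * of_real pi * \<i> * (\<tau> + of_int n) * ?y\<^sup>2 = 3 * of_real pi * \<i> * \<tau> * ?y\<^sup>2 + (of_real pi * \<i> * of_int n * of_int c ^ 2 / 12 + 2 * of_real pi * \<i> * of_int (n * m))"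
    unfolding m' by (simp add: algebra_simps)
  then have "exp (3 * of_real pi * \<i> * (\<tau> + of_int n) * ?y\<^sup>2) = exp (3 * of_real pi * \<i> * \<tau> * ?y\<^sup>2) * exp (of_real pi * \<i> * of_int n * of_int c ^ 2 / 12)"
    by (simp only: exp_add exp_2pi_i_int mult_1_right)
  then show "(-1) powi j * ?y ^ k * exp (3 * of_real pi * \<i> * (\<tau> + of_int n) * ?y\<^sup>2) =
      exp (of_real pi * \<i> * of_int n * of_int c ^ 2 / 12) * ((-1) powi j * ?y ^ k * exp (3 * of_real pi * \<i> * \<tau> * ?y\<^sup>2))"
    by (simp only: mult_ac)
qed

text \<open>In units of pi i n / 12 the phases add up to 2 + 8 for \<open>f0\<close> and to 1 + 9
  for \<open>g0\<close>, again the same. The six eta factors take away 6, and the remaining 4 is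
  twice the phase 2 of \<eta>^2.\<close>

lemma wedge_form_translation:
  defines "\<kappa> \<equiv> \<lambda>n. exp (of_real pi * \<i> * of_int n / 6)"
  shows "wedge_form (w1 + of_int n) (w2 + of_int n) / (eta (w1 + of_int n) ^ 3 * eta (w2 + of_int n) ^ 3) =
     (\<kappa> n)\<^sup>2 * (wedge_form w1 w2 / (eta w1 ^ 3 * eta w2 ^ 3))"
proof -
  define E where "E = (\<lambda>x::complex. exp (of_real pi * \<i> * of_int n * x / 12))"
  have E_add: "E x * E y = E (x + y)" for x y
    by (simp add: E_def exp_add [symmetric] add_divide_distrib [symmetric] algebra_simps)
  have E_pow: "E x ^ k = E (of_nat k * x)" for x k
    unfolding E_def exp_of_nat_mult [symmetric] by (rule arg_cong [where f = exp]) simp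
  have E: "exp (of_real pi * \<i> * of_int n * of_int 1 ^ 2 / 6) = E 2" "exp (of_real pi * \<i> * of_int n * of_int 2 ^ 2 / 6) = E 8"
    "exp (of_real pi * \<i> * of_int n * of_int 1 ^ 2 / 12) = E 1" "exp (of_real pi * \<i> * of_int n * of_int 3 ^ 2 / 12) = E 9"
    "exp (of_real pi * \<i> * of_int n / 12) = E 1"
    unfolding E_def by (rule arg_cong [where f = exp]; simp)+
  have odd: "theta_odd (1 / 6) (w + of_int n) = E 2 * theta_odd (1 / 6) w" "theta_odd (1 / 3) (w + of_int n) = E 8 * theta_odd (1 / 3) w" for w
    using theta_odd_translation [of 1 w n] theta_odd_translation [of 2 w n] unfolding E by simp_all
  have alt: "theta_alt 1 (1 / 6) (w + of_int n) = E 1 * theta_alt 1 (1 / 6) w" "theta_alt 1 (1 / 2) (w + of_int n) = E 9 * theta_alt 1 (1 / 2) w" for w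
    using theta_alt_translation [of 1 1 w n] theta_alt_translation [of 3 1 w n] unfolding E by simp_all
  have eta: "eta (w + of_int n) ^ 3 = E 3 * eta w ^ 3" for w
    using eta_translation [of w n] E_pow [of 1 3] unfolding E by (simp add: power_mult_distrib)
  have "wedge_form (w1 + of_int n) (w2 + of_int n) = 4 * ((E 2 * E 8) * f0 w1 w2) + (E 1 * E 9) * g0 w1 w2"
    unfolding wedge_form_def f0_def g0_def theta_eq odd alt by (simp add: algebra_simps)
  also have "\<dots> = E 10 * wedge_form w1 w2"
    unfolding E_add by (simp add: wedge_form_def algebra_simps)
  finally have w: "wedge_form (w1 + of_int n) (w2 + of_int n) = E 10 * wedge_form w1 w2" .
  have E10: "E 10 = (\<kappa> n)\<^sup>2 * E 6" 
    unfolding \<kappa>_def E_def exp_of_nat_mult [symmetric] exp_add [symmetric] by (rule arg_cong [where f = exp]) simp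
  have "(E 3 * eta w1 ^ 3) * (E 3 * eta w2 ^ 3) = (E 3 * E 3) * (eta w1 ^ 3 * eta w2 ^ 3)"
    by (simp only: mult_ac)
  then have E6: "(E 3 * eta w1 ^ 3) * (E 3 * eta w2 ^ 3) = E 6 * (eta w1 ^ 3 * eta w2 ^ 3)"
    by (simp add: E_add)
  have "E 6 \<noteq> 0" by (simp add: E_def)
  then show ?thesis
    unfolding w eta E6 E10 by simp
qed

text \<open>Both \<open>\<eta>\<^sup>2\<close> and \<open>wedge_form\<close> divided by \<open>\<eta>(w\<^sub>1)\<^sup>3 \<eta>(w\<^sub>2)\<^sup>3\<close> have integral weight, so that the action of the
  modular group can be followed along its generators without any branch of the square root.\<close>

definition eta_wedge_modular :: "int \<Rightarrow> int \<Rightarrow> int \<Rightarrow> int \<Rightarrow> complex \<Rightarrow> bool" where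
  "eta_wedge_modular a b c d \<kappa> \<longleftrightarrow>
     (\<forall>\<tau>. Im \<tau> > 0 \<longrightarrow> eta (moebius a b c d \<tau>) ^ 2 = \<kappa> * (of_int c * \<tau> + of_int d) * eta \<tau> ^ 2) \<and>
     (\<forall>w1 w2. Im w1 > 0 \<longrightarrow> Im w2 > 0 \<longrightarrow>
        wedge_form (moebius a b c d w1) (moebius a b c d w2) / (eta (moebius a b c d w1) ^ 3 * eta (moebius a b c d w2) ^ 3)
        = \<kappa>\<^sup>2 * (wedge_form w1 w2 / (eta w1 ^ 3 * eta w2 ^ 3)))"

text \<open>Right multiplication of the matrix by the translation by \<open>n\<close>, so that the
  assumption is used at the shifted points.\<close>

lemma eta_wedge_modular_translation:
  assumes "eta_wedge_modular a b c d \<kappa>"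
  shows "eta_wedge_modular a (b + n * a) c (d + n * c) (\<kappa> * exp (of_real pi * \<i> * of_int n / 6))"
proof -
  have M: "moebius a (b + n * a) c (d + n * c) z = moebius a b c d (z + of_int n)" for z
    by (simp add: moebius_def algebra_simps)
  have e: "exp (of_real pi * \<i> * of_int n / 12) ^ 2 = exp (of_real pi * \<i> * of_int n / 6)"
    unfolding exp_of_nat_mult [symmetric] by (rule arg_cong [where f = exp]) simp
  show ?thesis
    unfolding eta_wedge_modular_def
  proof (intro conjI allI impI)
    fix \<tau> :: complex assume "Im \<tau> > 0"
    then have "Im (\<tau> + of_int n) > 0" by simp
    then have X: "eta (moebius a b c d (\<tau> + of_int n)) ^ 2 = \<kappa> * (of_int c * (\<tau> + of_int n) + of_int d) * eta (\<tau> + of_int n) ^ 2"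
      using assms unfolding eta_wedge_modular_def by blast
    have lin: "of_int c * (\<tau> + of_int n) + of_int d = of_int c * \<tau> + of_int (d + n * c)"
      by (simp add: algebra_simps)
    show "eta (moebius a (b + n * a) c (d + n * c) \<tau>) ^ 2 = 
        \<kappa> * exp (of_real pi * \<i> * of_int n / 6) * (of_int c * \<tau> + of_int (d + n * c)) * eta \<tau> ^ 2"
      unfolding M X lin eta_translation power_mult_distrib e by (simp only: mult_ac)
  next
    fix w1 w2 :: complex assume "Im w1 > 0" "Im w2 > 0"
    then have "Im (w1 + of_int n) > 0" "Im (w2 + of_int n) > 0" by simp_all
    then show "wedge_form (moebius a (b + n * a) c (d + n * c) w1) (moebius a (b + n * a) c (d + n * c) w2) /
        (eta (moebius a (b + n * a) c (d + n * c) w1) ^ 3 * eta (moebius a (b + n * a) c (d + n * c) w2) ^ 3) =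
        (\<kappa> * exp (of_real pi * \<i> * of_int n / 6))\<^sup>2 * (wedge_form w1 w2 / (eta w1 ^ 3 * eta w2 ^ 3))"
      using assms unfolding eta_wedge_modular_def M
      by (simp only: wedge_form_translation power_mult_distrib mult.assoc)
  qed
qed

text \<open>Right multiplication of the matrix by (0, - 1; 1, 0); the factor z in \<eta>(- 1 / z)^2
  clears the denominator of the automorphy factor at - 1 / z.\<close>

lemma eta_wedge_modular_inversion:
  assumes "eta_wedge_modular a b c d \<kappa>"
  shows "eta_wedge_modular b (- a) d (- c) (- \<i> * \<kappa>)"
proof -
  have M: "moebius b (- a) d (- c) z = moebius a b c d (- 1 / z)" if "Im z > 0" for z
  proof -
    have z: "z \<noteq> 0" using that by auto
    have 1: "of_int b * z + of_int (- a) = z * (of_int a * (- 1 / z) + of_int b)"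
      "of_int d * z + of_int (- c) = z * (of_int c * (- 1 / z) + of_int d)"
      using z by (simp_all add: field_simps)
    show ?thesis
      unfolding moebius_def 1 by (rule nonzero_mult_divide_mult_cancel_left [OF z])
  qed
  have e: "eta (- 1 / z) ^ 2 = - \<i> * z * eta z ^ 2" if "Im z > 0" for z
  proof -
    have "(complex_of_real (sqrt 3))\<^sup>2 = 3" by (simp flip: of_real_power)
    moreover have "z \<noteq> 0" using that by auto
    ultimately show ?thesis
      unfolding eta_inversion [OF that refl] power_mult_distrib power_divide power2_csqrt by (simp add: field_simps)
  qed
  show ?thesis
    unfolding eta_wedge_modular_def
  proof (intro conjI allI impI)
    fix \<tau> :: complex assume \<tau>: "Im \<tau> > 0"
    have "eta (moebius b (- a) d (- c) \<tau>) ^ 2 = \<kappa> * (of_int c * (- 1 / \<tau>) + of_int d) * (- \<i> * \<tau> * eta \<tau> ^ 2)"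
      using assms Im_minus_inverse [OF \<tau>] unfolding eta_wedge_modular_def M [OF \<tau>] by (simp only: e [OF \<tau>])
    moreover have "\<tau> \<noteq> 0" using \<tau> by auto
    then have "\<kappa> * (of_int c * (- 1 / \<tau>) + of_int d) * (- \<i> * \<tau> * X) = - \<i> * \<kappa> * (of_int d * \<tau> + of_int (- c)) * X" for X
      by (simp add: field_simps)
    ultimately show "eta (moebius b (- a) d (- c) \<tau>) ^ 2 = - \<i> * \<kappa> * (of_int d * \<tau> + of_int (- c)) * eta \<tau> ^ 2"
      by (simp only:)
  next
    fix w1 w2 :: complex assume w: "Im w1 > 0" "Im w2 > 0"
    show "wedge_form (moebius b (- a) d (- c) w1) (moebius b (- a) d (- c) w2) /
        (eta (moebius b (- a) d (- c) w1) ^ 3 * eta (moebius b (- a) d (- c) w2) ^ 3) =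
        (- \<i> * \<kappa>)\<^sup>2 * (wedge_form w1 w2 / (eta w1 ^ 3 * eta w2 ^ 3))"
      using assms Im_minus_inverse [OF w(1)] Im_minus_inverse [OF w(2)]
      unfolding eta_wedge_modular_def M [OF w(1)] M [OF w(2)]
      by (simp only: wedge_form_inversion [OF w] power_mult_distrib mult_ac)
  qed
qed

text \<open>Euclid's algorithm on the bottom row: a translation reduces \<open>d\<close> modulo
  \<open>c\<close>, an inversion exchanges the two entries up to sign, and the absolute value of
  \<open>c\<close> decreases.\<close>

lemma eta_wedge_modular_exists:
  assumes "a * d - b * c = 1"
  shows "\<exists>\<kappa>. eta_wedge_modular a b c d \<kappa>"
  using assms
proof (induction "nat \<bar>c\<bar>" arbitrary: a b c d rule: less_induct)
  case less
  show ?case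
  proof (cases "c = 0")
    case True
    with less.prems have "a * d = 1" by simp
    then have ad: "a = 1 \<and> d = 1 \<or> a = - 1 \<and> d = - 1"
      by (auto simp: zmult_eq_1_iff)
    have "eta_wedge_modular 1 0 0 1 1"
      by (simp add: eta_wedge_modular_def moebius_def)
    \<comment> \<open>For minus the identity the Moebius map is trivial but the automorphy factor is
      - 1, which the multiplier has to cancel.\<close>
    moreover have "eta_wedge_modular (- 1) 0 0 (- 1) (- 1)"
      by (simp add: eta_wedge_modular_def moebius_def)
    ultimately show ?thesis
      using eta_wedge_modular_translation [of 1 0 0 1 1 b] eta_wedge_modular_translation [of "- 1" 0 0 "- 1" "- 1" "- b"] ad True
      by auto
  next
    case False
    define n where "n = d div c"
    define d1 where "d1 = d mod c"
    define b1 where "b1 = b - n * a"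
    have d: "d = d1 + n * c" by (simp add: n_def d1_def)
    have "\<bar>d1\<bar> < \<bar>c\<bar>" using False by (simp add: d1_def abs_mod_less)
    then have "nat \<bar>- d1\<bar> < nat \<bar>c\<bar>" using False by simp
    \<comment> \<open>The matrix (- b1, a; - d1, c) is the one that inversion turns into (a, b1; c,
      d1).\<close>
    moreover have "- b1 * c - a * (- d1) = 1"
      using less.prems by (simp add: b1_def d algebra_simps)
    ultimately obtain \<kappa> where "eta_wedge_modular (- b1) a (- d1) c \<kappa>"
      using less.hyps by blast
    from eta_wedge_modular_translation [OF eta_wedge_modular_inversion [OF this], of n]
    show ?thesis by (auto simp: b1_def d add.commute)
  qed
qed

section \<open>The regularized integral\<close>

abbreviation UH :: "complex set" where "UH \<equiv> {z. Im z > 0}"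

lemma open_UH: "open UH" and convex_UH: "convex UH"
  by (rule open_halfspace_Im_gt, rule convex_halfspace_Im_gt)

text \<open>Once \<open>f \<tau>\<close> is split off, variation of constants suggests (v -
  \<tau>)^(-1/2) times the integral of (x - \<tau>)^(-1/2) h(x) from \<tau> to v. The substitution x
  = \<tau> + u^2 (v - \<tau>) removes the root together with the singularity and leaves
  \<open>A\<close>, the integral of 2 h over [0, 1]. No branch is chosen, and \<open>A\<close> is
  holomorphic also at \<tau>.\<close>

lemma half_order_ode_exists:
  assumes f: "f holomorphic_on UH" and \<tau>: "Im \<tau> > 0"
  obtains Q where "Q holomorphic_on UH" 
    and "\<And>v. Im v > 0 \<Longrightarrow> (v - \<tau>) * deriv Q v - Q v / 2 = - \<i> * f v"
proof -
  define h where "h = (\<lambda>v. if v = \<tau> then deriv f \<tau> else (f v - f \<tau>) / (v - \<tau>))"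
  have h: "h holomorphic_on UH"
    unfolding h_def by (rule pole_lemma_open [OF f open_UH])
  have fh: "f v = f \<tau> + (v - \<tau>) * h v" for v by (simp add: h_def)
  define \<gamma> where "\<gamma> = (\<lambda>v (u::real). \<tau> + of_real (u\<^sup>2) * (v - \<tau>))"
  have \<gamma>UH: "Im (\<gamma> v u) > 0" if "Im v > 0" "u \<in> {0..1}" for v u
  proof -
    have u: "0 \<le> u\<^sup>2" "u\<^sup>2 \<le> 1" using that by (auto simp: power_le_one)
    have "\<gamma> v u = (1 - u\<^sup>2) *\<^sub>R \<tau> + (u\<^sup>2) *\<^sub>R v"
      by (simp add: \<gamma>_def scaleR_conv_of_real algebra_simps)
    also have "\<dots> \<in> UH" using convexD_alt [OF convex_UH] \<tau> that u by simp
    finally show ?thesis by simp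
  qed
  have h': "(h has_field_derivative deriv h v) (at v within A)" if "Im v > 0" for v A
    using holomorphic_derivI [OF h open_UH] that by auto
  have conth': "continuous_on UH (deriv h)" and conth: "continuous_on UH h"
    using h holomorphic_deriv [OF h open_UH] by (simp_all add: holomorphic_on_imp_continuous_on)
  have cont\<gamma>: "continuous_on (UH \<times> {0..1}) (\<lambda>(v, u). \<gamma> v u)"
    unfolding \<gamma>_def case_prod_unfold by (intro continuous_intros)
  define A where "A = (\<lambda>v. integral {0..1} (\<lambda>u. 2 * h (\<gamma> v u)))"
  define A' where "A' = (\<lambda>v. integral {0..1} (\<lambda>u. 2 * (of_real (u\<^sup>2) * deriv h (\<gamma> v u))))"
  have cont1: "continuous_on {0..1} (\<lambda>u. h (\<gamma> v u))" "continuous_on {0..1} (\<lambda>u. of_real (u\<^sup>2) * deriv h (\<gamma> v u))" if "Im v > 0" for v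
  proof -
    have "continuous_on {0..1} (\<gamma> v)" unfolding \<gamma>_def by (intro continuous_intros)
    then show "continuous_on {0..1} (\<lambda>u. h (\<gamma> v u))" "continuous_on {0..1} (\<lambda>u. of_real (u\<^sup>2) * deriv h (\<gamma> v u))"
      using \<gamma>UH [OF that] by (auto intro!: continuous_intros continuous_on_compose2 [OF conth] continuous_on_compose2 [OF conth'])
  qed
  have A': "(A has_field_derivative A' v) (at v)" if v: "Im v > 0" for v
  proof -
    have "((\<lambda>v. integral (cbox 0 1) (\<lambda>u. 2 * h (\<gamma> v u))) has_field_derivative 
        integral (cbox 0 1) (\<lambda>u. 2 * (of_real (u\<^sup>2) * deriv h (\<gamma> v u)))) (at v within UH)"
    proof (rule leibniz_rule_field_derivative [OF _ _ _ _ convex_UH])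
      fix v :: complex and u :: real assume vu: "v \<in> UH" "u \<in> cbox 0 1"
      have "((\<lambda>v. \<gamma> v u) has_field_derivative of_real (u\<^sup>2)) (at v within UH)"
        unfolding \<gamma>_def by (auto intro!: derivative_eq_intros)
      then have "((\<lambda>v. h (\<gamma> v u)) has_field_derivative deriv h (\<gamma> v u) * of_real (u\<^sup>2)) (at v within UH)"
        using vu \<gamma>UH by (intro DERIV_chain2 [OF h']) auto
      from DERIV_cmult [OF this, of 2]
      show "((\<lambda>v. 2 * h (\<gamma> v u)) has_field_derivative 2 * (of_real (u\<^sup>2) * deriv h (\<gamma> v u))) (at v within UH)"
        by (simp add: mult_ac)
    next
      fix v assume "v \<in> UH"
      then show "(\<lambda>u. 2 * h (\<gamma> v u)) integrable_on cbox 0 1"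
        using cont1 by (intro integrable_continuous continuous_intros) auto
    next
      have "continuous_on (UH \<times> {0..1}) (\<lambda>x. deriv h ((\<lambda>(v, u). \<gamma> v u) x))"
        by (rule continuous_on_compose2 [OF conth' cont\<gamma>]) (use \<gamma>UH in auto)
      then have "continuous_on (UH \<times> {0..1}) (\<lambda>x. 2 * (of_real ((snd x)\<^sup>2) * deriv h ((\<lambda>(v, u). \<gamma> v u) x)))"
        by (intro continuous_intros)
      then show "continuous_on (UH \<times> cbox 0 1) (\<lambda>(v, u). 2 * (of_real (u\<^sup>2) * deriv h (\<gamma> v u)))"
        by (simp add: case_prod_unfold)
    qed (use v in auto)
    moreover have "at v within UH = at v"
      using v by (intro at_within_open open_UH) auto
    ultimately show ?thesis
      by (simp only: A_def A'_def cbox_interval)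
  qed
  have ode: "A v / 2 + (v - \<tau>) * A' v = h v" if v: "Im v > 0" for v
  proof -
    \<comment> \<open>The integrand is the derivative in \<open>u\<close> of u h(\<gamma>), and its
      integral is the left side of the equation for \<open>A\<close>.\<close>
    have "((\<lambda>u. h (\<gamma> v u) + 2 * (v - \<tau>) * (of_real (u\<^sup>2) * deriv h (\<gamma> v u))) has_integral
            (of_real 1 * h (\<gamma> v 1) - of_real 0 * h (\<gamma> v 0))) {0..1}"
    proof (rule fundamental_theorem_of_calculus)
      fix u :: real assume u: "u \<in> {0..1}"
      have "(\<gamma> v has_vector_derivative 2 * of_real u * (v - \<tau>)) (at u within {0..1})"
        unfolding \<gamma>_def by (auto intro!: derivative_eq_intros simp: has_vector_derivative_def scaleR_conv_of_real)
      then have "((h \<circ> \<gamma> v) has_vector_derivative (2 * of_real u * (v - \<tau>)) * deriv h (\<gamma> v u)) (at u within {0..1})"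
        by (rule field_vector_diff_chain_within) (use h' \<gamma>UH [OF v u] in auto)
      then show "((\<lambda>u. of_real u * h (\<gamma> v u)) has_vector_derivative
          h (\<gamma> v u) + 2 * (v - \<tau>) * (of_real (u\<^sup>2) * deriv h (\<gamma> v u))) (at u within {0..1})"
        by (auto intro!: derivative_eq_intros simp: o_def algebra_simps power2_eq_square)
    qed auto
    moreover have "integral {0..1} (\<lambda>u. h (\<gamma> v u) + 2 * (v - \<tau>) * (of_real (u\<^sup>2) * deriv h (\<gamma> v u)))
       = integral {0..1} (\<lambda>u. h (\<gamma> v u)) + 2 * (v - \<tau>) * integral {0..1} (\<lambda>u. of_real (u\<^sup>2) * deriv h (\<gamma> v u))"
      using cont1 [OF v] by (subst integral_add)
        (auto intro!: integrable_continuous_interval continuous_intros simp: integral_mult_right)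
    ultimately show ?thesis
      using v by (simp add: A_def A'_def integral_unique \<gamma>_def)
  qed
  define Q where "Q = (\<lambda>v. 2 * \<i> * f \<tau> - \<i> * (v - \<tau>) * A v)"
  have Q': "(Q has_field_derivative - \<i> * A v - \<i> * (v - \<tau>) * A' v) (at v)" if "Im v > 0" for v
    unfolding Q_def by (auto intro!: derivative_eq_intros A' [OF that] simp: algebra_simps)
  show thesis
  proof
    show "Q holomorphic_on UH"
      unfolding holomorphic_on_open [OF open_UH] using Q' by auto
    fix v :: complex assume v: "Im v > 0"
    have "(v - \<tau>) * deriv Q v - Q v / 2 = - \<i> * (f \<tau> + (v - \<tau>) * (A v / 2 + (v - \<tau>) * A' v))"
      unfolding DERIV_imp_deriv [OF Q' [OF v]] by (simp add: Q_def field_simps)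
    then show "(v - \<tau>) * deriv Q v - Q v / 2 = - \<i> * f v"
      unfolding ode [OF v] fh [symmetric] .
  qed
qed

text \<open>Away from \<tau> the solutions are multiples of a root of v - \<tau>, which is not
  single-valued around \<tau>. Squaring avoids branches: the square of \<open>D\<close> equals (v -
  \<tau>) E and its derivative is again \<open>E\<close>, so \<open>E\<close> is constant. It
  vanishes at \<tau>, where \<open>deriv D\<close> enters with the factor
  \<open>D \<tau> = 0\<close>.\<close>

lemma half_order_ode_unique:
  assumes D: "D holomorphic_on UH" and ode: "\<And>v. Im v > 0 \<Longrightarrow> (v - \<tau>) * deriv D v = D v / 2"
    and \<tau>: "Im \<tau> > 0" and v: "Im v > 0"
  shows "D v = 0"
proof -
  have D': "(D has_field_derivative deriv D v) (at v)" if "Im v > 0" for v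
    using holomorphic_derivI [OF D open_UH] that by auto
  define E where "E = (\<lambda>v. 2 * D v * deriv D v)"
  have E: "E holomorphic_on UH"
    unfolding E_def by (intro holomorphic_intros D holomorphic_deriv open_UH)
  have E1: "(D v)\<^sup>2 = (v - \<tau>) * E v" if "Im v > 0" for v
  proof -
    have "(v - \<tau>) * E v = 2 * D v * ((v - \<tau>) * deriv D v)" by (simp add: E_def)
    also have "\<dots> = (D v)\<^sup>2" unfolding ode [OF that] by (simp add: power2_eq_square)
    finally show ?thesis ..
  qed
  have E': "(E has_field_derivative 0) (at v)" if v: "v \<in> UH - {\<tau>}" for v
  proof -
    have E2: "(E has_field_derivative deriv E v) (at v)"
      using holomorphic_derivI [OF E open_UH] v by auto
    have "((\<lambda>v. (v - \<tau>) * E v) has_field_derivative E v + (v - \<tau>) * deriv E v) (at v)"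
      by (rule derivative_eq_intros E2 refl | simp)+
    moreover have "((\<lambda>v. (D v)\<^sup>2) has_field_derivative E v) (at v)"
      using v unfolding E_def by (auto intro!: derivative_eq_intros D')
    then have "((\<lambda>v. (v - \<tau>) * E v) has_field_derivative E v) (at v)"
      by (rule has_field_derivative_transform_within_open [OF _ open_UH]) (use v E1 in auto)
    ultimately have "(v - \<tau>) * deriv E v = 0"
      using DERIV_unique by fastforce
    with E2 v show ?thesis by simp
  qed
  have "E constant_on UH"
    by (rule DERIV_zero_connected_constant_on [where K = "{\<tau>}"])
       (use E E' open_UH convex_UH in \<open>auto simp: convex_connected holomorphic_on_imp_continuous_on\<close>)
  then have "E v = E \<tau>"
    using v \<tau> unfolding constant_on_def by (metis mem_Collect_eq)
  moreover have "E \<tau> = 0" using ode [OF \<tau>] by (simp add: E_def)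
  ultimately show ?thesis using E1 [OF v] by simp
qed

section \<open>Geodesics and the branch of the square root\<close>

lemma valid_path_geodesic: "valid_path (geodesic z w)"
  by (simp add: geodesic_def Let_def)

text \<open>Simplicity allows a point of the path to be disregarded in a contour integral. The two
  statements on real parts keep the part of an arc beyond its starting point off the vertical line
  through that point, on which the cut of the integrand lies.\<close>

lemma
  assumes "Im z > 0" "Im w > 0"
  shows simple_path_geodesic: "z \<noteq> w \<Longrightarrow> simple_path (geodesic z w)"
    and Re_geodesic: "u \<in> path_image (geodesic z w) \<Longrightarrow> Re u \<in> closed_segment (Re z) (Re w)"
    and geodesic_Re_eq: "u \<in> path_image (geodesic z w) \<Longrightarrow> Re z \<noteq> Re w \<Longrightarrow> Re u = Re z \<Longrightarrow> u = z"
proof -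
  define x where "x = geodesic_centre z w"
  define r where "r = cmod (z - x)"
  have x: "Im x = 0" by (simp add: x_def geodesic_centre_def)
  have r: "r > 0" using assms x by (auto simp: r_def)
  have Arg: "0 < Arg (v - x) \<and> Arg (v - x) < pi" if "Im v > 0" for v
    using that x by (simp add: Arg_lt_pi)
  have polar: "v = x + of_real (cmod (v - x)) * exp (\<i> * of_real (Arg (v - x)))" for v
    using rcis_cmod_Arg [of "v - x"] by (simp add: rcis_def cis_conv_exp algebra_simps)
  have geo: "geodesic z w = part_circlepath x r (Arg (z - x)) (Arg (w - x))" if "Re z \<noteq> Re w"
    using that by (simp add: geodesic_def Let_def x_def r_def)
  have rw: "cmod (w - x) = r" if "Re z \<noteq> Re w"
    using cmod_geodesic_centre [OF that] by (simp add: x_def r_def)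
  have img: "\<exists>s \<in> closed_segment (Arg (z - x)) (Arg (w - x)). u = x + r * exp (\<i> * of_real s)" 
    if "u \<in> path_image (geodesic z w)" "Re z \<noteq> Re w" for u
    using that by (auto simp: geo path_image_part_circlepath' cis_conv_exp)
  show "simple_path (geodesic z w)" if "z \<noteq> w"
  proof (cases "Re z = Re w")
    case True
    with that show ?thesis by (simp add: geodesic_def simple_path_linepath)
  next
    case False
    have "Arg (z - x) \<noteq> Arg (w - x)"
      using polar [of z] polar [of w] rw [OF False] that r_def by metis
    then show ?thesis
      using r Arg [OF assms(1)] Arg [OF assms(2)] by (simp add: geo False simple_path_part_circlepath abs_le_iff)
  qed
  show "Re u \<in> closed_segment (Re z) (Re w)" if u: "u \<in> path_image (geodesic z w)"
  proof (cases "Re z = Re w")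
    case True
    with u have "u \<in> closed_segment z w" by (simp add: geodesic_def)
    then obtain t where "u = (1 - t) *\<^sub>R z + t *\<^sub>R w" unfolding closed_segment_def by blast
    then have "Re u = (1 - t) * Re z + t * Re w" by simp
    then show ?thesis using True by (simp add: algebra_simps)
  next
    case False
    from img [OF u False] obtain s where s: "s \<in> closed_segment (Arg (z - x)) (Arg (w - x))"
      and us: "u = x + r * exp (\<i> * of_real s)" by blast
    have Rez: "Re z = Re x + r * cos (Arg (z - x))"
      by (subst polar) (simp add: r_def Re_exp)
    have Rew: "Re w = Re x + r * cos (Arg (w - x))"
      by (subst polar) (simp add: rw [OF False] Re_exp)
    have Reu: "Re u = Re x + r * cos s" by (simp add: us Re_exp)
    have cos: "cos b \<le> cos a" if "0 \<le> a" "a \<le> b" "b \<le> pi" for a b :: real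
      using that by (simp add: cos_monotone_0_pi_le)
    have "(cos (Arg (z - x)) \<le> cos s \<and> cos s \<le> cos (Arg (w - x))) \<or> (cos (Arg (w - x)) \<le> cos s \<and> cos s \<le> cos (Arg (z - x)))"
      using s Arg [OF assms(1)] Arg [OF assms(2)] by (auto simp: closed_segment_eq_real_ivl intro!: cos split: if_splits)
    then show ?thesis
      using r by (auto simp: Rez Rew Reu closed_segment_eq_real_ivl)
  qed
  show "u = z" if u: "u \<in> path_image (geodesic z w)" and ne: "Re z \<noteq> Re w" and eq: "Re u = Re z"
  proof -
    from img [OF u ne] obtain s where us: "u = x + r * exp (\<i> * of_real s)" by blast
    then have "cmod (u - x) = r" using r by (simp add: norm_mult)
    then have "(cmod (u - x))\<^sup>2 = (cmod (z - x))\<^sup>2" by (simp add: r_def)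
    then have "(Im u)\<^sup>2 = (Im z)\<^sup>2" using eq x by (simp add: cmod_power2)
    moreover have "Im u > 0" using geodesic_upper_half_plane assms u by blast
    ultimately show ?thesis using eq assms by (simp add: complex_eq_iff power2_eq_iff)
  qed
qed

text \<open>The argument i (v - \<tau>) is a nonpositive real exactly on the vertical ray upwards
  from \<tau>. Off the vertical line the root is continuous as usual; on the line it is continuous
  relative to the line, being real below \<tau> and i times a real root above.\<close>

lemma continuous_on_csqrt_side:
  shows "continuous_on {v. Re v \<noteq> Re \<tau>} (\<lambda>v. csqrt (\<i> * (v - \<tau>)))"
    and "continuous_on {v. Re v = Re \<tau>} (\<lambda>v. csqrt (\<i> * (v - \<tau>)))"
proof -
  show "continuous_on {v. Re v \<noteq> Re \<tau>} (\<lambda>v. csqrt (\<i> * (v - \<tau>)))"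
    by (intro continuous_on_compose2 [OF continuous_on_csqrt] continuous_intros)
       (auto simp: complex_nonpos_Reals_iff)
  have "csqrt (\<i> * (v - \<tau>)) = (if Im v \<le> Im \<tau> then of_real (sqrt (Im \<tau> - Im v)) else \<i> * of_real (sqrt (Im v - Im \<tau>)))" 
    if "Re v = Re \<tau>" for v
  proof -
    have "\<i> * (v - \<tau>) = of_real (Im \<tau> - Im v)" using that by (simp add: complex_eq_iff)
    then show ?thesis by (simp add: csqrt_of_real_nonneg csqrt_of_real_nonpos)
  qed
  then have eq: "continuous_on {v. Re v = Re \<tau>} (\<lambda>v. csqrt (\<i> * (v - \<tau>))) \<longleftrightarrow> continuous_on {v. Re v = Re \<tau>}
     (\<lambda>v. if Im v \<le> Im \<tau> then of_real (sqrt (Im \<tau> - Im v)) else \<i> * of_real (sqrt (Im v - Im \<tau>)))"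
    by (intro continuous_on_cong) auto
  show "continuous_on {v. Re v = Re \<tau>} (\<lambda>v. csqrt (\<i> * (v - \<tau>)))"
    unfolding eq by (intro continuous_on_cases_le continuous_intros) auto
qed

text \<open>The set \<open>S\<close> is the punctured vertical line through \<tau> or the complement
  of that line. In the first case it is not open and contains points of the cut, which is why the
  derivative of the root is taken within \<open>S\<close>.\<close>

lemma geodesic_tail_side:
  assumes "Im \<tau> > 0" "Im w > 0" "\<tau> \<noteq> w"
  obtains S where "\<And>z. z \<in> path_image (geodesic \<tau> w) \<Longrightarrow> z \<noteq> \<tau> \<Longrightarrow> path_image (geodesic z w) \<subseteq> S"
    and "\<tau> \<notin> S" and "continuous_on S (\<lambda>v. csqrt (\<i> * (v - \<tau>)))"
proof (cases "Re \<tau> = Re w")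
  case True
  show ?thesis
  proof
    show "continuous_on ({v. Re v = Re \<tau>} - {\<tau>}) (\<lambda>v. csqrt (\<i> * (v - \<tau>)))"
      by (rule continuous_on_subset [OF continuous_on_csqrt_side(2)]) auto
    fix z assume "z \<in> path_image (geodesic \<tau> w)" and z: "z \<noteq> \<tau>"
    then have zs: "z \<in> closed_segment \<tau> w" using True by (simp add: geodesic_def)
    then obtain t where t: "0 \<le> t" "t \<le> 1" "z = (1 - t) *\<^sub>R \<tau> + t *\<^sub>R w" by (auto simp: closed_segment_def)
    then have "Re z = (1 - t) * Re \<tau> + t * Re w" by simp
    then have Re: "Re z = Re w" using True by (simp add: algebra_simps)
    have t0: "t > 0" using t z by (cases "t = 0") auto
    have "v \<noteq> \<tau>" "Re v = Re \<tau>" if v: "v \<in> closed_segment z w" for v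
    proof -
      obtain s where s: "0 \<le> s" "s \<le> 1" "v = (1 - s) *\<^sub>R z + s *\<^sub>R w" 
        using v unfolding closed_segment_def by blast
      then have "Re v = (1 - s) * Re z + s * Re w" by simp
      then show "Re v = Re \<tau>" using True Re by (simp add: algebra_simps)
      have "v - \<tau> = (t * (1 - s) + s) *\<^sub>R (w - \<tau>)"
        unfolding s(3) t(3) scaleR_conv_of_real by (simp add: algebra_simps)
      moreover have "t * (1 - s) + s > 0"
        using t0 s(1,2) by (cases "s = 0") (auto intro!: add_nonneg_pos mult_nonneg_nonneg)
      ultimately show "v \<noteq> \<tau>" using assms(3) by auto
    qed
    then show "path_image (geodesic z w) \<subseteq> {v. Re v = Re \<tau>} - {\<tau>}"
      using Re by (auto simp: geodesic_def)
  qed auto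
next
  case False
  show ?thesis
  proof
    show "continuous_on {v. Re v \<noteq> Re \<tau>} (\<lambda>v. csqrt (\<i> * (v - \<tau>)))"
      by (rule continuous_on_csqrt_side)
    fix z assume z: "z \<in> path_image (geodesic \<tau> w)" and ne: "z \<noteq> \<tau>"
    have Imz: "Im z > 0" using geodesic_upper_half_plane assms z by blast
    have "Re z \<noteq> Re \<tau>" using geodesic_Re_eq [OF assms(1,2) z False] ne by blast
    moreover have "Re z \<in> closed_segment (Re \<tau>) (Re w)" using Re_geodesic [OF assms(1,2) z] .
    ultimately have "Re \<tau> \<notin> closed_segment (Re z) (Re w)" 
      by (auto simp: closed_segment_eq_real_ivl split: if_splits)
    then show "path_image (geodesic z w) \<subseteq> {v. Re v \<noteq> Re \<tau>}"
      using Re_geodesic [OF Imz assms(2)] by (intro subsetI) (metis mem_Collect_eq)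
  qed auto
qed

text \<open>From (s y - s v) (s y + s v) = c (y - v) and continuity alone. It therefore works
  relative to any set on which the root is continuous, also along the cut, where
  \<open>csqrt\<close> is discontinuous in every full neighbourhood.\<close>

lemma has_field_derivative_sqrt_branch:
  fixes s :: "complex \<Rightarrow> complex"
  assumes cont: "continuous_on S s" and sq: "\<And>v. v \<in> S \<Longrightarrow> (s v)\<^sup>2 = c * (v - \<tau>)"
    and v: "v \<in> S" "v \<noteq> \<tau>" "c \<noteq> 0"
  shows "(s has_field_derivative c / (2 * s v)) (at v within S)"
proof -
  have nz: "s v \<noteq> 0" using sq [OF v(1)] v by auto
  have "(s \<longlongrightarrow> s v) (at v within S)" using cont v by (simp add: continuous_on_def)
  then have "((\<lambda>y. c / (s y + s v)) \<longlongrightarrow> c / (s v + s v)) (at v within S)"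
    using nz by (intro tendsto_intros) auto
  moreover have "\<forall>\<^sub>F y in at v within S. c / (s y + s v) = (s y - s v) / (y - v)"
    unfolding eventually_at_filter
  proof (intro always_eventually allI impI)
    fix y assume y: "y \<noteq> v" "y \<in> S"
    have "(s y - s v) * (s y + s v) = (s y)\<^sup>2 - (s v)\<^sup>2"
      by (simp add: algebra_simps power2_eq_square)
    also have "\<dots> = c * (y - v)"
      unfolding sq [OF y(2)] sq [OF v(1)] by (simp add: algebra_simps)
    finally have "(s y - s v) * (s y + s v) = c * (y - v)" .
    moreover from this have "s y + s v \<noteq> 0" using y v(3) by auto
    ultimately show "c / (s y + s v) = (s y - s v) / (y - v)"
      using y by (simp add: frac_eq_eq mult_ac)
  qed
  ultimately have "((\<lambda>y. (s y - s v) / (y - v)) \<longlongrightarrow> c / (s v + s v)) (at v within S)"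
    by (rule Lim_transform_eventually)
  then show ?thesis
    by (simp only: has_field_derivative_iff mult_2)
qed

text \<open>The antiderivative of \<open>f v / (i (v - \<tau>))\<^bsup>3/2\<^esup>\<close> is \<open>Q v / (i (v - \<tau>))\<^bsup>1/2\<^esup>\<close>, and \<open>Q \<tau> = 2 i f \<tau>\<close>
  is exactly what the regularization removes.\<close>

lemma reg_integral_eq:
  assumes Im: "Im \<tau> > 0" "Im w > 0" "\<tau> \<noteq> w"
    and Q: "Q holomorphic_on UH"
    and ode: "\<And>v. Im v > 0 \<Longrightarrow> (v - \<tau>) * deriv Q v - Q v / 2 = - \<i> * f v"
  shows "reg_integral \<tau> w f = Q w / csqrt (\<i> * (w - \<tau>))"
proof -
  define s where "s = (\<lambda>v. csqrt (\<i> * (v - \<tau>)))"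
  have s2: "(s v)\<^sup>2 = \<i> * (v - \<tau>)" for v by (simp add: s_def)
  have s0: "s v \<noteq> 0" if "v \<noteq> \<tau>" for v using that by (simp add: s_def)
  obtain S where S: "\<And>z. z \<in> path_image (geodesic \<tau> w) \<Longrightarrow> z \<noteq> \<tau> \<Longrightarrow> path_image (geodesic z w) \<subseteq> S"
    and \<tau>S: "\<tau> \<notin> S" and contS: "continuous_on S s"
    unfolding s_def using geodesic_tail_side [OF Im] by blast
  have Q': "(Q has_field_derivative deriv Q v) (at v within A)" if "Im v > 0" for v A
    using holomorphic_derivI [OF Q open_UH] that by auto
  have prim: "contour_integral (geodesic z w) (\<lambda>v. f v / s v ^ 3) = Q w / s w - Q z / s z"
    if z: "z \<in> path_image (geodesic \<tau> w)" "z \<noteq> \<tau>" for z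
  proof -
    have Imz: "Im z > 0" using geodesic_upper_half_plane [OF Im(1,2) z(1)] .
    have "((\<lambda>v. f v / s v ^ 3) has_contour_integral (Q (pathfinish (geodesic z w)) / s (pathfinish (geodesic z w))
         - Q (pathstart (geodesic z w)) / s (pathstart (geodesic z w)))) (geodesic z w)"
    proof (rule contour_integral_primitive [where S = "S \<inter> UH"])
      fix v assume v: "v \<in> S \<inter> UH"
      then have v\<tau>: "v \<noteq> \<tau>" using \<tau>S by auto
      have s': "(s has_field_derivative \<i> / (2 * s v)) (at v within S \<inter> UH)"
        by (rule has_field_derivative_sqrt_branch [where \<tau> = \<tau>])
           (use v v\<tau> s2 continuous_on_subset [OF contS] in auto)
      have "((\<lambda>v. Q v / s v) has_field_derivative (deriv Q v * s v - Q v * (\<i> / (2 * s v))) / (s v * s v)) (at v within S \<inter> UH)"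
        by (rule DERIV_divide [OF Q' s' s0 [OF v\<tau>]]) (use v in auto)
      moreover have "(deriv Q v * s v - Q v * (\<i> / (2 * s v))) / (s v * s v) = f v / s v ^ 3"
      proof -
        have "(deriv Q v * s v - Q v * (\<i> / (2 * s v))) / (s v * s v) = (deriv Q v * (s v)\<^sup>2 - \<i> * Q v / 2) / s v ^ 3"
          using s0 [OF v\<tau>] by (simp add: field_simps power2_eq_square power3_eq_cube)
        also have "deriv Q v * (s v)\<^sup>2 - \<i> * Q v / 2 = \<i> * ((v - \<tau>) * deriv Q v - Q v / 2)"
          by (simp add: s2 algebra_simps)
        also have "\<dots> = f v" using ode v by simp
        finally show ?thesis .
      qed
      ultimately show "((\<lambda>v. Q v / s v) has_field_derivative f v / s v ^ 3) (at v within S \<inter> UH)" by simp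
    next
      show "path_image (geodesic z w) \<subseteq> S \<inter> UH"
        using S [OF z] geodesic_upper_half_plane [OF Imz Im(2)] by auto
    qed (rule valid_path_geodesic)
    then show ?thesis
      by (simp add: contour_integral_unique pathstart_geodesic pathfinish_geodesic)
  qed
  have Q\<tau>: "Q \<tau> = 2 * \<i> * f \<tau>"
    using ode [OF Im(1)] by (simp add: field_simps)
  let ?F = "at \<tau> within path_image (geodesic \<tau> w)"
  \<comment> \<open>With the primitive inserted, the boundary term that regularization leaves is (Q
    \<tau> - Q z) / s z. It equals i times s z times a difference quotient of \<open>Q\<close>, so
    it vanishes together with \<open>s\<close>.\<close>
  have "(s \<longlongrightarrow> 0) (at \<tau>)"
  proof (rule tendsto_norm_zero_cancel)
    have "((\<lambda>v. sqrt (cmod (\<i> * (v - \<tau>)))) \<longlongrightarrow> sqrt (cmod (\<i> * (\<tau> - \<tau>)))) (at \<tau>)"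
      by (intro tendsto_intros)
    then show "((\<lambda>v. cmod (s v)) \<longlongrightarrow> 0) (at \<tau>)" by (simp add: s_def)
  qed
  moreover have "((\<lambda>z. (Q z - Q \<tau>) / (z - \<tau>)) \<longlongrightarrow> deriv Q \<tau>) (at \<tau>)"
    using Q' [OF Im(1), of UNIV] by (simp add: has_field_derivative_iff)
  ultimately have "((\<lambda>z. \<i> * (s z * ((Q z - Q \<tau>) / (z - \<tau>))) + Q w / s w) \<longlongrightarrow> \<i> * (0 * deriv Q \<tau>) + Q w / s w) (at \<tau>)"
    by (intro tendsto_intros)
  then have "((\<lambda>z. \<i> * (s z * ((Q z - Q \<tau>) / (z - \<tau>))) + Q w / s w) \<longlongrightarrow> Q w / s w) (at \<tau>)"
    by (simp only: mult_zero_left mult_zero_right add_0_left)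
  then have lim: "((\<lambda>z. \<i> * (s z * ((Q z - Q \<tau>) / (z - \<tau>))) + Q w / s w) \<longlongrightarrow> Q w / s w) ?F"
    by (rule Lim_at_imp_Lim_at_within)
  have "((\<lambda>z. contour_integral (geodesic z w) (\<lambda>v. f v / s v ^ 3) + 2 * \<i> * f \<tau> / s z) \<longlongrightarrow> Q w / s w) ?F"
  proof (rule Lim_transform_eventually [OF lim])
    show "\<forall>\<^sub>F z in ?F. \<i> * (s z * ((Q z - Q \<tau>) / (z - \<tau>))) + Q w / s w =
         contour_integral (geodesic z w) (\<lambda>v. f v / s v ^ 3) + 2 * \<i> * f \<tau> / s z"
      unfolding eventually_at_filter
    proof (intro always_eventually allI impI)
      fix z assume z: "z \<noteq> \<tau>" "z \<in> path_image (geodesic \<tau> w)"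
      have "\<i> * (s z * ((Q z - Q \<tau>) / (z - \<tau>))) = \<i> * s z * (Q z - Q \<tau>) * \<i> / (s z)\<^sup>2"
        unfolding s2 using z by (simp add: field_simps)
      also have "\<dots> = (Q \<tau> - Q z) / s z"
        using s0 [OF z(1)] by (simp add: field_simps power2_eq_square)
      finally show "\<i> * (s z * ((Q z - Q \<tau>) / (z - \<tau>))) + Q w / s w =
         contour_integral (geodesic z w) (\<lambda>v. f v / s v ^ 3) + 2 * \<i> * f \<tau> / s z"
        unfolding prim [OF z(2,1)] Q\<tau> [symmetric] by (simp add: diff_divide_distrib)
    qed
  qed
  \<comment> \<open>\<open>Lim\<close> returns the limit only for a nontrivial filter: the geodesic
    is connected and contains two distinct points, so \<tau> is not isolated on it.\<close>
  moreover have "?F \<noteq> bot"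
  proof -
    have "connected (path_image (geodesic \<tau> w))"
      by (intro connected_path_image valid_path_imp_path valid_path_geodesic)
    moreover have "\<tau> \<in> path_image (geodesic \<tau> w)" "w \<in> path_image (geodesic \<tau> w)"
      using pathstart_in_path_image [of "geodesic \<tau> w"] pathfinish_in_path_image [of "geodesic \<tau> w"]
      by (simp_all add: pathstart_geodesic pathfinish_geodesic)
    ultimately have "\<tau> islimpt path_image (geodesic \<tau> w)"
      using connected_imp_perfect [of "path_image (geodesic \<tau> w)" \<tau>] Im(3) by (metis singletonD)
    then show ?thesis by (simp add: trivial_limit_within)
  qed
  ultimately show ?thesis
    unfolding reg_integral_def s_def by (intro tendsto_Lim)
qed

section \<open>Transformation of the double integral\<close>

lemma theta_char_1_holomorphic:
  assumes S: "open S" and g: "g holomorphic_on S" and pos: "\<And>t. t \<in> S \<Longrightarrow> Re (g t) > 0"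
  shows "(\<lambda>t. theta_char 1 x y (g t)) holomorphic_on S"
proof -
  have e: "(of_int n + x) ^ 1 * gauss t (of_int n + x) y =
     gauss t x y * ((of_int n + x) *
     gauss t (of_int n) (y + \<i> * t * x))" for n t
  proof -
    have "gauss t (of_int n + x) y = 
      gauss t x y *
      gauss t (of_int n) (y + \<i> * t * x)"
      unfolding exp_add [symmetric] by (rule arg_cong [where f = exp]) (simp add: algebra_simps power2_eq_square)
    then show ?thesis by (simp add: mult_ac)
  qed
  have "norm (of_int n + x) \<le> (1 + norm x) * exp (2 * pi * \<bar>real_of_int n\<bar>)" for n :: int
  proof -
    have "norm (of_int n + x) \<le> \<bar>real_of_int n\<bar> + norm x"
      by (rule order_trans [OF norm_triangle_ineq]) simp
    also have "\<dots> \<le> (1 + norm x) * (1 + 2 * pi * \<bar>real_of_int n\<bar>)"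
    proof -
      have "\<bar>real_of_int n\<bar> * 1 \<le> \<bar>real_of_int n\<bar> * (2 * pi)"
        using pi_gt3 by (intro mult_left_mono) auto
      then show ?thesis
        by (simp add: algebra_simps) (smt (verit) mult_nonneg_nonneg norm_ge_zero abs_ge_zero pi_ge_zero)
    qed
    also have "\<dots> \<le> (1 + norm x) * exp (2 * pi * \<bar>real_of_int n\<bar>)"
      by (intro mult_left_mono exp_ge_add_one_self) auto
    finally show ?thesis .
  qed
  then have "(\<lambda>t. \<Sum>\<^sub>\<infinity>n::int. (of_int n + x) * gauss (g t) (of_int n) (y + \<i> * g t * x)) holomorphic_on S"
    by (intro jtheta_weighted_holomorphic holomorphic_intros S g pos)
  then show ?thesis
    unfolding theta_char_def e infsum_cmult_right' by (intro holomorphic_intros g)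
qed

lemma theta_holomorphic:
  "theta 1 3 1 holomorphic_on UH" "theta 1 3 2 holomorphic_on UH"
  "theta 1 (3 / 2) 1 holomorphic_on UH" "theta 1 (3 / 2) 0 holomorphic_on UH"
proof -
  have odd: "theta_odd x holomorphic_on UH" for x
  proof -
    have "(\<lambda>\<tau>. theta_char 1 x 0 (- 6 * \<i> * \<tau>)) holomorphic_on UH"
      by (intro theta_char_1_holomorphic open_UH holomorphic_intros) auto
    then show ?thesis
      by (rule holomorphic_transform) (simp add: theta_odd_has_sum(2))
  qed
  have alt: "theta_alt 1 x holomorphic_on UH" for x
  proof -
    have "(\<lambda>\<tau>. theta_char 1 x (1 / 2) (- 3 * \<i> * \<tau>)) holomorphic_on UH"
      by (intro theta_char_1_holomorphic open_UH holomorphic_intros) auto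
    then have "(\<lambda>\<tau>. exp (- of_real pi * \<i> * x) * theta_char 1 x (1 / 2) (- 3 * \<i> * \<tau>)) holomorphic_on UH"
      by (intro holomorphic_intros)
    then show ?thesis
    proof (rule holomorphic_transform)
      fix \<tau> assume "\<tau> \<in> UH"
      then show "exp (- of_real pi * \<i> * x) * theta_char 1 x (1 / 2) (- 3 * \<i> * \<tau>) = theta_alt 1 x \<tau>"
        using theta_alt_has_sum(2) [of \<tau> 1 x] by simp
    qed
  qed
  show "theta 1 3 1 holomorphic_on UH" "theta 1 3 2 holomorphic_on UH"
    "theta 1 (3 / 2) 1 holomorphic_on UH" "theta 1 (3 / 2) 0 holomorphic_on UH"
    unfolding theta_eq [abs_def] by (rule odd alt)+
qed

text \<open>\<open>Q\<close> is assembled from the solutions for the four theta series instead of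
  being solved for separately at each \<open>w1\<close>; hence the diagonal \<open>Q w w\<close> is
  holomorphic in \<open>w\<close>. The factor i (w - \<tau>) split off from it is the product of the
  roots from the inner and the outer integral.\<close>

lemma Phi_hat_as_holomorphic_integral:
  assumes \<tau>: "Im \<tau> > 0"
  obtains Q R where "R holomorphic_on UH"
    and "\<And>w1. Im w1 > 0 \<Longrightarrow> Q w1 holomorphic_on UH"
    and "\<And>w1 v. Im w1 > 0 \<Longrightarrow> Im v > 0 \<Longrightarrow> (v - \<tau>) * deriv (Q w1) v - Q w1 v / 2 =
           - \<i> * (wedge_form w1 v * (1 - of_real pi * \<i> / 6 * (v - \<tau>) * E2 \<tau>))"
    and "\<And>w1. Im w1 > 0 \<Longrightarrow> Q w1 w1 = \<i> * (w1 - \<tau>) * R w1"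
    and "\<And>w. Im w > 0 \<Longrightarrow> w \<noteq> \<tau> \<Longrightarrow> Phi_hat \<tau> w = 1 / of_real pi * contour_integral (geodesic \<tau> w) R"
proof -
  let ?F = "\<lambda>w1 w2. (4 * f0 w1 w2 + g0 w1 w2) * (1 - of_real pi * \<i> / 6 * (w2 - \<tau>) * E2 \<tau>)"
  define e where "e = (\<lambda>v. 1 - of_real pi * \<i> / 6 * (v - \<tau>) * E2 \<tau>)"
  have e: "e holomorphic_on UH" unfolding e_def by (intro holomorphic_intros)
  let ?T1 = "theta 1 3 1" and ?T2 = "theta 1 3 2" and ?A1 = "theta 1 (3 / 2) 1" and ?A0 = "theta 1 (3 / 2) 0"
  have ex: "\<exists>q. q holomorphic_on UH \<and> (\<forall>v. Im v > 0 \<longrightarrow> (v - \<tau>) * deriv q v - q v / 2 = - \<i> * (T v * e v))"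
    if T: "T holomorphic_on UH" for T
  proof -
    have "(\<lambda>v. T v * e v) holomorphic_on UH" by (intro holomorphic_intros T e)
    from half_order_ode_exists [OF this \<tau>] show ?thesis by metis
  qed
  obtain q1 where q1: "q1 holomorphic_on UH" "\<And>v. Im v > 0 \<Longrightarrow> (v - \<tau>) * deriv q1 v - q1 v / 2 = - \<i> * (?T1 v * e v)"
    using ex [OF theta_holomorphic(1)] by blast
  obtain q2 where q2: "q2 holomorphic_on UH" "\<And>v. Im v > 0 \<Longrightarrow> (v - \<tau>) * deriv q2 v - q2 v / 2 = - \<i> * (?T2 v * e v)"
    using ex [OF theta_holomorphic(2)] by blast
  obtain p1 where p1: "p1 holomorphic_on UH" "\<And>v. Im v > 0 \<Longrightarrow> (v - \<tau>) * deriv p1 v - p1 v / 2 = - \<i> * (?A1 v * e v)"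
    using ex [OF theta_holomorphic(3)] by blast
  obtain p0 where p0: "p0 holomorphic_on UH" "\<And>v. Im v > 0 \<Longrightarrow> (v - \<tau>) * deriv p0 v - p0 v / 2 = - \<i> * (?A0 v * e v)"
    using ex [OF theta_holomorphic(4)] by blast
  define Q where "Q = (\<lambda>w1 v. 4 * (?T1 w1 * q2 v - ?T2 w1 * q1 v) + (?A1 w1 * p0 v - ?A0 w1 * p1 v))"
  have Qhol: "Q w1 holomorphic_on UH" for w1
    unfolding Q_def by (intro holomorphic_intros q1 q2 p1 p0)
  have ode: "(v - \<tau>) * deriv (Q w1) v - Q w1 v / 2 = - \<i> * (wedge_form w1 v * e v)" if v: "Im v > 0" for w1 v
  proof -
    have d: "(f has_field_derivative deriv f v) (at v)" if "f holomorphic_on UH" for f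
      using holomorphic_derivI [OF that open_UH] v by auto
    have "(Q w1 has_field_derivative 4 * (?T1 w1 * deriv q2 v - ?T2 w1 * deriv q1 v) + (?A1 w1 * deriv p0 v - ?A0 w1 * deriv p1 v)) (at v)"
      unfolding Q_def by (intro DERIV_add DERIV_diff DERIV_cmult d q1 q2 p1 p0)
    then have D: "deriv (Q w1) v = 4 * (?T1 w1 * deriv q2 v - ?T2 w1 * deriv q1 v) + (?A1 w1 * deriv p0 v - ?A0 w1 * deriv p1 v)"
      by (rule DERIV_imp_deriv)
    have "(v - \<tau>) * deriv (Q w1) v - Q w1 v / 2 =
        4 * (?T1 w1 * ((v - \<tau>) * deriv q2 v - q2 v / 2) - ?T2 w1 * ((v - \<tau>) * deriv q1 v - q1 v / 2))
        + (?A1 w1 * ((v - \<tau>) * deriv p0 v - p0 v / 2) - ?A0 w1 * ((v - \<tau>) * deriv p1 v - p1 v / 2))"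
      unfolding D unfolding Q_def by (simp add: field_simps)
    also have "\<dots> = - \<i> * (wedge_form w1 v * e v)"
      unfolding q1(2) [OF v] q2(2) [OF v] p1(2) [OF v] p0(2) [OF v] wedge_form_def f0_def g0_def
      by (simp add: algebra_simps)
    finally show ?thesis .
  qed
  define R0 where "R0 = (\<lambda>w. Q w w)"
  have R0: "R0 holomorphic_on UH"
    unfolding R0_def Q_def by (intro holomorphic_intros q1 q2 p1 p0 theta_holomorphic)
  \<comment> \<open>At v = \<tau> the derivative drops out of the differential equation, and the
    determinants on its right side vanish at equal arguments.\<close>
  have "R0 \<tau> = 0"
  proof -
    have "wedge_form \<tau> \<tau> = 0" by (simp add: wedge_form_def f0_def g0_def)
    with ode [OF \<tau>, of \<tau>] show ?thesis by (simp add: R0_def)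
  qed
  from holomorphic_factor_zero [OF R0 open_UH _ this] \<tau>
  obtain g where g: "g holomorphic_on UH" "\<And>w. w \<in> UH \<Longrightarrow> R0 w = (w - \<tau>) * g w" by blast
  define R where "R = (\<lambda>w. - \<i> * g w)"
  have QR: "Q w w = \<i> * (w - \<tau>) * R w" if "Im w > 0" for w
  proof -
    have "Q w w = (w - \<tau>) * g w" using g(2) [of w] that by (simp add: R0_def)
    then show ?thesis by (simp add: R_def algebra_simps)
  qed
  have Phi: "Phi_hat \<tau> w = 1 / of_real pi * contour_integral (geodesic \<tau> w) R" if w: "Im w > 0" "w \<noteq> \<tau>" for w
  proof -
    \<comment> \<open>The integrands are compared away from the starting point only, where the root
      is 0; on a simple path a single point does not affect the integral.\<close>
    have "contour_integral (geodesic \<tau> w) (\<lambda>w1. reg_integral \<tau> w1 (?F w1)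
      / csqrt (\<i> * (w1 - \<tau>))) = contour_integral (geodesic \<tau> w) R"
    proof (rule contour_integral_spike_finite_simple_path [where A = "{\<tau>}"])
      show "simple_path (geodesic \<tau> w)" by (rule simple_path_geodesic) (use \<tau> w in auto)
      fix w1 assume w1: "w1 \<in> path_image (geodesic \<tau> w) - {\<tau>}"
      have Im: "Im w1 > 0" using geodesic_upper_half_plane \<tau> w w1 by blast
      have ne: "\<tau> \<noteq> w1" using w1 by auto
      have "reg_integral \<tau> w1 (?F w1) = Q w1 w1 / csqrt (\<i> * (w1 - \<tau>))"
        by (rule reg_integral_eq [OF \<tau> Im ne Qhol]) (use ode in \<open>simp only: wedge_form_def e_def\<close>)
      moreover have "csqrt (\<i> * (w1 - \<tau>)) * csqrt (\<i> * (w1 - \<tau>)) = \<i> * (w1 - \<tau>)"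
        using power2_csqrt [of "\<i> * (w1 - \<tau>)"] by (simp add: power2_eq_square)
      ultimately show "reg_integral \<tau> w1 (?F w1) / csqrt (\<i> * (w1 - \<tau>)) = R w1"
        using ne by (simp add: QR [OF Im] divide_divide_eq_left)
    qed auto
    then show ?thesis by (simp only: Phi_hat_def)
  qed
  show thesis
  proof (rule that [of R Q])
    show "R holomorphic_on UH" unfolding R_def by (intro holomorphic_intros g)
  qed (use Qhol ode QR Phi in \<open>simp_all add: e_def\<close>)
qed

section \<open>Moebius maps, quasi-modularity of \<open>E2\<close> and the multiplier of
  \<eta>\<close>

lemma
  assumes det: "a * d - b * c = 1" and z: "Im z > 0"
  shows moebius_denom_nonzero: "of_int c * z + of_int d \<noteq> 0"
    and Im_moebius_pos: "Im (moebius a b c d z) > 0"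
    and moebius_diff: "Im w > 0 \<Longrightarrow> moebius a b c d z - moebius a b c d w = (z - w) / ((of_int c * z + of_int d) * (of_int c * w + of_int d))"
    and moebius_deriv: "(moebius a b c d has_field_derivative 1 / (of_int c * z + of_int d)\<^sup>2) (at z)"
proof -
  have nz: "of_int c * z + of_int d \<noteq> 0" if z: "Im z > 0" for z
  proof
    assume 0: "of_int c * z + of_int d = 0"
    from arg_cong [OF this, of Im] z have "c = 0" by simp
    with 0 have "d = 0" by simp
    with \<open>c = 0\<close> det show False by simp
  qed
  have detR: "real_of_int a * of_int d - of_int b * of_int c = 1"
    using arg_cong [OF det, of real_of_int] by simp
  have detC: "of_int a * of_int d = (1 + of_int b * of_int c :: complex)"
    using arg_cong [OF det, of "of_int :: int \<Rightarrow> complex"] by (simp add: algebra_simps)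
  show "of_int c * z + of_int d \<noteq> 0" by (rule nz [OF z])
  have "Im ((of_int a * z + of_int b) * cnj (of_int c * z + of_int d)) = Im z * (real_of_int a * of_int d - of_int b * of_int c)"
    by (simp add: algebra_simps)
  then show "Im (moebius a b c d z) > 0"
    unfolding moebius_def Im_complex_div_gt_0 detR using z by simp
  show "moebius a b c d z - moebius a b c d w = (z - w) / ((of_int c * z + of_int d) * (of_int c * w + of_int d))" if w: "Im w > 0"
  proof -
    have "(of_int a * z + of_int b) * (of_int c * w + of_int d) - (of_int a * w + of_int b) * (of_int c * z + of_int d) =
        (of_int a * of_int d - of_int b * of_int c) * (z - w)"
      by (simp add: algebra_simps)
    also have "\<dots> = z - w" unfolding detC by simp
    finally show ?thesis
      unfolding moebius_def by (simp add: diff_frac_eq nz [OF z] nz [OF w])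
  qed
  have "((\<lambda>z. (of_int a * z + of_int b) / (of_int c * z + of_int d)) has_field_derivative
      (of_int a * (of_int c * z + of_int d) - (of_int a * z + of_int b) * of_int c) / ((of_int c * z + of_int d) * (of_int c * z + of_int d))) (at z)"
    by (rule DERIV_divide) (auto intro!: derivative_eq_intros nz [OF z])
  moreover have "of_int a * (of_int c * z + of_int d) - (of_int a * z + of_int b) * of_int c = 1"
    using detC by (simp add: algebra_simps)
  ultimately show "(moebius a b c d has_field_derivative 1 / (of_int c * z + of_int d)\<^sup>2) (at z)"
    by (simp add: moebius_def [abs_def] power2_eq_square)
qed

text \<open>The square of h = \<eta>(M v) / \<eta>(v) is \<kappa> J, hence h' / h = c / (2 J) with
  no choice of root. Computed from the derivative of \<eta>, the same quotient is E2(M v) / J^2 -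
  E2(v) times pi i / 12; equating the two gives the law for \<open>E2\<close>.\<close>

lemma
  assumes M: "eta_wedge_modular a b c d \<kappa>" and det: "a * d - b * c = 1" and v: "Im v > 0"
  defines "J \<equiv> \<lambda>v. of_int c * v + of_int d"
  shows eta_quotient_deriv: "((\<lambda>v. eta (moebius a b c d v) / eta v) has_field_derivative
            eta (moebius a b c d v) / eta v * of_int c / (2 * J v)) (at v)"
    and E2_moebius: "of_real pi * \<i> / 12 * E2 (moebius a b c d v) = (J v)\<^sup>2 * (of_real pi * \<i> / 12 * E2 v) + of_int c * J v / 2"
proof -
  define L where "L = of_real pi * \<i> / 12"
  define h where "h = (\<lambda>v. eta (moebius a b c d v) / eta v)"
  have J0: "J v \<noteq> 0" if "Im v > 0" for v unfolding J_def by (rule moebius_denom_nonzero [OF det that])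
  have ImM: "Im (moebius a b c d v) > 0" if "Im v > 0" for v by (rule Im_moebius_pos [OF det that])
  have h2: "(h v)\<^sup>2 = \<kappa> * J v" if "Im v > 0" for v
    using M that eta_nonzero [OF that] by (simp add: h_def J_def eta_wedge_modular_def power_divide)
  have h0: "h v \<noteq> 0" using eta_nonzero [OF v] eta_nonzero [OF ImM [OF v]] by (simp add: h_def)
  define X where "X = L * E2 (moebius a b c d v) / (J v)\<^sup>2 - L * E2 v"
  have "((\<lambda>v. eta (moebius a b c d v)) has_field_derivative (L * E2 (moebius a b c d v) * eta (moebius a b c d v)) * (1 / (J v)\<^sup>2)) (at v)"
    unfolding L_def J_def by (rule DERIV_chain2 [OF eta_deriv [OF ImM [OF v]] moebius_deriv [OF det v]])
  from DERIV_divide [OF this eta_deriv [OF v] eta_nonzero [OF v]]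
  have "(h has_field_derivative (L * E2 (moebius a b c d v) * eta (moebius a b c d v) * (1 / (J v)\<^sup>2) * eta v - eta (moebius a b c d v) * (L * E2 v * eta v)) / (eta v * eta v)) (at v)"
    unfolding h_def L_def .
  moreover have "(L * E2 (moebius a b c d v) * eta (moebius a b c d v) * (1 / (J v)\<^sup>2) * eta v - eta (moebius a b c d v) * (L * E2 v * eta v)) / (eta v * eta v) = h v * X"
    using eta_nonzero [OF v] by (simp add: h_def X_def field_simps)
  ultimately have h': "(h has_field_derivative h v * X) (at v)" by simp
  then have "((\<lambda>v. (h v)\<^sup>2) has_field_derivative 2 * (h v)\<^sup>2 * X) (at v)"
    by (auto intro!: derivative_eq_intros simp: power2_eq_square)
  moreover have "((\<lambda>v. \<kappa> * J v) has_field_derivative \<kappa> * of_int c) (at v)"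
    unfolding J_def by (auto intro!: derivative_eq_intros)
  then have "((\<lambda>v. (h v)\<^sup>2) has_field_derivative \<kappa> * of_int c) (at v)"
    by (rule has_field_derivative_transform_within_open [OF _ open_UH]) (use v h2 in auto)
  ultimately have "2 * (h v)\<^sup>2 * X = \<kappa> * of_int c"
    by (rule DERIV_unique)
  then have "\<kappa> * (2 * J v * X) = \<kappa> * of_int c"
    by (simp add: h2 [OF v] mult_ac)
  moreover have "\<kappa> \<noteq> 0" using h2 [OF v] h0 by auto
  ultimately have X: "X = of_int c / (2 * J v)"
    using J0 [OF v] by (simp add: field_simps)
  show "((\<lambda>v. eta (moebius a b c d v) / eta v) has_field_derivative
            eta (moebius a b c d v) / eta v * of_int c / (2 * J v)) (at v)"
    using h' unfolding X h_def by simp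
  have "L * E2 (moebius a b c d v) = (J v)\<^sup>2 * (L * E2 v + X)"
    using J0 [OF v] by (simp add: X_def field_simps)
  also have "\<dots> = (J v)\<^sup>2 * (L * E2 v) + of_int c * J v / 2"
    using J0 [OF v] unfolding X by (simp add: field_simps power2_eq_square)
  finally show "of_real pi * \<i> / 12 * E2 (moebius a b c d v) = (J v)\<^sup>2 * (of_real pi * \<i> / 12 * E2 v) + of_int c * J v / 2"
    unfolding L_def .
qed

text \<open>Both \<open>h\<close> and the principal root of \<open>J\<close> have logarithmic
  derivative c / (2 J), so their quotient is constant on the half-plane. This constant is the number
  described by \<open>nu_eta\<close>, unique because \<eta> and the root do not vanish at i.\<close>

lemma nu_eta_square:
  assumes M: "eta_wedge_modular a b c d \<kappa>" and det: "a * d - b * c = 1"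
  shows "nu_eta a b c d ^ 2 = \<kappa>"
proof -
  define J where "J = (\<lambda>v. of_int c * v + of_int d :: complex)"
  define h where "h = (\<lambda>v. eta (moebius a b c d v) / eta v)"
  define s where "s = (\<lambda>v. csqrt (J v))"
  have J0: "J v \<noteq> 0" if "Im v > 0" for v unfolding J_def by (rule moebius_denom_nonzero [OF det that])
  have s0: "s v \<noteq> 0" if "Im v > 0" for v using J0 [OF that] by (simp add: s_def)
  have s2: "s v * s v = J v" for v using power2_csqrt [of "J v"] by (simp add: s_def power2_eq_square)
  \<comment> \<open>For c = 0 the factor \<open>J\<close> is constant, possibly - 1 and so on the
    cut, but then the root is constant as well; otherwise \<open>J v\<close> is not real and the
    root is differentiable there.\<close>
  have s': "(s has_field_derivative of_int c / (2 * s v)) (at v)" if v: "Im v > 0" for v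
  proof (cases "c = 0")
    case True
    then show ?thesis by (simp add: s_def [abs_def] J_def)
  next
    case False
    then have "J v \<notin> \<real>\<^sub>\<le>\<^sub>0" using v by (auto simp: J_def complex_nonpos_Reals_iff)
    then have "(csqrt has_field_derivative inverse (2 * csqrt (J v))) (at (J v))"
      by (rule has_field_derivative_csqrt)
    moreover have "(J has_field_derivative of_int c) (at v)"
      unfolding J_def by (auto intro!: derivative_eq_intros)
    ultimately have "(s has_field_derivative inverse (2 * csqrt (J v)) * of_int c) (at v)"
      unfolding s_def by (rule DERIV_chain2)
    then show ?thesis by (simp add: s_def field_simps)
  qed
  have "\<exists>\<nu>. \<forall>v\<in>UH. h v / s v = \<nu>"
  proof (rule has_field_derivative_zero_constant [OF convex_UH])
    fix v assume "v \<in> UH"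
    then have v: "Im v > 0" by simp
    have h': "(h has_field_derivative h v * of_int c / (2 * J v)) (at v)"
      using eta_quotient_deriv [OF M det v] by (simp add: h_def J_def)
    have "((\<lambda>v. h v / s v) has_field_derivative (h v * of_int c / (2 * J v) * s v - h v * (of_int c / (2 * s v))) / (s v * s v)) (at v)"
      by (rule DERIV_divide [OF h' s' [OF v] s0 [OF v]])
    moreover have "h v * of_int c / (2 * J v) * s v - h v * (of_int c / (2 * s v)) = 0"
      unfolding s2 [symmetric] using s0 [OF v] by (simp add: field_simps)
    ultimately show "((\<lambda>v. h v / s v) has_field_derivative 0) (at v within UH)"
      by (simp add: has_field_derivative_at_within)
  qed
  then obtain \<nu> where \<nu>: "h v / s v = \<nu>" if "Im v > 0" for v by auto
  have hs: "h v = \<nu> * s v" if "Im v > 0" for v using \<nu> [OF that] s0 [OF that] by (simp add: field_simps)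
  have "nu_eta a b c d = \<nu>"
    unfolding nu_eta_def
  proof (rule the_equality)
    have "eta (moebius a b c d v) = \<nu> * s v * eta v" if "Im v > 0" for v
      using hs [OF that] eta_nonzero [OF that] by (simp add: h_def field_simps)
    then show *: "\<forall>\<tau>. Im \<tau> > 0 \<longrightarrow> eta (moebius a b c d \<tau>) = \<nu> * csqrt (of_int c * \<tau> + of_int d) * eta \<tau>"
      by (simp add: s_def J_def)
    fix \<mu> assume "\<forall>\<tau>. Im \<tau> > 0 \<longrightarrow> eta (moebius a b c d \<tau>) = \<mu> * csqrt (of_int c * \<tau> + of_int d) * eta \<tau>"
    with * have "\<mu> * (s \<i> * eta \<i>) = \<nu> * (s \<i> * eta \<i>)"
      by (simp add: s_def J_def mult.assoc)
    then show "\<mu> = \<nu>" using s0 [of \<i>] eta_nonzero [of \<i>] by simp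
  qed
  moreover have "\<nu>\<^sup>2 = \<kappa>"
  proof -
    have "(h \<i>)\<^sup>2 = \<kappa> * J \<i>"
      using M eta_nonzero [of \<i>] by (simp add: h_def J_def eta_wedge_modular_def power_divide)
    moreover have "(h \<i>)\<^sup>2 = \<nu>\<^sup>2 * J \<i>"
      unfolding hs [of \<i>, simplified] by (simp add: power2_eq_square s2 [symmetric])
    ultimately show ?thesis using J0 [of \<i>] by simp
  qed
  ultimately show ?thesis by simp
qed

theorem proposition6p7:
  fixes \<tau> w :: complex and a b c d :: int
  assumes "Im \<tau> > 0" and "Im w > 0" and "\<tau> \<noteq> w"
    and "a * d - b * c = 1"
  shows "Phi_hat ((of_int a * \<tau> + of_int b) / (of_int c * \<tau> + of_int d))
                 ((of_int a * w + of_int b) / (of_int c * w + of_int d))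
         = nu_eta a b c d ^ 10 * (of_int c * \<tau> + of_int d) ^ 3 * Phi_hat \<tau> w"
proof -
  note \<tau> = assms(1) and w = assms(2) and det = assms(4)
  obtain \<kappa> where \<kappa>: "eta_wedge_modular a b c d \<kappa>"
    using eta_wedge_modular_exists [OF det] by blast
  define M where "M = moebius a b c d"
  define J where "J = (\<lambda>v. of_int c * v + of_int d :: complex)"
  define h where "h = (\<lambda>v. eta (M v) / eta v)"
  have J0: "J v \<noteq> 0" if "Im v > 0" for v unfolding J_def by (rule moebius_denom_nonzero [OF det that])
  have ImM: "Im (M v) > 0" if "Im v > 0" for v unfolding M_def by (rule Im_moebius_pos [OF det that])
  have Mdiff: "M v - M u = (v - u) / (J v * J u)" if "Im v > 0" "Im u > 0" for u v
    unfolding M_def J_def by (rule moebius_diff [OF det that])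
  have M': "(M has_field_derivative 1 / (J v)\<^sup>2) (at v)" if "Im v > 0" for v
    unfolding M_def J_def by (rule moebius_deriv [OF det that])
  have h2: "(h v)\<^sup>2 = \<kappa> * J v" if "Im v > 0" for v
    using \<kappa> that eta_nonzero [OF that] by (simp add: h_def M_def J_def eta_wedge_modular_def power_divide)
  have h0: "h v \<noteq> 0" if "Im v > 0" for v
    using eta_nonzero [OF that] eta_nonzero [OF ImM [OF that]] by (simp add: h_def)
  have h': "(h has_field_derivative h v * of_int c / (2 * J v)) (at v)" if "Im v > 0" for v
    using eta_quotient_deriv [OF \<kappa> det that] by (simp add: h_def M_def J_def)
  have wedge: "wedge_form (M u) (M v) = \<kappa>\<^sup>2 * h u ^ 3 * h v ^ 3 * wedge_form u v" if "Im u > 0" "Im v > 0" for u v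
  proof -
    have "wedge_form (M u) (M v) / (eta (M u) ^ 3 * eta (M v) ^ 3) = \<kappa>\<^sup>2 * (wedge_form u v / (eta u ^ 3 * eta v ^ 3))"
      using \<kappa> that by (simp add: M_def eta_wedge_modular_def)
    then show ?thesis
      using that eta_nonzero [OF that(1)] eta_nonzero [OF that(2)] eta_nonzero [OF ImM [OF that(1)]] eta_nonzero [OF ImM [OF that(2)]]
      by (simp add: h_def field_simps)
  qed
  \<comment> \<open>The inhomogeneous term c J(\<tau>) in the law for \<open>E2\<close> is absorbed
    through J(v) - c (v - \<tau>) = J(\<tau>); the bracket thus transforms by a mere factor.\<close>
  have E2: "1 - of_real pi * \<i> / 6 * (M v - M \<tau>) * E2 (M \<tau>) = J \<tau> / J v * (1 - of_real pi * \<i> / 6 * (v - \<tau>) * E2 \<tau>)" if v: "Im v > 0" for v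
  proof -
    have L: "of_real pi * \<i> / 6 * E2 (M \<tau>) = (J \<tau>)\<^sup>2 * (of_real pi * \<i> / 6 * E2 \<tau>) + of_int c * J \<tau>"
    proof -
      have 1: "of_real pi * \<i> / 6 * X = 2 * (of_real pi * \<i> / 12 * X)" for X :: complex
        by simp
      have 2: "2 * (X * Y + Z / 2) = X * (2 * Y) + Z" for X Y Z :: complex
        by (simp add: algebra_simps)
      show ?thesis
        unfolding 1 M_def E2_moebius [OF \<kappa> det \<tau>] 2 J_def ..
    qed
    have "1 - of_real pi * \<i> / 6 * (M v - M \<tau>) * E2 (M \<tau>) = 1 - (M v - M \<tau>) * (of_real pi * \<i> / 6 * E2 (M \<tau>))"
      by (simp add: mult_ac)
    also have "\<dots> = (J v - of_int c * (v - \<tau>) - J \<tau> * (v - \<tau>) * (of_real pi * \<i> / 6 * E2 \<tau>)) / J v"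
      unfolding L Mdiff [OF v \<tau>] using J0 [OF v] J0 [OF \<tau>] by (simp add: field_simps power2_eq_square)
    also have "J v - of_int c * (v - \<tau>) = J \<tau>" by (simp add: J_def algebra_simps)
    also have "(J \<tau> - J \<tau> * (v - \<tau>) * (of_real pi * \<i> / 6 * E2 \<tau>)) / J v =
        J \<tau> / J v * (1 - of_real pi * \<i> / 6 * (v - \<tau>) * E2 \<tau>)"
    proof -
      have "(A - A * X * (Y * Z)) / B = A / B * (1 - Y * X * Z)" for A B X Y Z :: complex
        by (simp add: right_diff_distrib diff_divide_distrib mult_ac)
      then show ?thesis .
    qed
    finally show ?thesis .
  qed
  obtain Q R where R: "R holomorphic_on UH" and Q: "\<And>w1. Im w1 > 0 \<Longrightarrow> Q w1 holomorphic_on UH"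
    and ode: "\<And>w1 v. Im w1 > 0 \<Longrightarrow> Im v > 0 \<Longrightarrow> (v - \<tau>) * deriv (Q w1) v - Q w1 v / 2 =
           - \<i> * (wedge_form w1 v * (1 - of_real pi * \<i> / 6 * (v - \<tau>) * E2 \<tau>))"
    and QR: "\<And>w1. Im w1 > 0 \<Longrightarrow> Q w1 w1 = \<i> * (w1 - \<tau>) * R w1"
    and Phi: "\<And>w. Im w > 0 \<Longrightarrow> w \<noteq> \<tau> \<Longrightarrow> Phi_hat \<tau> w = 1 / of_real pi * contour_integral (geodesic \<tau> w) R"
    using Phi_hat_as_holomorphic_integral [OF \<tau>] by metis
  obtain Q1 R1 where R1: "R1 holomorphic_on UH" and Q1: "\<And>w1. Im w1 > 0 \<Longrightarrow> Q1 w1 holomorphic_on UH"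
    and ode1: "\<And>w1 v. Im w1 > 0 \<Longrightarrow> Im v > 0 \<Longrightarrow> (v - M \<tau>) * deriv (Q1 w1) v - Q1 w1 v / 2 =
           - \<i> * (wedge_form w1 v * (1 - of_real pi * \<i> / 6 * (v - M \<tau>) * E2 (M \<tau>)))"
    and QR1: "\<And>w1. Im w1 > 0 \<Longrightarrow> Q1 w1 w1 = \<i> * (w1 - M \<tau>) * R1 w1"
    and Phi1: "\<And>w. Im w > 0 \<Longrightarrow> w \<noteq> M \<tau> \<Longrightarrow> Phi_hat (M \<tau>) w = 1 / of_real pi * contour_integral (geodesic (M \<tau>) w) R1"
    using Phi_hat_as_holomorphic_integral [OF ImM [OF \<tau>]] by metis
  \<comment> \<open>The factor \<open>h v\<close> stands in for a root of \<open>J v\<close>: its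
    derivative h c / (2 J) compensates the change of the coefficient v - \<tau> under the Moebius
    map, so that both sides satisfy the same equation in \<open>v\<close> and uniqueness
    applies.\<close>
  have Q1Q: "Q1 (M u) (M v) * h v = \<kappa> ^ 4 * h u ^ 3 * (J \<tau>)\<^sup>2 * Q u v" if u: "Im u > 0" and v: "Im v > 0" for u v
  proof -
    define C where "C = \<kappa> ^ 4 * h u ^ 3 * (J \<tau>)\<^sup>2"
    define G where "G = (\<lambda>v. Q1 (M u) (M v) * h v)"
    have G': "(G has_field_derivative deriv (Q1 (M u)) (M v) * (1 / (J v)\<^sup>2) * h v + h v * of_int c / (2 * J v) * Q1 (M u) (M v)) (at v)" if v: "Im v > 0" for v
    proof -
      have "(Q1 (M u) has_field_derivative deriv (Q1 (M u)) (M v)) (at (M v))"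
        using holomorphic_derivI [OF Q1 open_UH] ImM u v by auto
      from DERIV_mult [OF DERIV_chain2 [OF this M' [OF v]] h' [OF v]]
      show ?thesis by (simp add: G_def)
    qed
    have Q': "(Q u has_field_derivative deriv (Q u) v) (at v)" if "Im v > 0" for v
      using holomorphic_derivI [OF Q open_UH] u that by auto
    define D where "D = (\<lambda>v. G v - C * Q u v)"
    have D': "(D has_field_derivative deriv (Q1 (M u)) (M v) * (1 / (J v)\<^sup>2) * h v + h v * of_int c / (2 * J v) * Q1 (M u) (M v) - C * deriv (Q u) v) (at v)" if "Im v > 0" for v
      unfolding D_def by (intro DERIV_diff G' DERIV_cmult Q' that)
    have "D v = 0"
    proof (rule half_order_ode_unique [OF _ _ \<tau> v])
      show "D holomorphic_on UH"
        unfolding holomorphic_on_open [OF open_UH] using D' by auto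
      fix v :: complex assume v: "Im v > 0"
      define e where "e = 1 - of_real pi * \<i> / 6 * (v - \<tau>) * E2 \<tau>"
      define q where "q = Q1 (M u) (M v)"
      define q' where "q' = deriv (Q1 (M u)) (M v)"
      have vc: "(v - \<tau>) * of_int c = J v - J \<tau>" by (simp add: J_def algebra_simps)
      have "(v - \<tau>) * (h v * of_int c / (2 * J v) * q) = h v * q / (2 * J v) * ((v - \<tau>) * of_int c)"
        by simp
      note vc' = this [unfolded vc]
      have c: "(v - \<tau>) * (h v * of_int c / (2 * J v) * q) - h v * q / 2 = - (h v * (J \<tau> / J v) * (q / 2))"
        unfolding vc' using J0 [OF v] by (simp add: field_simps)
      have o1: "(v - \<tau>) / (J v * J \<tau>) * q' - q / 2 = - \<i> * (\<kappa>\<^sup>2 * h u ^ 3 * h v ^ 3 * wedge_form u v * (J \<tau> / J v * e))"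
        using ode1 [OF ImM [OF u] ImM [OF v]] unfolding E2 [OF v] wedge [OF u v] unfolding Mdiff [OF v \<tau>] q_def q'_def e_def .
      \<comment> \<open>Three factors \<open>h v\<close> come from the wedge form and one from the
        multiplication; their product has integral weight, so \<open>h v\<close> disappears and two
        of the four factors \<kappa> in \<open>C\<close> arise.\<close>
      have h4: "h v ^ 4 = \<kappa>\<^sup>2 * (J v)\<^sup>2"
      proof -
        have "h v ^ 4 = ((h v)\<^sup>2)\<^sup>2" by (simp flip: power_mult)
        then show ?thesis by (simp add: h2 [OF v] power_mult_distrib)
      qed
      have "(v - \<tau>) * (q' * (1 / (J v)\<^sup>2) * h v + h v * of_int c / (2 * J v) * q) - h v * q / 2 =
         (v - \<tau>) * (q' * (1 / (J v)\<^sup>2) * h v) + ((v - \<tau>) * (h v * of_int c / (2 * J v) * q) - h v * q / 2)"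
        by (simp add: distrib_left)
      also have "\<dots> = h v * (J \<tau> / J v) * ((v - \<tau>) / (J v * J \<tau>) * q' - q / 2)"
        unfolding c using J0 [OF v] J0 [OF \<tau>] by (simp add: field_simps power2_eq_square)
      also have "\<dots> = - \<i> * (\<kappa>\<^sup>2 * h u ^ 3 * h v ^ 4 * wedge_form u v * (J \<tau> / J v)\<^sup>2 * e)"
        unfolding o1 by (simp add: power2_eq_square eval_nat_numeral mult_ac)
      also have "\<dots> = C * (- \<i> * (wedge_form u v * e))"
        unfolding h4 C_def using J0 [OF v] by (simp add: field_simps power2_eq_square eval_nat_numeral)
      also have "\<dots> = C * ((v - \<tau>) * deriv (Q u) v - Q u v / 2)"
        using ode [OF u v] by (simp only: e_def)
      finally have fin: "(v - \<tau>) * (q' * (1 / (J v)\<^sup>2) * h v + h v * of_int c / (2 * J v) * q) - h v * q / 2 = C * ((v - \<tau>) * deriv (Q u) v - Q u v / 2)" .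
      have gen: "x * (X - C * Y) = (q * y - C * z) / 2" if "x * X - y * q / 2 = C * (x * Y - z / 2)" for x X Y y z q :: complex
      proof -
        have "x * (X - C * Y) = (x * X - y * q / 2) - C * (x * Y - z / 2) + (q * y - C * z) / 2"
          by (simp add: field_simps)
        with that show ?thesis by simp
      qed
      show "(v - \<tau>) * deriv D v = D v / 2"
        unfolding DERIV_imp_deriv [OF D' [OF v]] unfolding D_def G_def
        by (rule gen) (rule fin [unfolded q_def q'_def])
    qed
    then show ?thesis by (simp add: D_def G_def C_def)
  qed
  \<comment> \<open>On the diagonal the three factors \<open>h u\<close> against one
    \<open>h v\<close> leave \<kappa> J, the fifth \<kappa>; the third J(\<tau>) comes from the
    difference M v - M \<tau>.\<close>
  define K where "K = \<kappa> ^ 5 * J \<tau> ^ 3"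
  have RR: "R1 (M v) * (1 / (J v)\<^sup>2) = K * R v" if v: "Im v > 0" "v \<noteq> \<tau>" for v
  proof -
    have "Q1 (M v) (M v) * h v = (\<kappa> ^ 4 * (h v)\<^sup>2 * (J \<tau>)\<^sup>2 * Q v v) * h v"
      unfolding Q1Q [OF v(1,1)] by (simp add: power2_eq_square power3_eq_cube)
    then have "Q1 (M v) (M v) = \<kappa> ^ 4 * (h v)\<^sup>2 * (J \<tau>)\<^sup>2 * Q v v"
      using h0 [OF v(1)] by simp
    then have "\<i> * ((v - \<tau>) / (J v * J \<tau>)) * R1 (M v) = \<kappa> ^ 4 * (\<kappa> * J v) * (J \<tau>)\<^sup>2 * (\<i> * (v - \<tau>) * R v)"
      unfolding QR1 [OF ImM [OF v(1)]] QR [OF v(1)] Mdiff [OF v(1) \<tau>] h2 [OF v(1)] .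
    then have "(\<i> * (v - \<tau>)) * (R1 (M v) / (J v * J \<tau>)) = (\<i> * (v - \<tau>)) * (\<kappa> ^ 5 * J v * (J \<tau>)\<^sup>2 * R v)"
      by (simp add: eval_nat_numeral mult_ac)
    then have "R1 (M v) / (J v * J \<tau>) = \<kappa> ^ 5 * J v * (J \<tau>)\<^sup>2 * R v"
      using v(2) by (subst (asm) mult_left_cancel) auto
    then show ?thesis
      unfolding K_def using J0 [OF v(1)] J0 [OF \<tau>] by (simp add: field_simps eval_nat_numeral)
  qed
  obtain P where P: "\<And>v. v \<in> UH \<Longrightarrow> (P has_field_derivative R v) (at v within UH)"
    using holomorphic_convex_primitive' [OF convex_UH open_UH R] by blast
  obtain P1 where P1: "\<And>v. v \<in> UH \<Longrightarrow> (P1 has_field_derivative R1 v) (at v within UH)"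
    using holomorphic_convex_primitive' [OF convex_UH open_UH R1] by blast
  have int: "contour_integral (geodesic u v) S = p v - p u" 
    if "\<And>v. v \<in> UH \<Longrightarrow> (p has_field_derivative S v) (at v within UH)" "Im u > 0" "Im v > 0" for p S u v
  proof -
    have "(S has_contour_integral (p (pathfinish (geodesic u v)) - p (pathstart (geodesic u v)))) (geodesic u v)"
    proof (rule contour_integral_primitive [OF that(1) valid_path_geodesic])
      show "path_image (geodesic u v) \<subseteq> UH"
        using geodesic_upper_half_plane [OF that(2,3)] by blast
    qed
    then show ?thesis by (simp add: contour_integral_unique pathstart_geodesic pathfinish_geodesic)
  qed
  define B where "B = (\<lambda>v. P1 (M v) - K * P v)"
  have B': "(B has_field_derivative R1 (M v) * (1 / (J v)\<^sup>2) - K * R v) (at v)" if v: "Im v > 0" for v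
  proof -
    have P': "(P has_field_derivative R v) (at v)" "(P1 has_field_derivative R1 (M v)) (at (M v))"
      using P [of v] P1 [of "M v"] v ImM [OF v] by (simp_all add: at_within_open [OF _ open_UH])
    show ?thesis
      unfolding B_def by (intro DERIV_diff DERIV_chain2 [OF P'(2) M' [OF v]] DERIV_cmult P'(1))
  qed
  \<comment> \<open>The relation between \<open>R1\<close> and \<open>R\<close> was obtained by
    dividing by v - \<tau>; continuity of \<open>B\<close> bridges the point \<tau>.\<close>
  have "B constant_on UH"
  proof (rule DERIV_zero_connected_constant_on [where K = "{\<tau>}"])
    show "continuous_on UH B"
      using B' DERIV_isCont by (auto intro!: continuous_at_imp_continuous_on)
    show "\<forall>v\<in>UH - {\<tau>}. (B has_field_derivative 0) (at v)"
      using B' RR by force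
  qed (use open_UH convex_UH in \<open>auto simp: convex_connected\<close>)
  then have "B w = B \<tau>"
    using w \<tau> unfolding constant_on_def by (metis mem_Collect_eq)
  then have PP: "P1 (M w) - P1 (M \<tau>) = K * (P w - P \<tau>)"
    by (simp add: B_def algebra_simps)
  have "M w \<noteq> M \<tau>"
    using Mdiff [OF w \<tau>] J0 [OF w] J0 [OF \<tau>] assms(3) by auto
  then have "Phi_hat (M \<tau>) (M w) = 1 / of_real pi * (P1 (M w) - P1 (M \<tau>))"
    using Phi1 [OF ImM [OF w]] int [OF P1 ImM [OF \<tau>] ImM [OF w]] by simp
  also have "\<dots> = K * (1 / of_real pi * (P w - P \<tau>))"
    unfolding PP by simp
  also have "1 / of_real pi * (P w - P \<tau>) = Phi_hat \<tau> w"
    using Phi [OF w] assms(3) int [OF P \<tau> w] by simp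
  also have "K = nu_eta a b c d ^ 10 * J \<tau> ^ 3"
    unfolding K_def nu_eta_square [OF \<kappa> det, symmetric] by (simp flip: power_mult)
  finally show ?thesis
    by (simp only: M_def moebius_def J_def)
qed

end
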